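(* Let $n\ge 2$ and let $\mathcal U$ be a complete system of representatives of $\mathcal O_F^\times/\mathcal O_F^{\times2}$ containing $1$ and $\Delta$ such that $d(\delta)=\operatorname{ord}(\delta-1)$ for all $\delta\in\mathcal U$ (with $d(1)=\infty$ understood). (i) If $n$ is even, a minimal testing set for $n$-universality consists of the lattices $\mathbf H^{n/2}$; $\mathbf H^{(n-4)/2}\perp 2^{-1}A(2,2\rho)\perp 2^{-1}\pi A(2,2\rho)$ (only if $n\ge4$); $\mathbf H^{(n-2)/2}\perp 2^{-1}A(2,2\rho)$; $\mathbf H^{(n-2)/2}\perp 2^{-1}\pi A(2,2\rho)$; $\mathbf H^{(n-2)/2}\perp \pi^{\frac{1-d(\delta)}{2}}A\big(\pi^{\frac{d(\delta)-1}{2}},-(\delta-1)\pi^{\frac{1-d(\delta)}{2}}\big)$; $\mathbf H^{(n-2)/2}\perp (1+4\rho(\delta-1)^{-1})\pi^{\frac{1-d(\delta)}{2}}A\big(\pi^{\frac{d(\delta)-1}{2}},-(\delta-1)\pi^{\frac{1-d(\delta)}{2}}\big)$; $\mathbf H^{(n-2)/2}\perp\langle 1,-\varepsilon\pi\rangle$; $\mathbf H^{(n-2)/2}\perp\langle\Delta,-\Delta\varepsilon\pi\rangle$, for all $\varepsilon\in\mathcal U$ and all $\delta\in\mathcal U\setminus\{1,\Delta\}$. (ii) If $n$ is odd, a minimal testing set for $n$-universality consists of the lattices $\mathbf H^{(n-1)/2}\perp\langle\varepsilon\rangle$, $\mathbf H^{(n-3)/2}\perp2^{-1}\pi A(2,2\rho)\perp\langle\Delta\varepsilon\rangle$,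 $\mathbf H^{(n-1)/2}\perp\langle\varepsilon\pi\rangle$, $\mathbf H^{(n-3)/2}\perp 2^{-1}A(2,2\rho)\perp\langle\Delta\varepsilon\pi\rangle$, for all $\varepsilon\in\mathcal U$.
   Context: $F$ is a dyadic local field (finite extension of $\mathbb Q_2$) with ring of integers $\mathcal O_F$, units $\mathcal O_F^\times$, uniformizer $\pi$, normalized valuation $\operatorname{ord}$, $e=\operatorname{ord}(2)$. For $c\in F^\times$, $\mathfrak d(c)=\bigcap_{x\in F}(c-x^2)\mathcal O_F$ and $d(c)=\operatorname{ord}(c^{-1}\mathfrak d(c))$. Fix $\rho\in\mathcal O_F^\times$ such that $\Delta:=1-4\rho$ satisfies $\mathfrak d(\Delta)=4\mathcal O_F$. Lattices are nondegenerate $\mathcal O_F$-lattices; $L$ is integral if $Q(L)\subseteq\mathcal O_F$; an integral lattice is $n$-universal if it represents (embeds isometrically) every integral lattice of rank $n$. $\langle a_1,\ldots,a_k\rangle$ denotes the lattice with an orthogonal basis $x_i$, $Q(x_i)=a_i$. For $\gamma\in F^\times$, $\xi,\eta\in F$, $\gamma A(\xi,\eta)$ is the binary lattice with Gram matrix $\begin{pmatrix}\gamma\xi&\gamma\\ \gamma&\gamma\eta\end{pmatrix}$; $\mathbf H=2^{-1}A(0,0)$ and $\mathbf H^k$ is the orthogonal sum of $k$ copies ($\mathbf H^0=0$). A set of rank-$n$ lattices is a testing set for $n$-universality if every integral lattice representing all lattices in the set is $n$-universal; it is minimal if no proper subset is a testing set. *)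

theory Defs
  imports "Jordan_Normal_Form.Determinant" "HOL-Library.Extended_Nat"
begin

text \<open>The field F is the type 'a; v is the normalized valuation ord (v 0 is irrelevant).\<close>

definition intO :: "('a::field \<Rightarrow> int) \<Rightarrow> 'a \<Rightarrow> bool" where
  "intO v x \<longleftrightarrow> x = 0 \<or> 0 \<le> v x"

definition unitO :: "('a::field \<Rightarrow> int) \<Rightarrow> 'a \<Rightarrow> bool" where
  "unitO v x \<longleftrightarrow> x \<noteq> 0 \<and> v x = 0"

text \<open>A complete discretely valued field of characteristic 0 whose residue field is
  finite of characteristic 2, i.e. a finite extension of Q_2.\<close>
definition dyadic_local_field :: "('a::field \<Rightarrow> int) \<Rightarrow> bool" where
  "dyadic_local_field v \<longleftrightarrow>
     (\<forall>x y. x \<noteq> 0 \<longrightarrow> y \<noteq> 0 \<longrightarrow> v (x * y) = v x + v y)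
   \<and> (\<forall>x y. x \<noteq> 0 \<longrightarrow> y \<noteq> 0 \<longrightarrow> x + y \<noteq> 0 \<longrightarrow> min (v x) (v y) \<le> v (x + y))
   \<and> (\<exists>p. p \<noteq> 0 \<and> v p = 1)
   \<and> (\<forall>s :: nat \<Rightarrow> 'a.
        (\<forall>k. \<exists>N. \<forall>m\<ge>N. \<forall>n\<ge>N. s m = s n \<or> k \<le> v (s m - s n)) \<longrightarrow>
        (\<exists>l. \<forall>k. \<exists>N. \<forall>m\<ge>N. s m = l \<or> k \<le> v (s m - l)))
   \<and> (\<exists>R. finite R \<and> R \<subseteq> {x. intO v x} \<and>
          (\<forall>x. intO v x \<longrightarrow> (\<exists>r\<in>R. x = r \<or> 1 \<le> v (x - r))))
   \<and> (2::'a) \<noteq> 0 \<and> 1 \<le> v 2"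

definition frac_ideal :: "('a::field \<Rightarrow> int) \<Rightarrow> 'a \<Rightarrow> 'a set" where
  "frac_ideal v a = {y. y = 0 \<or> (a \<noteq> 0 \<and> v a \<le> v y)}"

definition dideal :: "('a::field \<Rightarrow> int) \<Rightarrow> 'a \<Rightarrow> 'a set" where
  "dideal v c = (\<Inter>x. frac_ideal v (c - x^2))"

text \<open>d(c) = ord(c^{-1} d(c)), with value infinity if d(c) = 0.\<close>
definition dval :: "('a::field \<Rightarrow> int) \<Rightarrow> 'a \<Rightarrow> enat" where
  "dval v c = (if \<exists>a. a \<noteq> 0 \<and> dideal v c = frac_ideal v a
     then enat (nat (v (SOME a. a \<noteq> 0 \<and> dideal v c = frac_ideal v a) - v c))
     else \<infinity>)"

text \<open>d(c) as an integer (meaningful when d(c) is finite).\<close>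
definition dint :: "('a::field \<Rightarrow> int) \<Rightarrow> 'a \<Rightarrow> int" where
  "dint v c = int (the_enat (dval v c))"

text \<open>A lattice of rank k is given by its Gram matrix w.r.t. an O_F-basis
  (every lattice over the DVR O_F is free). Nondegenerate: det nonzero.\<close>
definition is_lattice :: "nat \<Rightarrow> 'a::field mat \<Rightarrow> bool" where
  "is_lattice k G \<longleftrightarrow> G \<in> carrier_mat k k \<and> G\<^sup>T = G \<and> det G \<noteq> 0"

definition integral_vec :: "('a::field \<Rightarrow> int) \<Rightarrow> 'a vec \<Rightarrow> bool" where
  "integral_vec v x \<longleftrightarrow> (\<forall>i < dim_vec x. intO v (x $ i))"

definition integral_lattice :: "('a::field \<Rightarrow> int) \<Rightarrow> 'a mat \<Rightarrow> bool" where
  "integral_lattice v G \<longleftrightarrow>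
     (\<forall>x \<in> carrier_vec (dim_row G). integral_vec v x \<longrightarrow> intO v (x \<bullet> (G *\<^sub>v x)))"

text \<open>L represents M: there is an isometric O_F-linear map M \<rightarrow> L, i.e. an integral
  matrix X with X G_L X^T = G_M.\<close>
definition represents :: "('a::field \<Rightarrow> int) \<Rightarrow> 'a mat \<Rightarrow> 'a mat \<Rightarrow> bool" where
  "represents v L M \<longleftrightarrow>
     (\<exists>X \<in> carrier_mat (dim_row M) (dim_row L).
        (\<forall>i < dim_row M. \<forall>j < dim_row L. intO v (X $$ (i, j))) \<and> X * L * X\<^sup>T = M)"

definition n_universal :: "('a::field \<Rightarrow> int) \<Rightarrow> nat \<Rightarrow> 'a mat \<Rightarrow> bool" where
  "n_universal v n L \<longleftrightarrow> integral_lattice v L \<and>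
     (\<forall>M. is_lattice n M \<and> integral_lattice v M \<longrightarrow> represents v L M)"

definition testing_set :: "('a::field \<Rightarrow> int) \<Rightarrow> nat \<Rightarrow> 'a mat set \<Rightarrow> bool" where
  "testing_set v n S \<longleftrightarrow> (\<forall>M \<in> S. is_lattice n M) \<and>
     (\<forall>L k. is_lattice k L \<and> integral_lattice v L \<and> (\<forall>M \<in> S. represents v L M)
            \<longrightarrow> n_universal v n L)"

definition minimal_testing_set :: "('a::field \<Rightarrow> int) \<Rightarrow> nat \<Rightarrow> 'a mat set \<Rightarrow> bool" where
  "minimal_testing_set v n S \<longleftrightarrow> testing_set v n S \<and> (\<forall>S' \<subset> S. \<not> testing_set v n S')"

definition osum :: "'a::zero mat \<Rightarrow> 'a mat \<Rightarrow> 'a mat" (infixr \<open>\<perp>\<^sub>L\<close> 65) where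
  "A \<perp>\<^sub>L B = four_block_mat A (0\<^sub>m (dim_row A) (dim_col B)) (0\<^sub>m (dim_row B) (dim_col A)) B"

definition diagL :: "'a::zero list \<Rightarrow> 'a mat" where
  "diagL as = mat (length as) (length as) (\<lambda>(i, j). if i = j then as ! i else 0)"

definition Abin :: "'a::field \<Rightarrow> 'a \<Rightarrow> 'a \<Rightarrow> 'a mat" where
  "Abin \<gamma> \<xi> \<eta> = mat_of_rows_list 2 [[\<gamma> * \<xi>, \<gamma>], [\<gamma>, \<gamma> * \<eta>]]"

definition Hyp :: "'a::field mat" where
  "Hyp = Abin (1/2) 0 0"

fun Hpow :: "nat \<Rightarrow> 'a::field mat" where
  "Hpow 0 = 0\<^sub>m 0 0"
| "Hpow (Suc k) = Hyp \<perp>\<^sub>L Hpow k"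

end

theory Submission
  imports Defs "HOL-Combinatorics.List_Permutation"
begin

text \<open>Every listed lattice is \<open>H\<^sup>k \<perp> A\<close>, where \<open>A\<close> is anisotropic and contains all vectors of its space
  with integral value; hence it represents each integral lattice that it represents over the field,
  and the theorem becomes one about quadratic spaces. Adding one diagonal entry at a time shows that
  every space is a listed one. The essential inputs are that norm groups of quadratic extensions have
  index at most two (by explicit approximation with norms and Artin-Schreier theory in the residue
  field) and Witt cancellation. For minimality, each listed space \<open>V\<close> is avoided by a space of dimension
  \<open>n + 2\<close> that represents all others: the determinant forces the complement of \<open>V\<close> to be a
  hyperbolic plane \<open>H\<close>, and one takes the space with the determinant of \<open>V \<perp> H\<close> not isometric to it.\<close>

section \<open>Valuations and the residue field\<close>

text \<open>The obstacle is residue characteristic two: every unit is a square modulo the maximal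
  ideal, so norms must be compared up to the order of a divisor of 4, where \<open>t^2 + t\<close>
  takes over from squaring. The role of the Hilbert symbol is played by one explicit element
  \<open>c\<close> for each nonsquare class \<open>D\<close>. Multiplication by \<open>c\<close>
  turns every non-norm from \<open>F(sqrt D)\<close> into a norm, which bounds the index by two. The
  norm group is proper because \<open>bin 1 D + {#- c#}\<close> is isometric to a ternary form
  \<open>tern x\<close> that omits the value \<open>x\<close>: norms from the unramified extension
  have even order, and the equation to be solved has sides of different parity. Anisotropy over
  ramified extensions is thus also reduced to parity of orders. The three shapes of
  \<open>c\<close>, namely \<open>\<pi>\<close>, \<open>\<Delta>\<close> and
  \<open>1 + 4 * \<rho> * inverse (\<delta> - 1)\<close>, are the factors by which the two listed
  binary spaces of one discriminant differ.\<close>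

locale dyadic =
  fixes v :: "'a::field \<Rightarrow> int"
  assumes dyadic: "dyadic_local_field v"
begin

lemma v_mult: "x \<noteq> 0 \<Longrightarrow> y \<noteq> 0 \<Longrightarrow> v (x * y) = v x + v y"
  using dyadic unfolding dyadic_local_field_def by blast

lemma v_add: "x \<noteq> 0 \<Longrightarrow> y \<noteq> 0 \<Longrightarrow> x + y \<noteq> 0 \<Longrightarrow> min (v x) (v y) \<le> v (x + y)"
  using dyadic unfolding dyadic_local_field_def by blast

lemma two_nz [simp]: "(2::'a) \<noteq> 0" and e_pos: "1 \<le> v 2"
  using dyadic unfolding dyadic_local_field_def by blast+

lemma four_nz [simp]: "(4::'a) \<noteq> 0"
  using two_nz mult_eq_0_iff[of "2::'a" 2] by simp

lemma v_one [simp]: "v 1 = 0"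
  using v_mult[of 1 1] by simp

lemma v_uminus [simp]: "v (- x) = v x"
proof (cases "x = 0")
  case False
  have "v (- 1) + v (- 1) = 0"
    using v_mult[of "-1" "-1"] by simp
  then have "v (- 1) = 0" by simp
  then show ?thesis using v_mult[of "-1" x] False by simp
qed simp

lemma v_inverse: "x \<noteq> 0 \<Longrightarrow> v (inverse x) = - v x"
  using v_mult[of x "inverse x"] by simp

lemma v_divide: "x \<noteq> 0 \<Longrightarrow> y \<noteq> 0 \<Longrightarrow> v (x / y) = v x - v y"
  using v_mult[of x "inverse y"] v_inverse[of y] by (simp add: divide_inverse)

lemma v_power: "x \<noteq> 0 \<Longrightarrow> v (x ^ n) = int n * v x"
  by (induction n) (auto simp: v_mult algebra_simps)

lemma v_powi: "x \<noteq> 0 \<Longrightarrow> v (x powi k) = k * v x"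
  by (auto simp: power_int_def v_power v_inverse)

lemma v_four: "v 4 = 2 * v 2"
  using v_mult[of 2 2] by simp

text \<open>Membership in the \<open>k\<close>-th power of the maximal ideal. The disjunct for 0
  shields the arbitrary value \<open>v 0\<close>, so that sums and products need no case
  distinction.\<close>

definition vge :: "'a \<Rightarrow> int \<Rightarrow> bool" where
  "vge x k \<longleftrightarrow> x = 0 \<or> k \<le> v x"

lemma vge_0 [simp]: "vge 0 k" by (simp add: vge_def)

lemma vge_mono: "vge x k \<Longrightarrow> j \<le> k \<Longrightarrow> vge x j"
  by (auto simp: vge_def)

lemma vge_v: "vge x (v x)" by (simp add: vge_def)

lemma vge_add: "vge x k \<Longrightarrow> vge y k \<Longrightarrow> vge (x + y) k"
  by (cases "x = 0"; cases "y = 0"; cases "x + y = 0") (use v_add[of x y] in \<open>auto simp: vge_def\<close>)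

lemma vge_uminus [simp]: "vge (- x) k = vge x k"
  by (auto simp: vge_def)

lemma vge_diff: "vge x k \<Longrightarrow> vge y k \<Longrightarrow> vge (x - y) k"
  using vge_add[of x k "- y"] by simp

lemma vge_minus_commute: "vge (x - y) k = vge (y - x) k"
  using vge_uminus[of "x - y" k] by simp

lemma vge_mult: "vge x j \<Longrightarrow> vge y k \<Longrightarrow> vge (x * y) (j + k)"
  by (cases "x = 0"; cases "y = 0") (auto simp: vge_def v_mult)

lemma vge_mult_le: "vge x j \<Longrightarrow> vge y k \<Longrightarrow> i \<le> j + k \<Longrightarrow> vge (x * y) i"
  using vge_mult vge_mono by blast

lemma vge_mult0: "vge x 0 \<Longrightarrow> vge y k \<Longrightarrow> vge (x * y) k"
  using vge_mult[of x 0 y k] by simp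

lemma vge_mult_iff: "x \<noteq> 0 \<Longrightarrow> vge (x * y) k \<longleftrightarrow> vge y (k - v x)"
  by (cases "y = 0") (auto simp: vge_def v_mult)

lemma vge_divide_iff: "x \<noteq> 0 \<Longrightarrow> vge (y / x) k \<longleftrightarrow> vge y (k + v x)"
  by (cases "y = 0") (auto simp: vge_def v_divide)

lemma vge_1 [simp]: "vge 1 0" by (simp add: vge_def)

lemma vge_2: "vge 2 1" using e_pos by (simp add: vge_def)

lemma intO_iff: "intO v x \<longleftrightarrow> vge x 0" by (simp add: intO_def vge_def)

text \<open>The equality case of the ultrametric inequality. It is also the usual source of
  nonvanishing below: 1 plus an element of the maximal ideal is a unit.\<close>

lemma v_add_less: "x \<noteq> 0 \<Longrightarrow> vge y (v x + 1) \<Longrightarrow> x + y \<noteq> 0 \<and> v (x + y) = v x"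
proof -
  assume x: "x \<noteq> 0" and y: "vge y (v x + 1)"
  show ?thesis
  proof (cases "y = 0")
    case False
    then have yv: "v x < v y" using y by (simp add: vge_def)
    have nz: "x + y \<noteq> 0" using yv by (metis add_eq_0_iff v_uminus less_irrefl)
    have "min (v (x + y)) (v (- y)) \<le> v (x + y + - y)"
      using v_add[of "x + y" "- y"] nz False x by simp
    moreover have "min (v x) (v y) \<le> v (x + y)" using v_add nz x False by blast
    ultimately show ?thesis using yv nz by auto
  qed (use x in simp)
qed

lemma vge_square1: "vge (x * x) 1 \<Longrightarrow> vge x 1"
  by (cases "x = 0") (auto simp: vge_def v_mult)

text \<open>Iterating \<open>t \<mapsto> w - t\<^sup>2\<close> contracts the maximal ideal, which is Hensel's lemma for this equation.\<close>

lemma artin_schreier_small: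
  assumes w: "vge w 1"
  obtains t where "vge t 1" "t^2 + t = w"
proof -
  define s where "s = rec_nat (0::'a) (\<lambda>_ t. w - t^2)"
  have s0: "s 0 = 0" and sS: "s (Suc n) = w - (s n)^2" for n by (simp_all add: s_def)
  have s1: "vge (s n) 1" for n
  proof (induction n)
    case (Suc n)
    have "vge ((s n)^2) 1" using vge_mult_le[OF Suc Suc] by (simp add: power2_eq_square)
    then show ?case using w by (simp add: sS vge_diff)
  qed (simp add: s0)
  have step: "vge (s (Suc n) - s n) (int n + 1)" for n
  proof (induction n)
    case 0 then show ?case using s1 by (simp add: s0)
  next
    case (Suc n)
    have "s (Suc (Suc n)) - s (Suc n) = - ((s (Suc n) - s n) * (s (Suc n) + s n))"
      by (simp add: sS power2_eq_square algebra_simps)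
    moreover have "vge ((s (Suc n) - s n) * (s (Suc n) + s n)) (int n + 1 + 1)"
      by (rule vge_mult[OF Suc]) (rule vge_add[OF s1 s1])
    ultimately show ?case by (simp add: vge_mono)
  qed
  have cau: "vge (s (n + j) - s n) (int n + 1)" for n j
  proof (induction j)
    case (Suc j)
    have "s (n + Suc j) - s n = (s (Suc (n + j)) - s (n + j)) + (s (n + j) - s n)" by simp
    moreover have "vge (s (Suc (n + j)) - s (n + j)) (int n + 1)"
      using vge_mono[OF step[of "n + j"]] by simp
    ultimately show ?case using Suc vge_add by metis
  qed simp
  have cau2: "vge (s m - s n) k" if "nat k \<le> m" "nat k \<le> n" for m n k
  proof -
    have "vge (s m - s (nat k)) k" "vge (s n - s (nat k)) k"
      using cau[of "nat k" "m - nat k"] cau[of "nat k" "n - nat k"] that by (auto elim!: vge_mono)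
    then have "vge ((s m - s (nat k)) - (s n - s (nat k))) k" by (rule vge_diff)
    then show ?thesis by simp
  qed
  have "\<forall>k. \<exists>N. \<forall>m\<ge>N. \<forall>n\<ge>N. s m = s n \<or> k \<le> v (s m - s n)"
    using cau2 unfolding vge_def by (metis eq_iff_diff_eq_0)
  then obtain l where l: "\<forall>k. \<exists>N. \<forall>m\<ge>N. s m = l \<or> k \<le> v (s m - l)"
    using dyadic unfolding dyadic_local_field_def by blast
  have lk: "\<exists>N. \<forall>m\<ge>N. vge (s m - l) k" for k using l unfolding vge_def by (metis eq_iff_diff_eq_0)
  have l1: "vge l 1"
  proof -
    obtain N where "vge (s N - l) 1" using lk by blast
    then have "vge (s N - (s N - l)) 1" using s1 vge_diff by blast
    then show ?thesis by simp
  qed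
  have close: "vge (l^2 + l - w) k" for k
  proof -
    define k' where "k' = max k 1"
    obtain N where N: "\<forall>m\<ge>N. vge (s m - l) k'" using lk by blast
    have a: "vge (l - s (Suc N)) k'" and b: "vge (l - s N) k'"
      using N by (auto simp: vge_minus_commute[of l])
    have "l^2 + l - w = (l - s (Suc N)) + (l - s N) * (l + s N)"
      by (simp add: sS power2_eq_square algebra_simps)
    moreover have "vge ((l - s N) * (l + s N)) k'"
      using vge_mult_le[OF b vge_add[OF l1 s1]] by simp
    ultimately have "vge (l^2 + l - w) k'" using a vge_add by metis
    then show ?thesis by (rule vge_mono) (simp add: k'_def)
  qed
  \<comment> \<open>Only 0 has order at least \<open>k\<close> for every \<open>k\<close>; the order
    tested exceeds that of the element by one.\<close>
  have "l^2 + l - w = 0"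
    using close[of "v (l^2 + l - w) + 1"] by (auto simp: vge_def)
  then show ?thesis using that l1 by simp
qed

text \<open>A Newton step: \<open>u = 1 + 2 * t\<close> is the derivative of \<open>t^2 + t\<close>
  and a unit, and replacing \<open>t\<close> by \<open>t + u * z\<close> adds
  \<open>u^2 * (z^2 + z)\<close>. What remains is the same equation with right-hand side in the
  maximal ideal.\<close>

lemma artin_schreier_lift:
  assumes w: "vge (w - t^2 - t) 1" and t: "vge t 0"
  obtains t' where "t'^2 + t' = w"
proof -
  define u where "u = 1 + 2 * t"
  have u: "u \<noteq> 0" "v u = 0"
    using v_add_less[of 1 "2 * t"] vge_mult[OF vge_2 t] by (auto simp: u_def)
  have "vge ((w - t^2 - t) / u^2) 1"
    using u w by (simp add: vge_divide_iff v_power)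
  then obtain z where z: "z^2 + z = (w - t^2 - t) / u^2"
    using artin_schreier_small by blast
  have "(t + u * z)^2 + (t + u * z) = t^2 + t + u^2 * (z^2 + z)"
    by (simp add: u_def power2_eq_square algebra_simps)
  also have "\<dots> = w" using u z by simp
  finally show ?thesis using that by blast
qed

text \<open>Residue classes are plain sets of integral elements. No field structure is put on them,
  since the arguments below only count classes.\<close>

definition res :: "'a \<Rightarrow> 'a set" where
  "res x = {y. vge y 0 \<and> vge (x - y) 1}"

definition resfield :: "'a set set" where
  "resfield = res ` {x. vge x 0}"

lemma res_eq_iff:
  assumes "vge x 0" "vge y 0"
  shows "res x = res y \<longleftrightarrow> vge (x - y) 1"
proof
  assume "res x = res y"
  then have "y \<in> res x" using assms by (simp add: res_def)
  then show "vge (x - y) 1" by (simp add: res_def)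
next
  assume a: "vge (x - y) 1"
  have "vge (x - z) 1 = vge (y - z) 1" for z
    using vge_add[of "x - y" 1 "y - z"] vge_diff[of "x - z" 1 "x - y"] a by auto
  then show "res x = res y" by (auto simp: res_def)
qed

lemma finite_resfield: "finite resfield"
proof -
  obtain R where R: "finite R" "R \<subseteq> {x. intO v x}"
    and c: "\<forall>x. intO v x \<longrightarrow> (\<exists>r\<in>R. x = r \<or> 1 \<le> v (x - r))"
    using dyadic unfolding dyadic_local_field_def by blast
  have "resfield \<subseteq> res ` R"
  proof
    fix X assume "X \<in> resfield"
    then obtain x where x: "vge x 0" "X = res x" by (auto simp: resfield_def)
    then obtain r where r: "r \<in> R" "x = r \<or> 1 \<le> v (x - r)" using c intO_iff by blast
    then have "vge (x - r) 1" by (auto simp: vge_def)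
    moreover have "vge r 0" using r R intO_iff by blast
    ultimately have "res x = res r" using x res_eq_iff by blast
    then show "X \<in> res ` R" using x r by blast
  qed
  then show ?thesis using R finite_surj by blast
qed

text \<open>Modulo 2, \<open>x^2 - y^2\<close> equals \<open>(x - y)^2\<close>, so squaring is
  injective on the residue field, and by finiteness it is surjective.\<close>

lemma residue_perfect:
  assumes a: "vge a 0"
  obtains s where "vge s 0" "vge (a - s^2) 1"
proof -
  \<comment> \<open>Squaring on residue classes, by way of a chosen representative; the next fact
    shows that the choice does not matter.\<close>
  define f where "f X = res ((SOME x. vge x 0 \<and> X = res x)^2)" for X
  have f: "f (res x) = res (x^2)" if x: "vge x 0" for x
  proof -
    define y where "y = (SOME y. vge y 0 \<and> res x = res y)"
    have y: "vge y 0 \<and> res x = res y"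
      unfolding y_def by (rule someI[of _ x]) (use x in simp)
    then have d: "vge (y - x) 1" using x res_eq_iff by metis
    have "vge ((y - x) * (y + x)) 1"
      using vge_mult_le[OF d vge_add[of y 0 x]] x y by simp
    then have "vge (y^2 - x^2) 1" by (simp add: power2_eq_square algebra_simps)
    moreover have "vge (y^2) 0" "vge (x^2) 0" using x y vge_mult0 by (auto simp: power2_eq_square)
    ultimately have "res (y^2) = res (x^2)" using res_eq_iff by blast
    then show ?thesis by (simp add: f_def y_def)
  qed
  have sq0: "vge (x^2) 0" if "vge x 0" for x using that vge_mult0 by (auto simp: power2_eq_square)
  have "inj_on f resfield"
  proof (rule inj_onI)
    fix X Y assume "X \<in> resfield" "Y \<in> resfield" and e: "f X = f Y"
    then obtain x y where x: "vge x 0" "X = res x" and y: "vge y 0" "Y = res y"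
      by (auto simp: resfield_def)
    have "vge (x^2 - y^2) 1" using e f x y sq0 res_eq_iff by metis
    moreover have "vge (2 * (y * (x - y))) 1"
      using vge_mult_le[OF vge_2 vge_mult0[OF y(1) vge_diff[OF x(1) y(1)]]] by simp
    ultimately have "vge (x^2 - y^2 - 2 * (y * (x - y))) 1" by (rule vge_diff)
    then have "vge ((x - y) * (x - y)) 1" by (simp add: power2_eq_square algebra_simps)
    then have "vge (x - y) 1" by (rule vge_square1)
    then show "X = Y" using x y res_eq_iff by blast
  qed
  moreover have "f ` resfield \<subseteq> resfield"
    using f sq0 by (auto simp: resfield_def)
  ultimately have "f ` resfield = resfield"
    using finite_resfield endo_inj_surj by blast
  moreover have "res a \<in> resfield" using a by (simp add: resfield_def)
  ultimately obtain X where "X \<in> resfield" "res a = f X" by blast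
  then obtain s where "vge s 0" "res a = res (s^2)" using f by (auto simp: resfield_def)
  then show ?thesis using that a sq0 res_eq_iff by blast
qed

end

section \<open>The unit \<rho> and the cosets of Artin-Schreier theory\<close>

locale dyadic_rho = dyadic +
  fixes \<rho> :: 'a
  assumes rho_unit: "unitO v \<rho>"
    and rho_dideal: "dideal v (1 - 4 * \<rho>) = frac_ideal v 4"
begin

definition Delta :: 'a ("\<Delta>") where "\<Delta> = 1 - 4 * \<rho>"

lemma rho_nz [simp]: "\<rho> \<noteq> 0" and v_rho [simp]: "v \<rho> = 0"
  using rho_unit by (auto simp: unitO_def)

lemma vge_rho [simp]: "vge \<rho> 0" by (simp add: vge_def)

text \<open>Completing the square gives
  \<open>\<Delta> - (1 + 2 * t)^2 = - (4 * (t^2 + t + \<rho>))\<close>. A root modulo the maximal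
  ideal would bring a square closer to \<open>\<Delta>\<close> than the defect \<open>4 O\<close>
  permits. So \<open>X^2 + X + \<rho>\<close> stays irreducible over the residue field.\<close>

lemma rho_irreducible:
  assumes t: "vge t 0" shows "\<not> vge (t^2 + t + \<rho>) 1"
proof
  assume a: "vge (t^2 + t + \<rho>) 1"
  have "4 \<in> dideal v \<Delta>" by (simp add: Delta_def rho_dideal frac_ideal_def)
  then have "4 \<in> frac_ideal v (\<Delta> - (1 + 2 * t)^2)" by (auto simp: dideal_def)
  then have b: "\<Delta> - (1 + 2 * t)^2 \<noteq> 0" "v (\<Delta> - (1 + 2 * t)^2) \<le> v 4"
    by (auto simp: frac_ideal_def)
  have "\<Delta> - (1 + 2 * t)^2 = - (4 * (t^2 + t + \<rho>))"
    by (simp add: Delta_def power2_eq_square algebra_simps)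
  then have "t^2 + t + \<rho> \<noteq> 0" "v 4 + v (t^2 + t + \<rho>) \<le> v 4"
    using b v_mult[of 4 "t^2 + t + \<rho>"] by (metis four_nz mult_zero_right neg_equal_0_iff_equal v_uminus)+
  then show False using a by (auto simp: vge_def)
qed

text \<open>On the residue field, \<open>t \<mapsto> t\<^sup>2 + t\<close> is two-to-one, so its image has index two, and \<open>\<rho>\<close> represents the other coset.\<close>

lemma artin_schreier_cosets:
  assumes w: "vge w 0"
  obtains t where "vge t 0" "vge (w - t^2 - t) 1 \<or> vge (w - \<rho> - t^2 - t) 1"
proof -
  define p where "p x = x^2 + x" for x :: 'a
  have p0: "vge (p x) 0" if "vge x 0" for x
    using that by (simp add: p_def power2_eq_square vge_add vge_mult0)
  have prho: "vge (\<rho> + p x) 0" if "vge x 0" for x using p0[OF that] by (simp add: vge_add)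
  have pdiff: "p x - p y = (x - y) * (x - y + 1) + 2 * (y * (x - y))" for x y
    by (simp add: p_def power2_eq_square algebra_simps)
  have peq: "vge (p x - p y) 1 \<longleftrightarrow> vge (x - y) 1 \<or> vge (x - (y + 1)) 1" (is "?L \<longleftrightarrow> ?R")
    if x: "vge x 0" and y: "vge y 0" for x y
  proof -
    have c: "vge (2 * (y * (x - y))) 1"
      using vge_mult_le[OF vge_2 vge_mult0[OF y vge_diff[OF x y]]] by simp
    have "?L \<longleftrightarrow> vge ((x - y) * (x - y + 1)) 1"
      using vge_add[OF _ c, of "(x - y) * (x - y + 1)"] vge_diff[OF _ c, of "p x - p y"]
      by (auto simp: pdiff)
    also have "\<dots> \<longleftrightarrow> vge (x - y) 1 \<or> vge (x - y + 1) 1"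
    proof
      assume "vge ((x - y) * (x - y + 1)) 1"
      then show "vge (x - y) 1 \<or> vge (x - y + 1) 1"
        using vge_diff[OF x y] vge_add[OF vge_diff[OF x y] vge_1]
        by (cases "x - y = 0"; cases "x - y + 1 = 0") (auto simp: vge_def v_mult)
    next
      assume "vge (x - y) 1 \<or> vge (x - y + 1) 1"
      then show "vge ((x - y) * (x - y + 1)) 1"
        using vge_mult_le[of "x - y" 1 "x - y + 1" 0 1] vge_mult_le[of "x - y" 0 "x - y + 1" 1 1]
          vge_diff[OF x y] vge_add[OF vge_diff[OF x y] vge_1] by auto
    qed
    also have "vge (x - y + 1) 1 \<longleftrightarrow> vge (x - (y + 1)) 1"
    proof -
      have "x - y + 1 = (x - (y + 1)) + 2" "x - (y + 1) = (x - y + 1) - 2" by simp_all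
      then show ?thesis using vge_add[OF _ vge_2] vge_diff[OF _ vge_2] by metis
    qed
    finally show ?thesis .
  qed
  define O0 where "O0 = {x. vge x 0}"
  define A where "A = (\<lambda>x. res (p x)) ` O0"
  define B where "B = (\<lambda>x. res (\<rho> + p x)) ` O0"
  have AB: "A \<subseteq> resfield" "B \<subseteq> resfield"
    using p0 prho by (auto simp: A_def B_def O0_def resfield_def)
  have fin: "finite A" "finite B" using AB finite_resfield finite_subset by blast+
  \<comment> \<open>If \<open>p x\<close> and \<open>\<rho> + p y\<close> agreed, then
    \<open>y - x\<close> would be a root of \<open>t^2 + t + \<rho>\<close> modulo the maximal
    ideal; all correction terms are multiples of 2.\<close>
  have disj: "A \<inter> B = {}"
  proof (rule ccontr)
    assume "A \<inter> B \<noteq> {}"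
    then obtain x y where xy: "vge x 0" "vge y 0" "res (p x) = res (\<rho> + p y)"
      by (auto simp: A_def B_def O0_def)
    then have "vge (p x - (\<rho> + p y)) 1" using p0 prho res_eq_iff by metis
    then have a: "vge (\<rho> + p y - p x) 1" by (simp add: vge_minus_commute)
    have "vge (2 * (p x - x * y)) 1"
      using vge_mult_le[OF vge_2 vge_diff[OF p0[OF xy(1)] vge_mult0[OF xy(1,2)]]] by simp
    with a have "vge (\<rho> + p y - p x + 2 * (p x - x * y)) 1" by (rule vge_add)
    moreover have "\<rho> + p y - p x + 2 * (p x - x * y) = (y - x)^2 + (y - x) + \<rho> + 2 * x"
      by (simp add: p_def power2_eq_square algebra_simps)
    moreover have "vge (2 * x) 1" using vge_mult_le[OF vge_2 xy(1)] by simp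
    ultimately have "vge ((y - x)^2 + (y - x) + \<rho> + 2 * x - 2 * x) 1" using vge_diff by metis
    then show False using rho_irreducible[OF vge_diff[OF xy(2,1)]] by (metis add_diff_cancel_right')
  qed
  define h where "h X = (SOME x. vge x 0 \<and> X = res (p x))" for X
  define g where "g X = (SOME x. vge x 0 \<and> X = res (\<rho> + p x))" for X
  have h: "vge (h (res (p x))) 0" "res (p x) = res (p (h (res (p x))))" if "vge x 0" for x
    using someI[of "\<lambda>y. vge y 0 \<and> res (p x) = res (p y)" x] that by (simp_all add: h_def)
  have g: "vge (g (res (\<rho> + p x))) 0" "res (\<rho> + p x) = res (\<rho> + p (g (res (\<rho> + p x))))"
    if "vge x 0" for x
    using someI[of "\<lambda>y. vge y 0 \<and> res (\<rho> + p x) = res (\<rho> + p y)" x] that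
    by (simp_all add: g_def)
  \<comment> \<open>A fibre of \<open>p\<close> consists of at most the two classes of
    \<open>h X\<close> and \<open>h X + 1\<close>, so \<open>A\<close> has at least half as many
    elements as the residue field. Translation by \<rho> gives the same for \<open>B\<close>, and
    two disjoint halves exhaust the field.\<close>
  have "resfield \<subseteq> (\<lambda>X. res (h X)) ` A \<union> (\<lambda>X. res (h X + 1)) ` A"
  proof
    fix X assume "X \<in> resfield"
    then obtain x where x: "vge x 0" "X = res x" by (auto simp: resfield_def)
    define y where "y = h (res (p x))"
    have y: "vge y 0" "res (p x) = res (p y)" using h[OF x(1)] by (simp_all add: y_def)
    have "vge (p x - p y) 1" using res_eq_iff[OF p0[OF x(1)] p0[OF y(1)]] y(2) by blast
    then have "res x = res y \<or> res x = res (y + 1)"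
      using peq[OF x(1) y(1)] res_eq_iff[OF x(1) y(1)] res_eq_iff[OF x(1) vge_add[OF y(1) vge_1]]
      by blast
    moreover have "res (p x) \<in> A" using x by (auto simp: A_def O0_def)
    ultimately show "X \<in> (\<lambda>X. res (h X)) ` A \<union> (\<lambda>X. res (h X + 1)) ` A"
      unfolding x(2) y_def by blast
  qed
  then have "card resfield \<le> card ((\<lambda>X. res (h X)) ` A \<union> (\<lambda>X. res (h X + 1)) ` A)"
    by (rule card_mono[rotated]) (use fin in simp)
  also have "\<dots> \<le> card ((\<lambda>X. res (h X)) ` A) + card ((\<lambda>X. res (h X + 1)) ` A)"
    by (rule card_Un_le)
  also have "\<dots> \<le> card A + card A"
    using card_image_le[OF fin(1)] by (rule add_mono) (rule card_image_le[OF fin(1)])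
  finally have c1: "card resfield \<le> card A + card A" .
  have "A \<subseteq> (\<lambda>X. res (p (g X))) ` B"
  proof
    fix X assume "X \<in> A"
    then obtain x where x: "vge x 0" "X = res (p x)" by (auto simp: A_def O0_def)
    define y where "y = g (res (\<rho> + p x))"
    have y: "vge y 0" "res (\<rho> + p x) = res (\<rho> + p y)" using g[OF x(1)] by (simp_all add: y_def)
    have "vge (p x - p y) 1"
      using res_eq_iff[OF prho[OF x(1)] prho[OF y(1)]] y(2) by (metis add_diff_cancel_left)
    then have "X = res (p y)" using res_eq_iff[OF p0[OF x(1)] p0[OF y(1)]] x(2) by blast
    moreover have "res (\<rho> + p x) \<in> B" using x by (auto simp: B_def O0_def)
    ultimately show "X \<in> (\<lambda>X. res (p (g X))) ` B" unfolding y_def by blast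
  qed
  then have "card A \<le> card B" using fin surj_card_le by blast
  then have "card resfield \<le> card (A \<union> B)" using c1 card_Un_disjoint[OF fin disj] by linarith
  then have "A \<union> B = resfield" using AB finite_resfield by (metis card_seteq Un_least)
  moreover have "res w \<in> resfield" using w by (simp add: resfield_def)
  ultimately have "res w \<in> A \<or> res w \<in> B" by blast
  then show ?thesis
  proof
    assume "res w \<in> A"
    then obtain x where x: "vge x 0" "res w = res (p x)" by (auto simp: A_def O0_def)
    then have "vge (w - p x) 1" using w p0 res_eq_iff by metis
    then show ?thesis using that x by (simp add: p_def algebra_simps)
  next
    assume "res w \<in> B"
    then obtain x where x: "vge x 0" "res w = res (\<rho> + p x)" by (auto simp: B_def O0_def)
    then have "vge (w - (\<rho> + p x)) 1" using w prho res_eq_iff by metis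
    then show ?thesis using that x by (simp add: p_def algebra_simps)
  qed
qed

end

section \<open>Norm groups of quadratic extensions\<close>

text \<open>For nonsquare \<open>D\<close>, the group of norms from \<open>F(sqrt D)\<close>. For a
  nonzero square the form is a hyperbolic plane, and the definition still makes sense.\<close>

definition normgroup :: "'a::field \<Rightarrow> 'a set" where
  "normgroup D = {c. c \<noteq> 0 \<and> (\<exists>x y. c = x^2 - D * y^2)}"

definition sqeq :: "'a::field \<Rightarrow> 'a \<Rightarrow> bool" where
  "sqeq a b \<longleftrightarrow> (\<exists>s. s \<noteq> 0 \<and> a = b * s^2)"

lemma sqeq_refl [simp]: "sqeq a a"
  unfolding sqeq_def by (rule exI[of _ 1]) simp

lemma sqeq_sym: "sqeq a b \<Longrightarrow> sqeq b a"
proof -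
  assume "sqeq a b"
  then obtain s where "s \<noteq> 0" "a = b * s^2" by (auto simp: sqeq_def)
  then show "sqeq b a" unfolding sqeq_def
    by (intro exI[of _ "1 / s"]) (simp add: power_divide)
qed

lemma sqeq_trans: "sqeq a b \<Longrightarrow> sqeq b c \<Longrightarrow> sqeq a c"
proof -
  assume "sqeq a b" "sqeq b c"
  then obtain s t where "s \<noteq> 0" "a = b * s^2" "t \<noteq> 0" "b = c * t^2" by (auto simp: sqeq_def)
  then show "sqeq a c" unfolding sqeq_def
    by (intro exI[of _ "t * s"]) (simp add: power_mult_distrib)
qed

lemma sqeq_mult: "sqeq a b \<Longrightarrow> sqeq c d \<Longrightarrow> sqeq (a * c) (b * d)"
proof -
  assume "sqeq a b" "sqeq c d"
  then obtain s t where "s \<noteq> 0" "a = b * s^2" "t \<noteq> 0" "c = d * t^2" by (auto simp: sqeq_def)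
  then show ?thesis unfolding sqeq_def
    by (intro exI[of _ "s * t"]) (simp add: power_mult_distrib)
qed

lemma sqeqI: "s \<noteq> 0 \<Longrightarrow> a = b * s^2 \<Longrightarrow> sqeq a b"
  by (auto simp: sqeq_def)

lemma normgroup_nz: "c \<in> normgroup D \<Longrightarrow> c \<noteq> 0"
  by (simp add: normgroup_def)

lemma normgroupI: "c \<noteq> 0 \<Longrightarrow> c = x^2 - D * y^2 \<Longrightarrow> c \<in> normgroup D"
  by (auto simp: normgroup_def)

lemma normgroup_square: "s \<noteq> 0 \<Longrightarrow> s^2 \<in> normgroup D"
  by (rule normgroupI[of _ s D 0]) auto

lemma normgroup_1 [simp]: "1 \<in> normgroup D"
  using normgroup_square[of 1 D] by simp

lemma normgroup_uminus: "D \<noteq> 0 \<Longrightarrow> - D \<in> normgroup D"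
  by (rule normgroupI[of _ 0 D 1]) auto

lemma normgroup_mult:
  assumes "a \<in> normgroup D" "b \<in> normgroup D" shows "a * b \<in> normgroup D"
proof -
  obtain x y z w where ab: "a = x^2 - D * y^2" "b = z^2 - D * w^2" and nz: "a \<noteq> 0" "b \<noteq> 0"
    using assms by (auto simp: normgroup_def)
  have "a * b = (x * z + D * y * w)^2 - D * (x * w + y * z)^2"
    unfolding ab by (simp add: power2_eq_square algebra_simps)
  then show ?thesis using nz by (intro normgroupI) auto
qed

lemma normgroup_inverse:
  assumes "a \<in> normgroup D" shows "1 / a \<in> normgroup D"
proof -
  have "a * (1 / a)^2 \<in> normgroup D"
    by (rule normgroup_mult[OF assms normgroup_square]) (use normgroup_nz[OF assms] in simp)
  moreover have "a * (1 / a)^2 = 1 / a"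
    using normgroup_nz[OF assms] by (simp add: power2_eq_square)
  ultimately show ?thesis by simp
qed

lemma normgroup_divide: "a \<in> normgroup D \<Longrightarrow> b \<in> normgroup D \<Longrightarrow> a / b \<in> normgroup D"
  using normgroup_mult[OF _ normgroup_inverse, of a D b] by simp

lemma normgroup_mult_iff:
  assumes "g \<in> normgroup D" shows "c * g \<in> normgroup D \<longleftrightarrow> c \<in> normgroup D"
  using normgroup_mult[OF _ assms] normgroup_divide[OF _ assms] normgroup_nz[OF assms]
  by (metis nonzero_mult_div_cancel_right)

lemma normgroup_sqeq:
  assumes "sqeq D E" shows "normgroup D = normgroup E"
proof -
  have "normgroup D \<subseteq> normgroup E" if "sqeq D E" for D E :: 'a
  proof
    fix c assume "c \<in> normgroup D"
    then obtain x y where c: "c \<noteq> 0" "c = x^2 - D * y^2" by (auto simp: normgroup_def)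
    obtain s where "D = E * s^2" using \<open>sqeq D E\<close> by (auto simp: sqeq_def)
    then show "c \<in> normgroup E"
      using c by (intro normgroupI[of _ x E "s * y"]) (auto simp: power_mult_distrib)
  qed
  then show ?thesis using assms sqeq_sym by blast
qed

context dyadic
begin

lemma normgroup_of_one:
  assumes "(c::'a) \<noteq> 0" shows "c \<in> normgroup 1"
proof (rule normgroupI)
  have "((c + 1) / 2)^2 - 1 * ((c - 1) / 2)^2 = ((c + 1) / 2 + (c - 1) / 2) * ((c + 1) / 2 - (c - 1) / 2)"
    by (simp add: power2_eq_square algebra_simps)
  moreover have "(c + 1) / 2 + (c - 1) / 2 = c" "(c + 1) / 2 - (c - 1) / 2 = 1"
    by (simp_all add: add_divide_distrib[symmetric] diff_divide_distrib[symmetric] mult_2[symmetric])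
  ultimately show "c = ((c + 1) / 2)^2 - 1 * ((c - 1) / 2)^2" by simp
qed (fact assms)

text \<open>The symmetry of the Hilbert symbol, obtained by solving \<open>c = x^2 - D * y^2\<close>
  for \<open>D\<close>. If \<open>y = 0\<close>, then \<open>c\<close> is a square and its norm form
  takes every nonzero value.\<close>

lemma normgroup_sym:
  assumes "c \<noteq> 0" "(D::'a) \<noteq> 0" shows "c \<in> normgroup D \<longleftrightarrow> D \<in> normgroup c"
proof -
  have "D \<in> normgroup c" if c: "c \<noteq> 0" and D: "D \<noteq> 0" and g: "c \<in> normgroup D" for c D :: 'a
  proof -
    obtain x y where xy: "c = x^2 - D * y^2" using g by (auto simp: normgroup_def)
    show ?thesis
    proof (cases "y = 0")
      case True
      then have "sqeq c 1" using xy c by (intro sqeqI[of x]) auto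
      then show ?thesis using normgroup_sqeq[of c 1] normgroup_of_one[OF D] by simp
    next
      case False
      then have "D = (x / y)^2 - c * (1 / y)^2" using xy by (simp add: field_simps)
      then show ?thesis using D normgroupI by blast
    qed
  qed
  from this[of c D] this[of D c] show ?thesis using assms by blast
qed

end

section \<open>A uniformizer, unramified norms and the index of norm groups\<close>

locale dyadic_pi = dyadic_rho +
  fixes \<pi> :: 'a
  assumes pi_nz [simp]: "\<pi> \<noteq> 0" and v_pi [simp]: "v \<pi> = 1"
begin

lemma Delta_unit [simp]: "\<Delta> \<noteq> 0" "v \<Delta> = 0"
proof -
  have "vge (4 * \<rho>) 2" using e_pos by (intro vge_mult_le[of 4 2 \<rho> 0]) (auto simp: vge_def v_four)
  then have "vge (- (4 * \<rho>)) (v 1 + 1)" by (simp add: vge_def)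
  then show "\<Delta> \<noteq> 0" "v \<Delta> = 0" using v_add_less[of 1 "- (4 * \<rho>)"] by (auto simp: Delta_def)
qed

text \<open>The norm of \<open>x + y * w\<close> for a root \<open>w\<close> of
  \<open>X^2 - X + \<rho>\<close>, which generates the unramified quadratic extension. Its Gram
  matrix is \<open>Abin (1/2) 2 (2*\<rho>)\<close>.\<close>

definition unrN :: "'a \<Rightarrow> 'a \<Rightarrow> 'a" where
  "unrN x y = x^2 + x * y + \<rho> * y^2"

lemma unrN_vge: "vge x k \<Longrightarrow> vge y k \<Longrightarrow> vge (unrN x y) (2 * k)"
  unfolding unrN_def power2_eq_square
  by (intro vge_add vge_mult0[OF vge_rho] vge_mult_le[of _ k _ k]) auto

text \<open>The form is anisotropic modulo the maximal ideal. If \<open>y\<close> has the smaller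
  order, dividing by \<open>y^2\<close> leaves a value of \<open>t^2 + t + \<rho>\<close>, a unit;
  otherwise \<open>x^2\<close> dominates. Hence the order of a value is twice the smaller order of
  the coordinates, and an odd bound improves by one.\<close>

lemma unrN_vge_odd:
  assumes a: "vge (unrN x y) (2 * k + 1)"
  shows "vge x (k + 1) \<and> vge y (k + 1)"
proof (rule ccontr)
  assume n: "\<not> ?thesis"
  show False
  proof (cases "y \<noteq> 0 \<and> vge x (v y)")
    case True
    then have j: "v y \<le> k" using n vge_mono[of x "v y" "k + 1"] by (auto simp: vge_def not_le)
    have "vge (x / y) 0" using True by (simp add: vge_divide_iff)
    moreover have "(x / y)^2 + x / y + \<rho> = unrN x y / y^2"
      using True by (simp add: unrN_def field_simps power2_eq_square)
    moreover have "vge (unrN x y / y^2) 1"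
      using True j vge_mono[OF a, of "1 + 2 * v y"] by (simp add: vge_divide_iff v_power)
    ultimately show False using rho_irreducible by metis
  next
    case False
    then have x: "x \<noteq> 0" and y: "vge y (v x + 1)" using n by (auto simp: vge_def)
    have j: "v x \<le> k" using n x y by (auto simp: vge_def not_le)
    have "vge (x * y + \<rho> * y^2) (v (x^2) + 1)"
    proof (rule vge_add)
      show "vge (x * y) (v (x^2) + 1)" using vge_mult[OF vge_v[of x] y] x by (simp add: v_power add.assoc)
      show "vge (\<rho> * y^2) (v (x^2) + 1)"
      proof (cases "y = 0")
        case False
        then show ?thesis using y x by (auto simp: vge_def v_mult v_power)
      qed simp
    qed
    then have "unrN x y \<noteq> 0 \<and> v (unrN x y) = 2 * v x"
      using v_add_less[of "x^2" "x * y + \<rho> * y^2"] x by (simp add: unrN_def v_power add.assoc)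
    then show False using a j by (auto simp: vge_def)
  qed
qed

lemma unrN_nz: "x \<noteq> 0 \<or> y \<noteq> 0 \<Longrightarrow> unrN x y \<noteq> 0"
proof
  assume xy: "x \<noteq> 0 \<or> y \<noteq> 0" and z: "unrN x y = 0"
  have "vge x (k + 1) \<and> vge y (k + 1)" for k using unrN_vge_odd[of x y k] z by simp
  from this[of "max (v x) (v y)"] xy show False by (auto simp: vge_def)
qed

lemma unrN_even: "unrN x y \<noteq> 0 \<Longrightarrow> even (v (unrN x y))"
proof (rule ccontr)
  assume nz: "unrN x y \<noteq> 0" and "odd (v (unrN x y))"
  then obtain k where k: "v (unrN x y) = 2 * k + 1" by (elim oddE)
  then have "vge x (k + 1) \<and> vge y (k + 1)"
    by (intro unrN_vge_odd) (simp add: vge_def)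
  then have "vge (unrN x y) (2 * (k + 1))" using unrN_vge by blast
  then show False using nz k by (simp add: vge_def)
qed

text \<open>A unit is congruent to a square \<open>s^2\<close>. Keeping \<open>x = s\<close> and
  putting \<open>y = s / \<rho> * t\<close> gives the value
  \<open>s^2 + s^2 / \<rho> * (t^2 + t)\<close>, so \<open>t\<close> has to solve an Artin-Schreier
  equation with small right-hand side.\<close>

lemma unrN_surj:
  assumes u: "u \<noteq> 0" "v u = 0"
  obtains x y where "u = unrN x y"
proof -
  obtain s where s: "vge s 0" "vge (u - s^2) 1"
    using residue_perfect[of u] u by (auto simp: vge_def)
  have s0: "s \<noteq> 0" "v s = 0"
  proof -
    have "vge (s^2 - u) (v u + 1)" using s u by (simp add: vge_minus_commute)
    then have "s^2 \<noteq> 0 \<and> v (s^2) = 0" using v_add_less[of u "s^2 - u"] u by simp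
    then show "s \<noteq> 0" "v s = 0" by (auto simp: v_power)
  qed
  have "vge ((u - s^2) * \<rho> / s^2) 1"
    using s s0 vge_mult_le[OF s(2) vge_rho, of 1] by (simp add: vge_divide_iff v_power)
  then obtain t where t: "t^2 + t = (u - s^2) * \<rho> / s^2" using artin_schreier_small by blast
  have "unrN s (s / \<rho> * t) = s^2 + s^2 / \<rho> * (t^2 + t)"
    by (simp add: unrN_def power2_eq_square field_simps)
  also have "\<dots> = u" using s0 by (simp add: t)
  finally show ?thesis using that by metis
qed

lemma unrN_norm_form: "x^2 - \<Delta> * y^2 = unrN (x - y) (2 * y)"
  by (simp add: unrN_def Delta_def power2_eq_square algebra_simps)

lemma Delta_form_nz: "x^2 - \<Delta> * y^2 = 0 \<Longrightarrow> x = 0 \<and> y = 0"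
  using unrN_nz[of "x - y" "2 * y"] unfolding unrN_norm_form by auto

lemma normgroup_Delta: "c \<in> normgroup \<Delta> \<longleftrightarrow> c \<noteq> 0 \<and> even (v c)"
proof
  assume "c \<in> normgroup \<Delta>"
  then obtain x y where "c \<noteq> 0" "c = x^2 - \<Delta> * y^2" by (auto simp: normgroup_def)
  then show "c \<noteq> 0 \<and> even (v c)" using unrN_even unfolding unrN_norm_form by auto
next
  assume c: "c \<noteq> 0 \<and> even (v c)"
  then obtain j where j: "v c = 2 * j" by (elim conjE evenE)
  define u where "u = c / (\<pi> powi j)^2"
  have "u \<noteq> 0" "v u = 0" using c j by (auto simp: u_def v_divide v_power v_powi)
  then obtain x y where u: "u = unrN x y" using unrN_surj by blast
  have "u = (x + y / 2)^2 - \<Delta> * (y / 2)^2"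
    unfolding u unrN_norm_form by simp
  then have "u \<in> normgroup \<Delta>" using \<open>u \<noteq> 0\<close> normgroupI by blast
  then have "u * (\<pi> powi j)^2 \<in> normgroup \<Delta>"
    by (rule normgroup_mult) (rule normgroup_square, simp)
  then show "c \<in> normgroup \<Delta>" by (simp add: u_def)
qed

lemma Delta_nonsquare: "\<not> sqeq \<Delta> 1"
proof
  assume "sqeq \<Delta> 1"
  then have "\<pi> \<in> normgroup \<Delta>" using normgroup_sqeq[of \<Delta> 1] normgroup_of_one[of \<pi>] by simp
  then show False by (simp add: normgroup_Delta)
qed

text \<open>Squares are enough here: in \<open>(1 + q * s)^2\<close> the term
  \<open>q^2 * s^2\<close> can be matched to \<open>- r\<close>, and the cross term has order at
  least \<open>v 2 + i / 2\<close>, which exceeds \<open>i\<close> precisely because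
  \<open>i < 2 * v 2\<close>.\<close>

lemma normgroup_approx_even:
  assumes i: "even i" "1 \<le> i" "i < 2 * v 2" and r: "r \<noteq> 0" "v r = i"
  shows "\<exists>g\<in>normgroup D. vge (g - 1 + r) (i + 1)"
proof -
  obtain j where j: "i = 2 * j" using i by (elim evenE)
  define q where "q = \<pi> powi j"
  have q: "q \<noteq> 0" "v q = j" by (auto simp: q_def v_powi)
  have "vge (- r / q^2) 0" using r q j by (simp add: vge_def v_divide v_power)
  then obtain s where s: "vge s 0" "vge (- r / q^2 - s^2) 1" using residue_perfect by blast
  have qs: "vge (q * s) j" using vge_mult[OF vge_v s(1), of q] q by simp
  have "1 + q * s \<noteq> 0" using v_add_less[of 1 "q * s"] vge_mono[OF qs, of 1] i j by simp
  then have g: "(1 + q * s)^2 \<in> normgroup D" by (rule normgroup_square)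
  have "(1 + q * s)^2 - 1 + r = 2 * (q * s) - q^2 * (- r / q^2 - s^2)"
    using q by (simp add: power2_eq_square field_simps)
  moreover have "vge (2 * (q * s)) (i + 1)"
    using i j by (intro vge_mult_le[OF vge_v qs]) linarith
  moreover have "vge (q^2 * (- r / q^2 - s^2)) (i + 1)"
    using vge_mult_le[OF vge_v s(2), of "i + 1" "q^2"] q j by (simp add: v_power)
  ultimately have "vge ((1 + q * s)^2 - 1 + r) (i + 1)" using vge_diff by metis
  then show ?thesis using g by blast
qed

text \<open>Multiplying by norms pushes a given element into \<open>1 + \<kappa>O\<close>; there the norms contain
  \<open>1 + \<kappa>(t\<^sup>2 + t)\<close>, and the residual obstruction lies in the two cosets of Artin-Schreier theory.\<close>

lemma norm_index:
  assumes kap: "\<kappa> \<noteq> 0" "1 \<le> v \<kappa>" "v \<kappa> \<le> 2 * v 2"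
    and A: "\<And>t. 1 + \<kappa> * (t^2 + t) \<noteq> 0 \<Longrightarrow> 1 + \<kappa> * (t^2 + t) \<in> normgroup D"
    and O: "h \<in> normgroup D" "odd (v h)"
    and B: "\<And>i r. odd i \<Longrightarrow> 1 \<le> i \<Longrightarrow> i < v \<kappa> \<Longrightarrow> r \<noteq> 0 \<Longrightarrow> v r = i \<Longrightarrow>
      \<exists>g\<in>normgroup D. vge (g - 1 + r) (i + 1)"
    and c: "c \<noteq> 0"
  shows "c \<in> normgroup D \<or> c * (1 - \<kappa> * \<rho>) \<in> normgroup D"
proof -
  \<comment> \<open>Normalization: \<open>h\<close> repairs the parity of the order, an even power
    of \<pi> makes it zero, and a square makes the resulting unit congruent to 1.\<close>
  have "\<exists>g\<in>normgroup D. even (v (c * g))"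
  proof (cases "even (v c)")
    case True then show ?thesis by (intro bexI[of _ 1]) auto
  next
    case False
    then show ?thesis using O c normgroup_nz[OF O(1)] by (intro bexI[of _ h]) (auto simp: v_mult)
  qed
  then obtain g0 where g0: "g0 \<in> normgroup D" "even (v (c * g0))" by blast
  then obtain j where j: "v (c * g0) = 2 * j" by (elim evenE)
  have g0nz: "g0 \<noteq> 0" using g0 normgroup_nz by blast
  define g1 where "g1 = g0 / (\<pi> powi j)^2"
  have g1: "g1 \<in> normgroup D"
    unfolding g1_def by (rule normgroup_divide[OF g0(1) normgroup_square]) simp
  have u: "c * g1 \<noteq> 0" "v (c * g1) = 0"
    using c g0nz j by (auto simp: g1_def v_divide v_mult v_power v_powi)
  obtain s where s: "vge s 0" "vge (c * g1 - s^2) 1"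
    using residue_perfect[of "c * g1"] u by (auto simp: vge_def)
  have s0: "s \<noteq> 0" "v s = 0"
  proof -
    have "vge (s^2 - c * g1) (v (c * g1) + 1)"
      using s u by (simp add: vge_minus_commute[of "s^2"])
    then have "s^2 \<noteq> 0 \<and> v (s^2) = 0" using v_add_less[of "c * g1" "s^2 - c * g1"] u by simp
    then show "s \<noteq> 0" "v s = 0" by (auto simp: v_power)
  qed
  have base: "\<exists>g\<in>normgroup D. vge (c * g - 1) 1"
  proof (intro bexI)
    show "g1 / s^2 \<in> normgroup D" by (rule normgroup_divide[OF g1 normgroup_square[OF s0(1)]])
    have "c * (g1 / s^2) - 1 = (c * g1 - s^2) / s^2" using s0 by (simp add: field_simps)
    then show "vge (c * (g1 / s^2) - 1) 1" using s s0 by (simp add: vge_divide_iff v_power)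
  qed
  have approx: "\<exists>g\<in>normgroup D. vge (c * g - 1) (int (Suc n))" if "int (Suc n) \<le> v \<kappa>" for n
    using that
  proof (induction n)
    case 0 then show ?case using base by simp
  next
    case (Suc n)
    define i where "i = int (Suc n)"
    obtain g where g: "g \<in> normgroup D" "vge (c * g - 1) i" using Suc by (auto simp: i_def)
    define r where "r = c * g - 1"
    show ?case
    proof (cases "vge r (i + 1)")
      case True
      then show ?thesis using g by (auto simp: r_def i_def algebra_simps)
    next
      case False
      then have r: "r \<noteq> 0" "v r = i" using g by (auto simp: r_def vge_def)
      have i: "1 \<le> i" "i < v \<kappa>" using Suc.prems by (auto simp: i_def)
      \<comment> \<open>Here \<open>c * g = 1 + r\<close>. A norm close to \<open>1 - r\<close>
        inverts it up to \<open>r * (g' - 1)\<close>, which has order at least \<open>2 * i\<close>,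
        so the error gains one order.\<close>
      have "\<exists>g'\<in>normgroup D. vge (g' - 1 + r) (i + 1)"
      proof (cases "even i")
        case True
        then show ?thesis using normgroup_approx_even[of i r D] i kap r by simp
      next
        case False
        then show ?thesis using B[of i r] i r by simp
      qed
      then obtain g' where g': "g' \<in> normgroup D" "vge (g' - 1 + r) (i + 1)" by blast
      have "vge (g' - 1 + r - r) i"
        by (rule vge_diff) (use vge_mono[OF g'(2), of i] r in \<open>auto simp: vge_def\<close>)
      then have "vge (r * (g' - 1)) (i + 1)"
        using i r by (intro vge_mult_le[OF vge_v[of r], of _ i]) auto
      then have "vge ((g' - 1 + r) + r * (g' - 1)) (i + 1)" using g' vge_add by blast
      moreover have "(g' - 1 + r) + r * (g' - 1) = c * (g * g') - 1"
        by (simp add: r_def algebra_simps)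
      moreover have "i + 1 = int (Suc (Suc n))" by (simp add: i_def)
      ultimately have "vge (c * (g * g') - 1) (int (Suc (Suc n)))" by metis
      then show ?thesis using normgroup_mult[OF g(1) g'(1)] by blast
    qed
  qed
  have "\<exists>g\<in>normgroup D. vge (c * g - 1) (v \<kappa>)"
    using approx[of "nat (v \<kappa>) - 1"] kap by simp
  then obtain g where g: "g \<in> normgroup D" "vge (c * g - 1) (v \<kappa>)" by blast
  define w where "w = (c * g - 1) / \<kappa>"
  have w: "vge w 0" "c * g = 1 + \<kappa> * w" using g kap by (auto simp: w_def vge_divide_iff)
  have small: "1 + \<kappa> * w' \<in> normgroup D"
    if w': "vge w' 0" and t: "vge t 0" "vge (w' - t^2 - t) 1" for w' t
  proof -
    have "vge (\<kappa> * w') 1" using vge_mult_le[OF vge_v w'] kap by simp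
    then have "1 + \<kappa> * w' \<noteq> 0" using v_add_less[of 1 "\<kappa> * w'"] by simp
    moreover obtain t' where "t'^2 + t' = w'" using artin_schreier_lift[OF t(2,1)] by blast
    ultimately show ?thesis using A by blast
  qed
  obtain t where t: "vge t 0" "vge (w - t^2 - t) 1 \<or> vge (w - \<rho> - t^2 - t) 1"
    using artin_schreier_cosets[OF w(1)] by blast
  from t(2) show ?thesis
  proof
    assume "vge (w - t^2 - t) 1"
    then have "c * g \<in> normgroup D" using small w t by metis
    then show ?thesis using normgroup_mult_iff[OF g(1)] by blast
  next
    assume a: "vge (w - \<rho> - t^2 - t) 1"
    \<comment> \<open>The product of \<open>1 + \<kappa> * w\<close> and
      \<open>1 - \<kappa> * \<rho>\<close> is \<open>1 + \<kappa> * w'\<close>: the extra factor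
      shifts \<open>w\<close> by \<rho>, up to an element of the maximal ideal, and so moves it into
      the other coset.\<close>
    define w' where "w' = w - \<rho> - \<kappa> * (w * \<rho>)"
    have k: "vge (\<kappa> * (w * \<rho>)) 1"
      using vge_mult_le[OF vge_v vge_mult0[OF w(1) vge_rho]] kap by simp
    have "vge (w - \<rho> - t^2 - t - \<kappa> * (w * \<rho>)) 1" by (rule vge_diff[OF a k])
    then have "vge (w' - t^2 - t) 1" by (simp add: w'_def algebra_simps)
    moreover have "vge w' 0" unfolding w'_def
      by (intro vge_diff w vge_rho vge_mono[OF k]) simp
    ultimately have "1 + \<kappa> * w' \<in> normgroup D" using small t by blast
    moreover have "1 + \<kappa> * w' = (c * (1 - \<kappa> * \<rho>)) * g"
    proof -
      have "(c * (1 - \<kappa> * \<rho>)) * g = (1 + \<kappa> * w) * (1 - \<kappa> * \<rho>)" using w by (simp add: algebra_simps)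
      then show ?thesis by (simp add: w'_def algebra_simps)
    qed
    ultimately show ?thesis using normgroup_mult_iff[OF g(1)] by metis
  qed
qed

text \<open>Take \<open>\<kappa> = 4\<close>: then \<open>1 + 4 * (t^2 + t) = (1 + 2 * t)^2\<close>
  is a square and \<open>1 - \<kappa> * \<rho>\<close> is \<open>\<Delta>\<close>. Since
  \<open>D\<close> has order 1, the norms \<open>1 - D * y^2\<close> deviate from 1 in odd order and
  serve all odd orders below that of 4.\<close>

lemma norm_index_prime:
  assumes D: "D \<noteq> 0" "v D = 1" and c: "c \<noteq> 0"
  shows "c \<in> normgroup D \<or> c * \<Delta> \<in> normgroup D"
  unfolding Delta_def
proof (rule norm_index[OF _ _ _ _ normgroup_uminus[OF D(1)] _ _ c])
  show "1 + 4 * (t^2 + t) \<in> normgroup D" if "1 + 4 * (t^2 + t) \<noteq> 0" for t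
    using that by (intro normgroupI[of _ "1 + 2 * t" D 0]) (auto simp: power2_eq_square algebra_simps)
  fix i r assume i: "odd i" "1 \<le> i" "i < v 4" and r: "r \<noteq> 0" "v r = i"
  obtain j where j: "i = 2 * j + 1" using i by (elim oddE)
  define q where "q = \<pi> powi j"
  have q: "q \<noteq> 0" "v q = j" by (auto simp: q_def v_powi)
  have "vge (r / (D * q^2)) 0" using r q j D by (simp add: vge_def v_divide v_power v_mult)
  then obtain s where s: "vge s 0" "vge (r / (D * q^2) - s^2) 1" using residue_perfect by blast
  have ds: "vge (D * (q * s)^2) 1"
  proof -
    have "vge (q * s) 0" using vge_mult_le[OF vge_v[of q] s(1), of 0] q i j by simp
    then have "vge ((q * s)^2) 0" using vge_mult0 by (simp add: power2_eq_square)
    then show ?thesis using vge_mult_le[OF vge_v[of D], of _ 0 1] D by simp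
  qed
  have "1 + - (D * (q * s)^2) \<noteq> 0" using v_add_less[of 1 "- (D * (q * s)^2)"] ds by simp
  then have g: "1 - D * (q * s)^2 \<in> normgroup D" by (intro normgroupI[of _ 1 D "q * s"]) auto
  have "1 - D * (q * s)^2 - 1 + r = (D * q^2) * (r / (D * q^2) - s^2)"
    using q D by (simp add: power2_eq_square field_simps)
  moreover have "vge ((D * q^2) * (r / (D * q^2) - s^2)) (i + 1)"
    using vge_mult_le[OF vge_v s(2), of "i + 1" "D * q^2"] q D j by (simp add: v_power v_mult)
  ultimately show "\<exists>g\<in>normgroup D. vge (g - 1 + r) (i + 1)" using g by metis
qed (use e_pos D in \<open>auto simp: v_four\<close>)

text \<open>With \<open>a = \<delta> - 1\<close>, the norm of
  \<open>1 + y + y * sqrt \<delta>\<close> is \<open>1 + 2 * y - a * y^2\<close>. For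
  \<open>y = - 2 / a * t\<close> it equals \<open>1 - 4 / a * (t^2 + t)\<close>, which is where
  \<open>\<kappa> = - 4 / a\<close> comes from. Below the order of \<kappa> the term
  \<open>a * y^2\<close>, of odd order, dominates \<open>2 * y\<close>.\<close>

lemma norm_index_unit:
  assumes a: "odd (v (\<delta> - 1))" "1 \<le> v (\<delta> - 1)" "v (\<delta> - 1) < 2 * v 2" "\<delta> \<noteq> 1" and c: "c \<noteq> 0"
  shows "c \<in> normgroup \<delta> \<or> c * (1 + 4 * \<rho> * inverse (\<delta> - 1)) \<in> normgroup \<delta>"
proof -
  define a where "a = \<delta> - 1"
  have anz: "a \<noteq> 0" and va: "odd (v a)" "1 \<le> v a" "v a < 2 * v 2" using assms by (auto simp: a_def)
  have vk: "v (- 4 / a) = 2 * v 2 - v a" using anz v_divide[of "-4" a] v_four by simp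
  have h: "- a \<in> normgroup \<delta>" using anz by (intro normgroupI[of _ 1 \<delta> 1]) (auto simp: a_def)
  have form: "1 + 2 * y - a * y^2 = (1 + y)^2 - \<delta> * y^2" for y
    by (simp add: a_def power2_eq_square algebra_simps)
  have "c \<in> normgroup \<delta> \<or> c * (1 - (- 4 / a) * \<rho>) \<in> normgroup \<delta>"
  proof (rule norm_index[OF _ _ _ _ h _ _ c])
    fix t assume nz: "1 + - 4 / a * (t^2 + t) \<noteq> 0"
    have "1 + - 4 / a * (t^2 + t) = 1 + 2 * (- 2 / a * t) - a * (- 2 / a * t)^2"
      using anz by (simp add: power2_eq_square field_simps)
    also note form
    finally show "1 + - 4 / a * (t^2 + t) \<in> normgroup \<delta>" by (rule normgroupI[OF nz])
  next
    fix i r assume i: "odd i" "1 \<le> i" "i < v (- 4 / a)" and r: "r \<noteq> 0" "v r = i"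
    have "even (i - v a)" using i va by simp
    \<comment> \<open>The exponent \<open>j\<close> may be negative: \<open>y = q * s\<close> need
      not be integral, provided that \<open>a * y^2\<close> has order at least \<open>i\<close> and
      \<open>2 * y\<close> order above \<open>i\<close>.\<close>
    then obtain j where j: "i = 2 * j + v a" by (metis dvdE diff_eq_eq)
    define q where "q = \<pi> powi j"
    have q: "q \<noteq> 0" "v q = j" by (auto simp: q_def v_powi)
    have "vge (r / (a * q^2)) 0" using r q j anz by (simp add: vge_def v_divide v_power v_mult)
    then obtain s where s: "vge s 0" "vge (r / (a * q^2) - s^2) 1" using residue_perfect by blast
    have qs: "vge (q * s) j" using vge_mult[OF vge_v s(1), of q] q by simp
    have t2: "vge (2 * (q * s)) (i + 1)"
      using i j vk by (intro vge_mult_le[OF vge_v qs]) linarith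
    have e: "1 + 2 * (q * s) - a * (q * s)^2 - 1 + r = 2 * (q * s) + (a * q^2) * (r / (a * q^2) - s^2)"
      using q anz by (simp add: power_mult_distrib right_diff_distrib)
    have "vge ((a * q^2) * (r / (a * q^2) - s^2)) (i + 1)"
      using vge_mult_le[OF vge_v s(2), of "i + 1" "a * q^2"] q anz j by (simp add: v_power v_mult)
    then have m: "vge (1 + 2 * (q * s) - a * (q * s)^2 - 1 + r) (i + 1)"
      unfolding e by (rule vge_add[OF t2])
    have "vge (1 + 2 * (q * s) - a * (q * s)^2 - 1 + r - r) 1"
      by (rule vge_diff) (use vge_mono[OF m, of 1] vge_mono[OF vge_v[of r], of 1] r i in simp_all)
    then have d: "vge (1 + 2 * (q * s) - a * (q * s)^2 - 1) (v 1 + 1)" by simp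
    have "1 + 2 * (q * s) - a * (q * s)^2 \<noteq> 0"
      using v_add_less[OF one_neq_zero d] by (simp add: algebra_simps)
    then have "1 + 2 * (q * s) - a * (q * s)^2 \<in> normgroup \<delta>" using form by (rule normgroupI)
    then show "\<exists>g\<in>normgroup \<delta>. vge (g - 1 + r) (i + 1)" using m by blast
  qed (use anz va vk in auto)
  moreover have "1 - (- 4 / a) * \<rho> = 1 + 4 * \<rho> * inverse (\<delta> - 1)"
    using anz by (simp add: a_def field_simps)
  ultimately show ?thesis by simp
qed

end

section \<open>Representations of diagonal forms\<close>

text \<open>The predicate restricts the coefficients: \<open>intO v\<close> gives representations of
  lattices, \<open>True\<close> those of the spaces they span. Transitivity and orthogonal sums are
  thereby handled once for both.\<close>

definition rep_over :: "('a::field \<Rightarrow> bool) \<Rightarrow> 'a mat \<Rightarrow> 'a mat \<Rightarrow> bool" where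
  "rep_over P L M \<longleftrightarrow> (\<exists>X \<in> carrier_mat (dim_row M) (dim_row L).
     (\<forall>i < dim_row M. \<forall>j < dim_row L. P (X $$ (i, j))) \<and> X * L * X\<^sup>T = M)"

abbreviation frep :: "'a::field mat \<Rightarrow> 'a mat \<Rightarrow> bool" where
  "frep \<equiv> rep_over (\<lambda>_. True)"

text \<open>The arguments are functions rather than vectors: coordinates beyond the dimension are
  ignored, and restricting to an orthogonal summand becomes a shift of the index.\<close>

definition bform :: "'a::field mat \<Rightarrow> (nat \<Rightarrow> 'a) \<Rightarrow> (nat \<Rightarrow> 'a) \<Rightarrow> 'a" where
  "bform L f g = (\<Sum>k<dim_row L. \<Sum>l<dim_row L. f k * L $$ (k, l) * g l)"

lemma represents_rep_over: "represents v = rep_over (intO v)"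
  by (intro ext) (simp add: represents_def rep_over_def)

lemma bform_cong:
  assumes "\<And>k. k < dim_row L \<Longrightarrow> f k = f' k" "\<And>k. k < dim_row L \<Longrightarrow> g k = g' k"
  shows "bform L f g = bform L f' g'"
  unfolding bform_def by (intro sum.cong refl) (use assms in simp)

lemma bform_add_left: "bform L (\<lambda>k. f k + g k) h = bform L f h + bform L g h"
  by (simp add: bform_def algebra_simps sum.distrib)

lemma bform_scale_left: "bform L (\<lambda>k. c * f k) h = c * bform L f h"
  by (simp add: bform_def sum_distrib_left algebra_simps)

lemma bform_add_right: "bform L h (\<lambda>k. f k + g k) = bform L h f + bform L h g"
  by (simp add: bform_def algebra_simps sum.distrib)

lemma bform_scale_right: "bform L h (\<lambda>k. c * f k) = c * bform L h f"
  by (simp add: bform_def sum_distrib_left algebra_simps)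

lemma bform_zero [simp]: "bform L (\<lambda>k. 0) h = 0" "bform L h (\<lambda>k. 0) = 0"
  by (simp_all add: bform_def)

lemma bform_commute:
  assumes "L \<in> carrier_mat n n" "L\<^sup>T = L" shows "bform L f g = bform L g f"
proof -
  have s: "L $$ (k, l) = L $$ (l, k)" if "k < n" "l < n" for k l
    using that assms by (metis carrier_matD index_transpose_mat(1))
  have "bform L f g = (\<Sum>l<dim_row L. \<Sum>k<dim_row L. f k * L $$ (k, l) * g l)"
    unfolding bform_def by (rule sum.swap)
  also have "\<dots> = bform L g f"
    unfolding bform_def by (intro sum.cong refl) (use s assms in \<open>auto simp: ac_simps\<close>)
  finally show ?thesis .
qed

lemma congruence_entry:
  assumes "X \<in> carrier_mat n l" "L \<in> carrier_mat l l" "i < n" "j < n"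
  shows "(X * L * X\<^sup>T) $$ (i, j) = bform L (\<lambda>k. X $$ (i, k)) (\<lambda>k. X $$ (j, k))"
proof -
  have "(X * L * X\<^sup>T) $$ (i, j) = (\<Sum>a<l. X $$ (i, a) * (\<Sum>b<l. L $$ (a, b) * X $$ (j, b)))"
    using assms by (simp add: scalar_prod_def atLeast0LessThan)
  then show ?thesis using assms by (simp add: bform_def sum_distrib_left mult.assoc)
qed

lemma rep_over_iff:
  assumes L: "L \<in> carrier_mat l l" and M: "M \<in> carrier_mat m m"
  shows "rep_over P L M \<longleftrightarrow> (\<exists>f. (\<forall>i<m. \<forall>k<l. P (f i k)) \<and>
    (\<forall>i<m. \<forall>j<m. M $$ (i, j) = bform L (f i) (f j)))" (is "_ \<longleftrightarrow> ?R")
proof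
  assume "rep_over P L M"
  then obtain X where X: "X \<in> carrier_mat m l" "\<forall>i<m. \<forall>j<l. P (X $$ (i, j))" "X * L * X\<^sup>T = M"
    using L M by (auto simp: rep_over_def)
  then show ?R using congruence_entry[OF X(1) L]
    by (intro exI[of _ "\<lambda>i k. X $$ (i, k)"]) auto
next
  assume ?R
  then obtain f where f: "\<forall>i<m. \<forall>k<l. P (f i k)"
    "\<forall>i<m. \<forall>j<m. M $$ (i, j) = bform L (f i) (f j)" by blast
  define X where "X = mat m l (\<lambda>(i, k). f i k)"
  have X: "X \<in> carrier_mat m l" by (simp add: X_def)
  have "X * L * X\<^sup>T = M"
  proof (rule eq_matI)
    fix i j assume ij: "i < dim_row M" "j < dim_col M"
    then have "(X * L * X\<^sup>T) $$ (i, j) = bform L (\<lambda>k. X $$ (i, k)) (\<lambda>k. X $$ (j, k))"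
      using congruence_entry[OF X L] M by simp
    also have "\<dots> = bform L (f i) (f j)"
      by (rule bform_cong) (use ij L M in \<open>auto simp: X_def\<close>)
    finally show "(X * L * X\<^sup>T) $$ (i, j) = M $$ (i, j)" using f ij M by simp
  qed (use X M in auto)
  then show "rep_over P L M" unfolding rep_over_def
    using X f(1) L M by (intro bexI[of _ X]) (auto simp: X_def)
qed

lemma rep_over_trans:
  assumes L: "L \<in> carrier_mat l l" and M: "M \<in> carrier_mat m m"
    and P: "P 0" "\<And>a b. P a \<Longrightarrow> P b \<Longrightarrow> P (a + b)" "\<And>a b. P a \<Longrightarrow> P b \<Longrightarrow> P (a * b)"
    and "rep_over P L M" "rep_over P M N"
  shows "rep_over P L N"
proof -
  define n where "n = dim_row N"
  obtain X where X: "X \<in> carrier_mat m l" "\<forall>i<m. \<forall>j<l. P (X $$ (i, j))" "X * L * X\<^sup>T = M"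
    using assms by (auto simp: rep_over_def)
  obtain Y where Y: "Y \<in> carrier_mat n m" "\<forall>i<n. \<forall>j<m. P (Y $$ (i, j))" "Y * M * Y\<^sup>T = N"
    using assms by (auto simp: rep_over_def n_def)
  have sumP: "P (\<Sum>k<j. h k)" if "\<forall>k<j. P (h k)" for h and j :: nat
    using that by (induction j) (auto simp: P)
  have "Y * X * L * (Y * X)\<^sup>T = Y * (X * L * X\<^sup>T) * Y\<^sup>T"
  proof -
    have c: "Y\<^sup>T \<in> carrier_mat m n" "X\<^sup>T \<in> carrier_mat l m" using X Y by auto
    have 1: "(Y * X)\<^sup>T = X\<^sup>T * Y\<^sup>T" by (rule transpose_mult[OF Y(1) X(1)])
    have 2: "Y * X * L = Y * (X * L)" using X Y L by (intro assoc_mult_mat) auto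
    have 3: "Y * (X * L) * (X\<^sup>T * Y\<^sup>T) = Y * (X * L) * X\<^sup>T * Y\<^sup>T"
      using c X Y L by (intro assoc_mult_mat[symmetric, of _ n l _ m _ n]) auto
    have 4: "Y * (X * L) * X\<^sup>T = Y * (X * L * X\<^sup>T)"
      using c X Y L by (intro assoc_mult_mat[of _ n m _ l _ m]) auto
    show ?thesis unfolding 1 2 3 4 ..
  qed
  moreover have "\<forall>i<n. \<forall>j<l. P ((Y * X) $$ (i, j))"
    using X Y by (auto simp: scalar_prod_def atLeast0LessThan intro!: sumP P)
  ultimately show ?thesis unfolding rep_over_def
    using X Y L by (intro bexI[of _ "Y * X"]) (auto simp: n_def)
qed

lemma rep_over_mono: "rep_over P L M \<Longrightarrow> (\<And>x. P x \<Longrightarrow> Q x) \<Longrightarrow> rep_over Q L M"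
  unfolding rep_over_def by blast

lemma rep_over_refl:
  assumes "L \<in> carrier_mat l l" "P 0" "P 1" shows "rep_over P L L"
  unfolding rep_over_def using assms by (intro bexI[of _ "1\<^sub>m l"]) auto

section \<open>Orthogonal sums and diagonal Gram matrices\<close>

lemma osum_carrier [simp]:
  "A \<in> carrier_mat a a \<Longrightarrow> B \<in> carrier_mat b b \<Longrightarrow> A \<perp>\<^sub>L B \<in> carrier_mat (a + b) (a + b)"
  by (simp add: osum_def)

lemma dim_osum [simp]: "dim_row (A \<perp>\<^sub>L B) = dim_row A + dim_row B"
  "dim_col (A \<perp>\<^sub>L B) = dim_col A + dim_col B"
  by (simp_all add: osum_def)

lemma osum_index:
  assumes "A \<in> carrier_mat a a" "B \<in> carrier_mat b b" "i < a + b" "j < a + b"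
  shows "(A \<perp>\<^sub>L B) $$ (i, j) = (if i < a \<and> j < a then A $$ (i, j)
    else if \<not> i < a \<and> \<not> j < a then B $$ (i - a, j - a) else 0)"
  using assms by (auto simp: osum_def)

lemma osum_assoc: "(A \<perp>\<^sub>L B) \<perp>\<^sub>L C = A \<perp>\<^sub>L (B \<perp>\<^sub>L C)"
  using assoc_four_block_mat[of A B C] by (simp add: osum_def)

lemma osum_empty [simp]: "A \<perp>\<^sub>L 0\<^sub>m 0 0 = A" "0\<^sub>m 0 0 \<perp>\<^sub>L A = A"
  by (rule eq_matI, auto simp: osum_def)+

lemma osum_transpose:
  assumes "A \<in> carrier_mat a a" "B \<in> carrier_mat b b" "A\<^sup>T = A" "B\<^sup>T = B"
  shows "(A \<perp>\<^sub>L B)\<^sup>T = A \<perp>\<^sub>L B"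
  using transpose_four_block_mat[of A a a "0\<^sub>m a b" b "0\<^sub>m b a" b B] assms by (simp add: osum_def)

lemma sum_lessThan_add: "(\<Sum>k<a + b. h k) = (\<Sum>k<a. h k) + (\<Sum>k<b. h (k + a))" for h :: "nat \<Rightarrow> 'a::comm_monoid_add"
  by (induction b) (simp_all add: ac_simps)

lemma bform_osum:
  assumes A: "A \<in> carrier_mat a a" and B: "B \<in> carrier_mat b b"
  shows "bform (A \<perp>\<^sub>L B) f g = bform A f g + bform B (\<lambda>k. f (k + a)) (\<lambda>k. g (k + a))"
proof -
  have 1: "(\<Sum>l<a + b. f k * (A \<perp>\<^sub>L B) $$ (k, l) * g l) = (\<Sum>l<a. f k * A $$ (k, l) * g l)" if "k < a" for k
    using that by (simp add: sum_lessThan_add osum_index[OF A B])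
  have 2: "(\<Sum>l<a + b. f (k + a) * (A \<perp>\<^sub>L B) $$ (k + a, l) * g l) =
      (\<Sum>l<b. f (k + a) * B $$ (k, l) * g (l + a))" if "k < b" for k
    using that by (simp add: sum_lessThan_add osum_index[OF A B])
  show ?thesis using A B 1 2
    by (simp add: bform_def) (simp add: sum_lessThan_add[of "\<lambda>k. \<Sum>l<a + b. f k * (A \<perp>\<^sub>L B) $$ (k, l) * g l"])
qed

lemma rep_over_osum:
  assumes c: "A \<in> carrier_mat a a" "B \<in> carrier_mat b b" "A' \<in> carrier_mat a' a'" "B' \<in> carrier_mat b' b'"
    and P: "P 0" and "rep_over P A A'" "rep_over P B B'"
  shows "rep_over P (A \<perp>\<^sub>L B) (A' \<perp>\<^sub>L B')"
proof -
  obtain f where f: "\<forall>i<a'. \<forall>k<a. P (f i k)" "\<forall>i<a'. \<forall>j<a'. A' $$ (i, j) = bform A (f i) (f j)"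
    using assms rep_over_iff[OF c(1,3)] by blast
  obtain g where g: "\<forall>i<b'. \<forall>k<b. P (g i k)" "\<forall>i<b'. \<forall>j<b'. B' $$ (i, j) = bform B (g i) (g j)"
    using assms rep_over_iff[OF c(2,4)] by blast
  define h where "h i k = (if i < a' then if k < a then f i k else 0
    else if k < a then 0 else g (i - a') (k - a))" for i k
  have hA: "bform A (h i) (h j) = (if i < a' \<and> j < a' then bform A (f i) (f j) else 0)" for i j
  proof -
    have "bform A (h i) (h j) =
        bform A (if i < a' then f i else (\<lambda>k. 0)) (if j < a' then f j else (\<lambda>k. 0))"
      by (rule bform_cong) (use c in \<open>auto simp: h_def\<close>)
    then show ?thesis by simp
  qed
  have hB: "bform B (\<lambda>k. h i (k + a)) (\<lambda>k. h j (k + a)) =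
      (if \<not> i < a' \<and> \<not> j < a' then bform B (g (i - a')) (g (j - a')) else 0)" for i j
    by (auto simp: h_def)
  have "\<forall>i<a' + b'. \<forall>k<a + b. P (h i k)" using f g P by (auto simp: h_def)
  moreover have "\<forall>i<a' + b'. \<forall>j<a' + b'. (A' \<perp>\<^sub>L B') $$ (i, j) = bform (A \<perp>\<^sub>L B) (h i) (h j)"
    using f g by (auto simp: bform_osum[OF c(1,2)] osum_index[OF c(3,4)] hA hB)
  ultimately show ?thesis
    using rep_over_iff[OF osum_carrier[OF c(1,2)] osum_carrier[OF c(3,4)]] by blast
qed

lemma dim_diagL [simp]: "dim_row (diagL xs) = length xs" "dim_col (diagL xs) = length xs"
  by (simp_all add: diagL_def)

lemma diagL_carrier [simp]: "diagL xs \<in> carrier_mat (length xs) (length xs)"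
  by (rule carrier_matI) simp_all

lemma diagL_index:
  "i < length xs \<Longrightarrow> j < length xs \<Longrightarrow> diagL xs $$ (i, j) = (if i = j then xs ! i else 0)"
  by (simp add: diagL_def)

lemma diagL_append: "diagL (xs @ ys) = diagL xs \<perp>\<^sub>L diagL ys"
  by (rule eq_matI) (auto simp: osum_def diagL_def nth_append)

lemma bform_diagL: "bform (diagL xs) f g = (\<Sum>k<length xs. xs ! k * f k * g k)"
proof -
  have "(\<Sum>l<length xs. f k * diagL xs $$ (k, l) * g l) = xs ! k * f k * g k" if "k < length xs" for k
  proof -
    have "(\<Sum>l<length xs. f k * diagL xs $$ (k, l) * g l) =
        (\<Sum>l<length xs. if l = k then xs ! k * f k * g k else 0)"
      by (rule sum.cong) (use that in \<open>auto simp: diagL_def ac_simps\<close>)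
    then show ?thesis using that by simp
  qed
  then show ?thesis by (simp add: bform_def)
qed

definition lrep :: "'a::field list \<Rightarrow> 'a list \<Rightarrow> bool" where
  "lrep xs ys \<longleftrightarrow> frep (diagL xs) (diagL ys)"

lemma lrep_iff: "lrep xs ys \<longleftrightarrow> (\<exists>f. \<forall>i<length ys. \<forall>j<length ys.
    (\<Sum>k<length xs. xs ! k * f i k * f j k) = (if i = j then ys ! i else 0))"
  unfolding lrep_def rep_over_iff[OF diagL_carrier diagL_carrier] bform_diagL
  by (intro ex_cong1) (auto simp: diagL_index)

lemma lrepI: "(\<And>i j. i < length ys \<Longrightarrow> j < length ys \<Longrightarrow>
    (\<Sum>k<length xs. xs ! k * f i k * f j k) = (if i = j then ys ! i else 0)) \<Longrightarrow> lrep xs ys"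
  unfolding lrep_iff by blast

lemma lrep_trans: "lrep xs ys \<Longrightarrow> lrep ys zs \<Longrightarrow> lrep xs zs"
  unfolding lrep_def by (rule rep_over_trans[OF diagL_carrier diagL_carrier]) auto

lemma lrep_append: "lrep xs xs' \<Longrightarrow> lrep ys ys' \<Longrightarrow> lrep (xs @ ys) (xs' @ ys')"
  unfolding lrep_def diagL_append by (rule rep_over_osum) auto

lemma lrep_mset:
  assumes "mset xs = mset ys" shows "lrep xs ys"
proof -
  obtain p where p: "bij_betw p {..<length ys} {..<length xs}" "\<forall>i<length ys. ys ! i = xs ! p i"
    using permutation_Ex_bij[OF assms[symmetric]] by blast
  define f where "f i k = (if k = p i then 1 else 0 :: 'a)" for i k
  show ?thesis
  proof (rule lrepI[where f = f])
    fix i j assume ij: "i < length ys" "j < length ys"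
    have "(\<Sum>k<length xs. xs ! k * f i k * f j k) =
        (\<Sum>k<length xs. if k = p i then (if p i = p j then xs ! p i else 0) else 0)"
      by (rule sum.cong) (auto simp: f_def)
    also have "\<dots> = (if p i = p j then xs ! p i else 0)"
      using p(1) ij by (auto simp: bij_betw_def)
    also have "\<dots> = (if i = j then ys ! i else 0)"
      using p ij by (auto simp: bij_betw_def inj_on_def)
    finally show "(\<Sum>k<length xs. xs ! k * f i k * f j k) = (if i = j then ys ! i else 0)" .
  qed
qed

lemma lrep_drop: "lrep (xs @ ys) xs"
proof (rule lrepI[where f = "\<lambda>i k. if k = i then 1 else 0"])
  fix i j assume ij: "i < length xs" "j < length xs"
  have "(\<Sum>k<length (xs @ ys). (xs @ ys) ! k * (if k = i then 1 else 0) * (if k = j then 1 else 0)) =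
      (\<Sum>k<length (xs @ ys). if k = i then (if i = j then xs ! i else 0) else 0)"
    by (rule sum.cong) (use ij in \<open>auto simp: nth_append\<close>)
  then show "(\<Sum>k<length (xs @ ys). (xs @ ys) ! k * (if k = i then 1 else 0) * (if k = j then 1 else 0)) =
      (if i = j then xs ! i else 0)" using ij by simp
qed

text \<open>The vector \<open>(x, y)\<close> of value \<open>c\<close> is accompanied by its
  orthogonal vector \<open>(- b * y, a * x)\<close>, whose value is
  \<open>a * b * c\<close>.\<close>

lemma lrep_binary:
  assumes "c = a * x^2 + b * y^2"
  shows "lrep [a, b] [c, a * b * c]"
proof (rule lrepI[where f = "\<lambda>i k. if i = 0 then (if k = 0 then x else y) else if k = 0 then - b * y else a * x"])
  fix i j assume "i < length [c, a * b * c]" "j < length [c, a * b * c]"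
  then have "i = 0 \<or> i = 1" "j = 0 \<or> j = 1" by auto
  then show "(\<Sum>k<length [a, b]. [a, b] ! k * (if i = 0 then (if k = 0 then x else y) else if k = 0 then - b * y else a * x) *
      (if j = 0 then (if k = 0 then x else y) else if k = 0 then - b * y else a * x)) =
      (if i = j then [c, a * b * c] ! i else 0)"
    using assms by (auto simp: numeral_2_eq_2 power2_eq_square algebra_simps)
qed

text \<open>The coefficients form the inverse of the base change in \<open>lrep_binary\<close>,
  whose determinant is \<open>c\<close>.\<close>

lemma lrep_binary_rev:
  assumes "c = a * x^2 + b * y^2" "c \<noteq> 0"
  shows "lrep [c, a * b * c] [a, b]"
proof (rule lrepI[where f = "\<lambda>i k. if i = 0 then (if k = 0 then a * x / c else - y / c) else if k = 0 then b * y / c else x / c"])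
  fix i j assume "i < length [a, b]" "j < length [a, b]"
  then have ij: "i = 0 \<or> i = 1" "j = 0 \<or> j = 1" by auto
  have 1: "c * (a * x / c) * (a * x / c) + a * b * c * (- y / c) * (- y / c) = a * (a * x^2 + b * y^2) / c"
    using assms(2) by (simp add: power2_eq_square field_simps)
  have 2: "c * (b * y / c) * (b * y / c) + a * b * c * (x / c) * (x / c) = b * (a * x^2 + b * y^2) / c"
    using assms(2) by (simp add: power2_eq_square field_simps)
  have 3: "c * (a * x / c) * (b * y / c) + a * b * c * (- y / c) * (x / c) = 0"
    "c * (b * y / c) * (a * x / c) + a * b * c * (x / c) * (- y / c) = 0"
    by simp_all
  have 4: "a * (a * x^2 + b * y^2) / c = a" "b * (a * x^2 + b * y^2) / c = b"
    using assms by (simp_all flip: assms(1))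
  show "(\<Sum>k<length [c, a * b * c]. [c, a * b * c] ! k * (if i = 0 then (if k = 0 then a * x / c else - y / c) else if k = 0 then b * y / c else x / c) *
      (if j = 0 then (if k = 0 then a * x / c else - y / c) else if k = 0 then b * y / c else x / c)) =
      (if i = j then [a, b] ! i else 0)"
    using ij 1[unfolded 4] 2[unfolded 4] 3 by (auto simp del: times_divide_eq_left times_divide_eq_right)
qed

text \<open>The first basis vector is mapped to \<open>(t, w)\<close>. The reflection carrying \<open>(t, w)\<close> back to \<open>(1, 0)\<close>, or to
  \<open>(-1, 0)\<close> if \<open>t = 1\<close>, carries \<open>(s\<^sub>i, u\<^sub>i)\<close> to \<open>(0, u\<^sub>i + c s\<^sub>i w)\<close>.\<close>

lemma lrep_cancel:
  assumes two: "(2::'a::field) \<noteq> 0" and a: "a \<noteq> (0::'a)" and r: "lrep (a # xs) (a # ys)"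
  shows "lrep xs ys"
proof -
  obtain f where f: "\<And>i j. i < length (a # ys) \<Longrightarrow> j < length (a # ys) \<Longrightarrow>
      (\<Sum>k<length (a # xs). (a # xs) ! k * f i k * f j k) = (if i = j then (a # ys) ! i else 0)"
    using r unfolding lrep_iff by blast
  define t where "t = f 0 0"
  define w where "w k = f 0 (Suc k)" for k
  define s where "s i = f (Suc i) 0" for i
  define u where "u i k = f (Suc i) (Suc k)" for i k
  have ww: "(\<Sum>k<length xs. xs ! k * w k * w k) = a - a * t * t"
    using f[of 0 0] by (simp add: sum.lessThan_Suc_shift t_def w_def algebra_simps del: sum.lessThan_Suc)
  have uw: "(\<Sum>k<length xs. xs ! k * u i k * w k) = - (a * s i * t)" if "i < length ys" for i
    using f[of "Suc i" 0] that
    by (simp add: sum.lessThan_Suc_shift t_def w_def s_def u_def eq_neg_iff_add_eq_0 add.commute del: sum.lessThan_Suc)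
  have wu: "(\<Sum>k<length xs. xs ! k * w k * u i k) = - (a * s i * t)" if "i < length ys" for i
    using uw[OF that] by (simp add: ac_simps)
  have uu: "(\<Sum>k<length xs. xs ! k * u i k * u j k) = (if i = j then ys ! i else 0) - a * s i * s j"
    if "i < length ys" "j < length ys" for i j
    using f[of "Suc i" "Suc j"] that
    by (simp add: sum.lessThan_Suc_shift s_def u_def eq_diff_eq add.commute del: sum.lessThan_Suc)
  obtain c where c: "c * c * (1 - t * t) - 2 * c * t = 1"
  proof (cases "t = 1")
    case True
    then show ?thesis using two by (intro that[of "- 1 / 2"]) simp
  next
    case False
    then have nz: "1 - t \<noteq> 0" by simp
    define q where "q = 1 / (1 - t)"
    have q: "q * (1 - t) = 1" using nz by (simp add: q_def)
    have "q * q * (1 - t * t) - 2 * q * t = q * (q * (1 - t)) * (1 + t) - 2 * q * t"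
      by (simp add: algebra_simps)
    also have "\<dots> = q * (1 - t)" by (subst q) (simp add: algebra_simps)
    finally show ?thesis using that[of q] q by simp
  qed
  show ?thesis
  proof (rule lrepI[where f = "\<lambda>i k. u i k + c * s i * w k"])
    fix i j assume ij: "i < length ys" "j < length ys"
    have "(\<Sum>k<length xs. xs ! k * (u i k + c * s i * w k) * (u j k + c * s j * w k)) =
      (\<Sum>k<length xs. xs ! k * u i k * u j k + c * s j * (xs ! k * u i k * w k) +
        c * s i * (xs ! k * w k * u j k) + c * c * s i * s j * (xs ! k * w k * w k))"
      by (intro sum.cong refl) (simp add: algebra_simps)
    also have "\<dots> = (if i = j then ys ! i else 0) - a * s i * s j + c * s j * - (a * s i * t) +
        c * s i * - (a * s j * t) + c * c * s i * s j * (a - a * t * t)"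
      unfolding sum.distrib sum_distrib_left[symmetric] ww uw[OF ij(1)] wu[OF ij(2)] uu[OF ij] by simp
    also have "\<dots> = (if i = j then ys ! i else 0) + a * s i * s j * (c * c * (1 - t * t) - 2 * c * t - 1)"
      by (simp add: algebra_simps)
    finally show "(\<Sum>k<length xs. xs ! k * (u i k + c * s i * w k) * (u j k + c * s j * w k)) =
        (if i = j then ys ! i else 0)" using c by simp
  qed
qed

text \<open>A multiset of field elements stands for the diagonal form with these entries.\<close>

definition mrep :: "'a::field multiset \<Rightarrow> 'a multiset \<Rightarrow> bool" where
  "mrep A B \<longleftrightarrow> (\<exists>xs ys. mset xs = A \<and> mset ys = B \<and> lrep xs ys)"

lemma mrep_mset: "mrep (mset xs) (mset ys) \<longleftrightarrow> lrep xs ys"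
  unfolding mrep_def using lrep_mset lrep_trans by metis

lemma mrep_refl [simp]: "mrep A A"
  using mrep_mset lrep_mset ex_mset by metis

lemma mrep_trans [trans]: "mrep A B \<Longrightarrow> mrep B C \<Longrightarrow> mrep A C"
  using mrep_mset lrep_trans ex_mset by metis

lemma mrep_add: "mrep A A' \<Longrightarrow> mrep B B' \<Longrightarrow> mrep (A + B) (A' + B')"
  unfolding mrep_def using lrep_append mset_append by metis

lemma mrep_drop: "mrep (A + B) A"
proof -
  obtain xs ys where "mset xs = A" "mset ys = B" using ex_mset by metis
  then show ?thesis using lrep_drop[of xs ys] mrep_mset[of "xs @ ys" xs] by simp
qed

lemma mrep_subset: "B \<subseteq># A \<Longrightarrow> mrep A B"
  using mrep_drop[of B "A - B"] by simp

lemma mrep_cancel: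
  assumes "(2::'a::field) \<noteq> 0" "0 \<notin># (C :: 'a multiset)" "mrep (C + A) (C + B)"
  shows "mrep A B"
  using assms(2,3)
proof (induction C)
  case (add a C)
  obtain xs ys where "mset xs = C + A" "mset ys = C + B" using ex_mset by metis
  then have "mrep (C + A) (C + B)"
    using add.prems lrep_cancel[OF assms(1), of a xs ys] mrep_mset[of "a # xs" "a # ys"] mrep_mset[of xs ys]
    by simp
  then show ?case using add by simp
qed simp

lemma mrep_binary:
  assumes "c = a * x^2 + b * y^2" "c \<noteq> 0"
  shows "mrep {#a, b#} {#c, a * b * c#}" "mrep {#c, a * b * c#} {#a, b#}"
  using mrep_mset[of "[a, b]" "[c, a * b * c]"] mrep_mset[of "[c, a * b * c]" "[a, b]"]
    lrep_binary[OF assms(1)] lrep_binary_rev[OF assms] by simp_all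

lemma mrep_scale: "mrep {#a#} {#a * s^2#}"
  using mrep_mset[of "[a]" "[a * s^2]"] lrepI[of "[a * s^2]" "[a]" "\<lambda>_ _. s"]
  by (simp add: power2_eq_square ac_simps)

lemma mrep_singleD:
  assumes "mrep (mset xs) {#c#}"
  shows "\<exists>f. c = (\<Sum>k<length xs. xs ! k * (f k)^2)"
proof -
  have "lrep xs [c]" using assms mrep_mset[of xs "[c]"] by simp
  then obtain f where "(\<Sum>k<length xs. xs ! k * f 0 k * f 0 k) = c" unfolding lrep_iff by auto
  then show ?thesis by (intro exI[of _ "f 0"]) (auto simp: power2_eq_square mult.assoc)
qed

text \<open>Lagrange reduction; when all diagonal entries vanish, a hyperbolic pair of rows is split off.\<close>

lemma diagonalize_aux:
  fixes D :: "nat \<Rightarrow> nat \<Rightarrow> 'a::field"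
  assumes two: "(2::'a) \<noteq> 0" and fin: "finite S"
    and "\<And>i j. D i j = D j i" "\<And>i j. i \<notin> S \<Longrightarrow> D i j = 0"
  shows "\<exists>ps. length ps \<le> card S \<and> (\<forall>p\<in>set ps. fst p \<noteq> 0) \<and>
    (\<forall>i j. D i j = sum_list (map (\<lambda>(a, x). a * x i * x j) ps))"
  using assms(2-)
proof (induction "card S" arbitrary: S D rule: less_induct)
  case less
  note sym = less.prems(2) and supp = less.prems(3)
  consider i where "D i i \<noteq> 0" | i j where "\<forall>i. D i i = 0" "D i j \<noteq> 0" | "\<forall>i j. D i j = 0" by blast
  then show ?case
  proof cases
    case 1
    define d where "d = D i i"
    define E where "E k l = D k l - D i k * D i l / d" for k l
    have d: "d \<noteq> 0" "i \<in> S" using 1 supp by (auto simp: d_def)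
    have "\<exists>ps. length ps \<le> card (S - {i}) \<and> (\<forall>p\<in>set ps. fst p \<noteq> 0) \<and>
        (\<forall>k l. E k l = sum_list (map (\<lambda>(a, x). a * x k * x l) ps))"
    proof (rule less.hyps)
      show "card (S - {i}) < card S" using d less.prems(1) by (meson card_Diff1_less)
      show "E k l = E l k" for k l using sym[of k l] by (simp add: E_def mult.commute)
      show "E k l = 0" if k: "k \<notin> S - {i}" for k l
      proof (cases "k = i")
        case False
        then have "D k l = 0" "D i k = 0" using k supp sym[of i k] by auto
        then show ?thesis by (simp add: E_def)
      qed (use d in \<open>simp add: E_def d_def\<close>)
    qed (use less.prems in simp)
    then obtain ps where ps: "length ps \<le> card (S - {i})" "\<forall>p\<in>set ps. fst p \<noteq> 0"
      "\<And>k l. E k l = sum_list (map (\<lambda>(a, x). a * x k * x l) ps)" by blast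
    have c: "card S = Suc (card (S - {i}))" using d less.prems(1) by (metis card_Suc_Diff1)
    show ?thesis
    proof (intro exI[of _ "(1 / d, D i) # ps"] conjI allI)
      fix k l
      show "D k l = sum_list (map (\<lambda>(a, x). a * x k * x l) ((1 / d, D i) # ps))"
        using ps(3)[of k l] d by (simp add: E_def field_simps)
      show "length ((1 / d, D i) # ps) \<le> card S" using ps(1) unfolding c by simp
    qed (use ps(2) d in auto)
  next
    case 2
    define d where "d = D i j"
    define E where "E k l = D k l - (D i k * D j l + D j k * D i l) / d" for k l
    have d: "d \<noteq> 0" "i \<in> S" "j \<in> S" "i \<noteq> j" "D j i = d"
      using 2 supp[of i j] supp[of j i] sym[of i j] by (auto simp: d_def)
    have "\<exists>ps. length ps \<le> card (S - {i, j}) \<and> (\<forall>p\<in>set ps. fst p \<noteq> 0) \<and>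
        (\<forall>k l. E k l = sum_list (map (\<lambda>(a, x). a * x k * x l) ps))"
    proof (rule less.hyps)
      show "card (S - {i, j}) < card S" using d less.prems(1) by (intro psubset_card_mono) auto
      show "E k l = E l k" for k l using sym[of k l] by (simp add: E_def ac_simps)
      show "E k l = 0" if k: "k \<notin> S - {i, j}" for k l
      proof -
        consider "k = i" | "k = j" | "k \<notin> S" using k by blast
        then show ?thesis
        proof cases
          case 3
          then have "D k l = 0" "D i k = 0" "D j k = 0" using supp sym[of i k] sym[of j k] by auto
          then show ?thesis by (simp add: E_def)
        qed (use d 2 in \<open>simp_all add: E_def d_def[symmetric]\<close>)
      qed
    qed (use less.prems in simp)
    then obtain ps where ps: "length ps \<le> card (S - {i, j})" "\<forall>p\<in>set ps. fst p \<noteq> 0"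
      "\<And>k l. E k l = sum_list (map (\<lambda>(a, x). a * x k * x l) ps)" by blast
    have "card (S - {i, j}) = card S - 2" "2 \<le> card S"
      using d less.prems(1) card_mono[of S "{i, j}"] by (auto simp: card_Diff_subset)
    then have c: "card S = Suc (Suc (card (S - {i, j})))" by simp
    \<comment> \<open>The symmetric product of the rows \<open>D i\<close> and \<open>D j\<close> is
      a difference of squares of their sum and their difference; this diagonalizes the plane that is
      split off.\<close>
    define p q where "p = (1 / (2 * d), \<lambda>k. D i k + D j k)" and "q = (- 1 / (2 * d), \<lambda>k. D i k - D j k)"
    show ?thesis
    proof (intro exI[of _ "p # q # ps"] conjI allI)
      fix k l
      have pq: "1 / (2 * d) * (D i k + D j k) * (D i l + D j l) + - 1 / (2 * d) * (D i k - D j k) * (D i l - D j l)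
          = ((D i k + D j k) * (D i l + D j l) - (D i k - D j k) * (D i l - D j l)) / (2 * d)"
        by (simp add: diff_divide_distrib left_diff_distrib)
      also have "(D i k + D j k) * (D i l + D j l) - (D i k - D j k) * (D i l - D j l) =
          2 * (D i k * D j l + D j k * D i l)" by (simp add: algebra_simps)
      also have "2 * (D i k * D j l + D j k * D i l) / (2 * d) = (D i k * D j l + D j k * D i l) / d"
        by (rule mult_divide_mult_cancel_left[OF two])
      finally show "D k l = sum_list (map (\<lambda>(a, x). a * x k * x l) (p # q # ps))"
        using ps(3)[of k l] by (simp add: E_def p_def q_def algebra_simps)
      show "length (p # q # ps) \<le> card S" using ps(1) unfolding c by simp
    qed (use ps(2) d two in \<open>auto simp: p_def q_def\<close>)
  next
    case 3
    then show ?thesis by (intro exI[of _ "[]"]) auto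
  qed
qed

lemma diagonalize:
  fixes M :: "'a::field mat"
  assumes two: "(2::'a) \<noteq> 0" and M: "M \<in> carrier_mat n n" "M\<^sup>T = M"
  obtains xs where "length xs = n" "0 \<notin> set xs" "frep (diagL xs) M"
proof -
  define D where "D i j = (if i < n \<and> j < n then M $$ (i, j) else 0)" for i j
  have "M $$ (i, j) = M $$ (j, i)" if "i < n" "j < n" for i j
    using that M by (metis carrier_matD index_transpose_mat(1))
  then have "\<exists>ps. length ps \<le> card {..<n} \<and> (\<forall>p\<in>set ps. fst p \<noteq> 0) \<and>
    (\<forall>i j. D i j = sum_list (map (\<lambda>(a, x). a * x i * x j) ps))"
    by (intro diagonalize_aux[OF two]) (auto simp: D_def)
  then obtain ps where ps: "length ps \<le> n" "\<forall>p\<in>set ps. fst p \<noteq> 0"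
    "\<And>i j. D i j = sum_list (map (\<lambda>(a, x). a * x i * x j) ps)" by auto
  \<comment> \<open>The padding entries 1 carry the zero coordinate function: values do not change,
    and the list has length \<open>n\<close> with nonzero entries even if \<open>M\<close> is
    degenerate.\<close>
  define qs where "qs = ps @ replicate (n - length ps) (1, \<lambda>_. 0)"
  have qs: "length qs = n" "\<forall>p\<in>set qs. fst p \<noteq> 0" using ps by (auto simp: qs_def)
  have D: "D i j = (\<Sum>k<n. fst (qs ! k) * snd (qs ! k) i * snd (qs ! k) j)" for i j
  proof -
    have "D i j = sum_list (map (\<lambda>(a, x). a * x i * x j) qs)"
      using ps(3) by (simp add: qs_def sum_list_replicate)
    also have "\<dots> = (\<Sum>k<n. (\<lambda>(a, x). a * x i * x j) (qs ! k))"
      using qs by (simp add: sum_list_sum_nth atLeast0LessThan)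
    finally show ?thesis by (simp add: case_prod_unfold)
  qed
  have "frep (diagL (map fst qs)) M"
    unfolding rep_over_iff[OF diagL_carrier M(1)] bform_diagL
  proof (intro exI[of _ "\<lambda>i k. snd (qs ! k) i"] conjI allI impI TrueI)
    fix i j assume "i < n" "j < n"
    then show "M $$ (i, j) = (\<Sum>k<length (map fst qs). map fst qs ! k * snd (qs ! k) i * snd (qs ! k) j)"
      using D[of i j] qs(1) by (simp add: D_def)
  qed
  moreover have "0 \<notin> set (map fst qs)" using qs(2) by (metis imageE list.set_map)
  ultimately show ?thesis using that[of "map fst qs"] qs(1) by simp
qed

section \<open>Anisotropic kernels\<close>

text \<open>Mutual representation stands for isometry; for nondegenerate forms it forces equal
  dimensions, and the two notions agree.\<close>

definition meq :: "'a::field multiset \<Rightarrow> 'a multiset \<Rightarrow> bool" where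
  "meq A B \<longleftrightarrow> mrep A B \<and> mrep B A"

lemma meq_refl [simp]: "meq A A" by (simp add: meq_def)

lemma meq_sym: "meq A B \<Longrightarrow> meq B A" by (simp add: meq_def)

lemma meq_trans [trans]: "meq A B \<Longrightarrow> meq B C \<Longrightarrow> meq A C"
  unfolding meq_def using mrep_trans by blast

lemma meq_add: "meq A A' \<Longrightarrow> meq B B' \<Longrightarrow> meq (A + B) (A' + B')"
  unfolding meq_def using mrep_add by blast

lemma meq_mrep: "meq A B \<Longrightarrow> mrep A B" by (simp add: meq_def)

lemma meq_mrep_trans [trans]: "meq A B \<Longrightarrow> mrep B C \<Longrightarrow> mrep A C"
  "mrep A B \<Longrightarrow> meq B C \<Longrightarrow> mrep A C"
  unfolding meq_def using mrep_trans by blast+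

lemma meq_binary:
  "c = a * x^2 + b * y^2 \<Longrightarrow> c \<noteq> 0 \<Longrightarrow> meq {#a, b#} {#c, a * b * c#}"
  unfolding meq_def using mrep_binary by blast

lemma mrep_sqeq: "sqeq a b \<Longrightarrow> mrep {#b#} {#a#}"
  using mrep_scale by (auto simp: sqeq_def)

lemma meq_sqeq: "sqeq a b \<Longrightarrow> meq {#a#} {#b#}"
  unfolding meq_def by (intro conjI mrep_sqeq sqeq_sym[of a b])

lemma meq_pair: "sqeq a a' \<Longrightarrow> sqeq b b' \<Longrightarrow> meq {#a, b#} {#a', b'#}"
  using meq_add[OF meq_sqeq meq_sqeq, of b b' a a'] by simp

lemma lrep_scale:
  assumes "lrep xs ys" shows "lrep (map ((*) s) xs) (map ((*) s) ys)"
proof -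
  obtain f where f: "\<And>i j. i < length ys \<Longrightarrow> j < length ys \<Longrightarrow>
      (\<Sum>k<length xs. xs ! k * f i k * f j k) = (if i = j then ys ! i else 0)"
    using assms unfolding lrep_iff by blast
  show ?thesis
  proof (rule lrepI[where f = f])
    fix i j assume ij: "i < length (map ((*) s) ys)" "j < length (map ((*) s) ys)"
    have "(\<Sum>k<length (map ((*) s) xs). map ((*) s) xs ! k * f i k * f j k) =
        s * (\<Sum>k<length xs. xs ! k * f i k * f j k)"
      by (simp add: sum_distrib_left mult.assoc)
    then show "(\<Sum>k<length (map ((*) s) xs). map ((*) s) xs ! k * f i k * f j k) =
        (if i = j then map ((*) s) ys ! i else 0)" using f ij by simp
  qed
qed

lemma mrep_image_scale: "mrep A B \<Longrightarrow> mrep (image_mset ((*) s) A) (image_mset ((*) s) B)"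
  unfolding mrep_def using lrep_scale by (metis mset_map)

lemma meq_image_scale: "meq A B \<Longrightarrow> meq (image_mset ((*) s) A) (image_mset ((*) s) B)"
  unfolding meq_def using mrep_image_scale by blast

text \<open>The norm form with parameter \<open>D\<close> scaled by \<open>c\<close>. Every diagonal
  binary form with nonzero first entry has this shape; up to squares its determinant is
  \<open>- D\<close>.\<close>

definition bin :: "'a::field \<Rightarrow> 'a \<Rightarrow> 'a multiset" where
  "bin c D = {#c, - (c * D)#}"

definition hyp :: "nat \<Rightarrow> 'a::field multiset" where
  "hyp k = repeat_mset k {#1, - 1#}"

lemma hyp_0 [simp]: "hyp 0 = {#}" by (simp add: hyp_def)

lemma hyp_Suc: "hyp (Suc k) = bin 1 1 + hyp k"
  by (simp add: hyp_def bin_def)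

lemma hyp_add: "hyp (j + k) = hyp j + hyp k"
  by (induction j) (simp_all add: hyp_Suc ac_simps)

lemma size_hyp [simp]: "size (hyp k) = 2 * k"
  by (induction k) (simp_all add: hyp_Suc bin_def)

lemma hyp_nz: "0 \<notin># hyp k"
  by (induction k) (simp_all add: hyp_Suc bin_def)

lemma bin_pair: "a \<noteq> 0 \<Longrightarrow> bin a (- (b / a)) = {#a, b#}"
  by (simp add: bin_def)

text \<open>\<open>c * g\<close> is a value of the form, and a binary form is determined by its
  determinant and one nonzero value.\<close>

lemma bin_norm:
  assumes "c \<noteq> 0" "g \<in> normgroup D" shows "meq (bin c D) (bin (c * g) D)"
proof -
  obtain x y where g: "g \<noteq> 0" "g = x^2 - D * y^2" using assms by (auto simp: normgroup_def)
  have "meq {#c, - (c * D)#} {#c * g, c * - (c * D) * (c * g)#}"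
  proof (rule meq_binary)
    show "c * g = c * x^2 + - (c * D) * y^2" unfolding g(2) by (simp add: algebra_simps)
  qed (use assms g in simp)
  also have "meq {#c * g, c * - (c * D) * (c * g)#} {#c * g, - (c * g * D)#}"
    by (intro meq_pair sqeq_refl sqeqI[of c]) (use assms in \<open>simp_all add: power2_eq_square\<close>)
  finally show ?thesis by (simp add: bin_def)
qed

lemma bin_eq:
  assumes "c \<noteq> 0" "c' / c \<in> normgroup D" shows "meq (bin c D) (bin c' D)"
  using bin_norm[OF assms] assms(1) by simp

lemma bin_sqeq: "sqeq D E \<Longrightarrow> meq (bin c D) (bin c E)"
  unfolding bin_def using sqeq_mult[of "- c" "- c" D E] by (intro meq_pair) auto

lemma image_scale_bin: "image_mset ((*) s) (bin c D) = bin (s * c) D"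
  by (simp add: bin_def mult.assoc)

context dyadic
begin

lemma bin_hyp: "c \<noteq> (0::'a) \<Longrightarrow> c' \<noteq> 0 \<Longrightarrow> meq (bin c 1) (bin c' 1)"
  by (rule bin_eq) (simp_all add: normgroup_of_one)

lemma hyp_1_pair: "b \<noteq> (0::'a) \<Longrightarrow> meq (hyp 1) {#b, - b#}"
  using bin_hyp[of 1 b] by (simp add: hyp_Suc bin_def)

lemma hyp_1_rep: "b \<noteq> (0::'a) \<Longrightarrow> mrep (hyp 1) {#b#}"
  by (rule meq_mrep_trans(1)[OF hyp_1_pair]) (auto intro: mrep_subset)

end

context dyadic_pi
begin

text \<open>The orthogonal complement of a vector of value \<open>- a\<close> in the anisotropic
  quaternary space \<open>quat\<close>. Accordingly it cannot have the value
  \<open>a\<close>.\<close>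

definition tern :: "'a \<Rightarrow> 'a multiset" where
  "tern a = {#\<Delta> * a#} + bin (\<pi> * a) \<Delta>"

text \<open>Up to isometry, the norm form of the quaternion division algebra; the sign of the second
  plane is immaterial, since -1 is an unramified norm.\<close>

definition quat :: "'a multiset" where
  "quat = bin 1 \<Delta> + bin \<pi> \<Delta>"

lemma bin_Delta: "c \<noteq> 0 \<Longrightarrow> c' \<noteq> 0 \<Longrightarrow> even (v c' - v c) \<Longrightarrow> meq (bin c \<Delta>) (bin c' \<Delta>)"
  by (rule bin_eq) (auto simp: normgroup_Delta v_divide)

lemma image_scale_tern: "image_mset ((*) s) (tern a) = tern (s * a)"
  by (simp add: tern_def image_scale_bin ac_simps)

text \<open>The value \<open>a\<close> would give
  \<open>1 - \<Delta> * z^2 = \<pi> * (x^2 - \<Delta> * y^2)\<close>, with a norm of even order on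
  the left and an element of odd order on the right.\<close>

lemma tern_not_rep:
  assumes a: "a \<noteq> 0" shows "\<not> mrep (tern a) {#a#}"
proof
  assume "mrep (tern a) {#a#}"
  then have "mrep (mset [\<Delta> * a, \<pi> * a, - (\<pi> * a * \<Delta>)]) {#a#}"
    by (simp add: tern_def bin_def add_mset_commute)
  from mrep_singleD[OF this] obtain f where
    "a = \<Delta> * a * (f 0)^2 + \<pi> * a * (f (Suc 0))^2 - \<pi> * a * \<Delta> * (f (Suc (Suc 0)))^2" by auto
  then obtain x y z where "a = \<Delta> * a * z^2 + \<pi> * a * x^2 - \<pi> * a * \<Delta> * y^2" by blast
  then have "a * (1 - \<Delta> * z^2) = a * (\<pi> * (x^2 - \<Delta> * y^2))" by (simp add: algebra_simps)
  then have e: "1^2 - \<Delta> * z^2 = \<pi> * (x^2 - \<Delta> * y^2)" using a by simp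
  have nz: "1^2 - \<Delta> * z^2 \<noteq> 0" using Delta_form_nz[of 1 z] by auto
  then have "even (v (1^2 - \<Delta> * z^2))" using normgroupI normgroup_Delta by blast
  moreover have nz2: "x^2 - \<Delta> * y^2 \<noteq> 0" using nz e by auto
  then have "even (v (x^2 - \<Delta> * y^2))" using normgroupI normgroup_Delta by blast
  ultimately show False unfolding e using nz2 by (simp add: v_mult)
qed

text \<open>If \<open>c\<close> were a norm, \<open>bin 1 D\<close> could be rewritten to begin with
  \<open>c\<close>. Together with \<open>- c\<close> this splits off a hyperbolic plane, which would
  supply the forbidden value \<open>x\<close>.\<close>

lemma tern_nonnorm:
  assumes "meq (tern x) (bin 1 D + {#- c#})" "x \<noteq> 0" "c \<noteq> 0"
  shows "c \<notin> normgroup D"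
proof
  assume "c \<in> normgroup D"
  then have "meq (bin 1 D) (bin c D)" using bin_norm[of 1 c D] by simp
  then have "meq (bin 1 D + {#- c#}) (bin c D + {#- c#})" by (intro meq_add) auto
  with assms(1) have "meq (tern x) (bin c D + {#- c#})" by (rule meq_trans)
  also have "bin c D + {#- c#} = bin c 1 + {#- (c * D)#}"
    by (simp add: bin_def add_mset_commute)
  also have "mrep (bin c 1 + {#- (c * D)#}) (bin c 1)" by (rule mrep_drop)
  also have "meq (bin c 1) (bin x 1)" using assms bin_hyp by simp
  also have "mrep (bin x 1) {#x#}" by (rule mrep_subset) (simp add: bin_def)
  finally show False using tern_not_rep assms(2) by blast
qed

text \<open>The constant \<open>c\<close> solves
  \<open>\<delta> - c * (\<delta> - 1) = \<Delta>\<close>. With \<open>a = \<delta> - 1\<close> this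
  makes the plane with entries \<open>a * \<delta>\<close> and \<open>- c\<close> take the value
  \<open>\<Delta> / a\<close>, which together with \<open>- a\<close> forms an unramified plane of
  odd order; the remaining entry is a unit.\<close>

lemma tern_unit:
  assumes a: "odd (v (\<delta> - 1))" "1 \<le> v (\<delta> - 1)" "v (\<delta> - 1) < 2 * v 2" "\<delta> \<noteq> 1"
  defines "c \<equiv> 1 + 4 * \<rho> * inverse (\<delta> - 1)"
  shows "c \<noteq> 0" "v c = 0" "meq (tern (- (\<delta> * c))) (bin 1 \<delta> + {#- c#})" "\<delta> \<noteq> 0" "v \<delta> = 0"
proof -
  define a where "a = \<delta> - 1"
  have anz: "a \<noteq> 0" and va: "odd (v a)" "1 \<le> v a" "v a < 2 * v 2" using assms by (auto simp: a_def)
  have da: "\<delta> = 1 + a" by (simp add: a_def)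
  show d: "\<delta> \<noteq> 0" "v \<delta> = 0" using v_add_less[of 1 a] va by (auto simp: da vge_def)
  have "vge (4 * \<rho> * inverse a) 1"
    using va anz by (simp add: vge_def v_mult v_inverse v_four)
  then show cnz: "c \<noteq> 0" and vc: "v c = 0"
    using v_add_less[of 1 "4 * \<rho> * inverse a"] by (auto simp: c_def a_def)
  have h: "- a \<in> normgroup \<delta>" using anz by (intro normgroupI[of _ 1 \<delta> 1]) (auto simp: a_def)
  have ca: "c * a = a + 4 * \<rho>" using anz by (simp add: c_def a_def[symmetric] algebra_simps)
  have w: "\<Delta> / a = (a * \<delta>) * (1 / a)^2 + (- c) * 1^2"
  proof -
    have "\<Delta> = \<delta> - c * a" by (simp add: ca da Delta_def)
    then have "\<Delta> / a = \<delta> / a - c" using anz by (simp add: diff_divide_distrib)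
    then show ?thesis using anz by (simp add: power2_eq_square)
  qed
  have "meq (bin 1 \<delta>) (bin (- a) \<delta>)" using bin_norm[OF _ h, of 1] by simp
  then have "meq (bin 1 \<delta> + {#- c#}) (bin (- a) \<delta> + {#- c#})" by (intro meq_add) auto
  also have "bin (- a) \<delta> + {#- c#} = {#- a#} + {#a * \<delta>, - c#}" by (simp add: bin_def add_mset_commute)
  also have "meq ({#- a#} + {#a * \<delta>, - c#}) ({#- a#} + {#\<Delta> / a, a * \<delta> * - c * (\<Delta> / a)#})"
    by (intro meq_add meq_refl meq_binary[OF w]) (use anz in simp)
  also have "{#- a#} + {#\<Delta> / a, a * \<delta> * - c * (\<Delta> / a)#} = {#\<Delta> * - (\<delta> * c)#} + {#- a, \<Delta> / a#}"
    using anz by (simp add: add_mset_commute mult.commute mult.left_commute)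
  also have "meq ({#\<Delta> * - (\<delta> * c)#} + {#- a, \<Delta> / a#}) ({#\<Delta> * - (\<delta> * c)#} + bin (- a) \<Delta>)"
    unfolding bin_def
    by (intro meq_add meq_refl meq_pair sqeqI[of "1 / a" "\<Delta> / a"]) (use anz in \<open>auto simp: power2_eq_square\<close>)
  also have "meq ({#\<Delta> * - (\<delta> * c)#} + bin (- a) \<Delta>) (tern (- (\<delta> * c)))"
    unfolding tern_def
    by (intro meq_add meq_refl bin_Delta) (use anz va d cnz vc in \<open>auto simp: v_mult\<close>)
  finally show "meq (tern (- (\<delta> * c))) (bin 1 \<delta> + {#- c#})" by (rule meq_sym)
qed

text \<open>Regroup the entries 1, \<open>- D\<close>, \<open>- \<Delta>\<close> as
  \<open>- D\<close> and the plane \<open>bin 1 \<Delta>\<close>. As \<open>D\<close> has odd order,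
  this is the unramified plane occurring in \<open>tern (- (D * \<Delta>))\<close>.\<close>

lemma tern_prime:
  assumes D: "D \<noteq> 0" "odd (v D)"
  shows "meq (tern (- (D * \<Delta>))) (bin 1 D + {#- \<Delta>#})"
proof -
  have "meq (tern (- (D * \<Delta>))) ({#- D#} + bin 1 \<Delta>)"
    unfolding tern_def
    by (intro meq_add meq_sqeq sqeqI[of \<Delta>] bin_Delta) (use D in \<open>auto simp: v_mult power2_eq_square\<close>)
  then show ?thesis by (simp add: bin_def add_mset_commute)
qed

lemma tern_Delta: "meq (tern (- (\<pi> * \<Delta>))) (bin 1 \<Delta> + {#- \<pi>#})"
proof -
  have "meq (tern (- (\<pi> * \<Delta>))) ({#- \<pi>#} + bin 1 \<Delta>)"
    unfolding tern_def
    by (intro meq_add meq_sqeq sqeqI[of \<Delta>] bin_Delta) (auto simp: v_mult power2_eq_square)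
  then show ?thesis by (simp add: bin_def add_mset_commute)
qed

end

section \<open>Representatives of the square classes and values of anisotropic forms\<close>

locale dyadic_sys = dyadic_pi +
  fixes U :: "'a set"
  assumes U_units: "U \<subseteq> {x. unitO v x}"
    and U_reps: "\<forall>u. unitO v u \<longrightarrow> (\<exists>!\<delta>\<in>U. \<exists>w. unitO v w \<and> u = \<delta> * w^2)"
    and U_1: "1 \<in> U" and U_Delta: "\<Delta> \<in> U"
    and U_d: "\<forall>\<delta>\<in>U. dval v \<delta> = (if \<delta> = 1 then \<infinity> else enat (nat (v (\<delta> - 1))))"
begin

lemma U_nz: "u \<in> U \<Longrightarrow> u \<noteq> 0" and U_v: "u \<in> U \<Longrightarrow> v u = 0"
  using U_units by (auto simp: unitO_def)

lemma U_inj: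
  assumes "u \<in> U" "w \<in> U" "sqeq u w" shows "u = w"
proof -
  obtain s where s: "s \<noteq> 0" "u = w * s^2" using assms by (auto simp: sqeq_def)
  have "v s = 0" using s U_v[OF assms(1)] U_v[OF assms(2)] U_nz[OF assms(2)] by (simp add: v_mult v_power)
  then have "unitO v s" using s by (simp add: unitO_def)
  moreover have "unitO v u" "unitO v 1" using U_units assms by (auto simp: unitO_def)
  moreover have "u = u * 1^2" by simp
  ultimately show ?thesis using U_reps assms s by metis
qed

lemma U_cover:
  assumes D: "D \<noteq> 0"
  obtains u where "u \<in> U" "sqeq D u \<or> sqeq D (u * \<pi>)"
proof -
  have 1: "\<exists>u\<in>U. sqeq D u" if D: "D \<noteq> 0" "even (v D)" for D
  proof -
    obtain j where j: "v D = 2 * j" using D by (elim evenE)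
    define q where "q = \<pi> powi j"
    have q: "q \<noteq> 0" "v q = j" by (auto simp: q_def v_powi)
    have "unitO v (D / q^2)" using D q j by (simp add: unitO_def v_divide v_power)
    then obtain u w where u: "u \<in> U" "unitO v w" "D / q^2 = u * w^2" using U_reps by blast
    then have "D = u * (w * q)^2" using q by (simp add: field_simps)
    moreover have "w * q \<noteq> 0" using u q by (simp add: unitO_def)
    ultimately show ?thesis using u sqeqI by blast
  qed
  show ?thesis
  proof (cases "even (v D)")
    case True then show ?thesis using 1 D that by blast
  next
    case False
    then have "even (v (D / \<pi>))" using D by (simp add: v_divide)
    then obtain u where "u \<in> U" "sqeq (D / \<pi>) u" using 1[of "D / \<pi>"] D by auto
    then have "u \<in> U" "sqeq (D / \<pi> * \<pi>) (u * \<pi>)" using sqeq_mult[OF _ sqeq_refl] by blast+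
    then show ?thesis using that by simp
  qed
qed

text \<open>Unpacks the choice made in \<open>dval\<close>. Since \<open>\<delta> - 1\<close> is
  integral and a generator of the defect ideal has order at least \<open>v (\<delta> - 1)\<close>,
  the truncation by \<open>nat\<close> is harmless; the outcome is that no square approximates
  \<delta> better than 1 does.\<close>

lemma U_defect:
  assumes "\<delta> \<in> U" "\<delta> \<noteq> 1"
  shows "\<delta> - x^2 \<noteq> 0" "v (\<delta> - x^2) \<le> v (\<delta> - 1)" "0 \<le> v (\<delta> - 1)" "dint v \<delta> = v (\<delta> - 1)"
proof -
  have nn: "0 \<le> v (\<delta> - 1)"
  proof -
    have "vge (\<delta> - 1) 0" using U_v[OF assms(1)] by (intro vge_diff) (auto simp: vge_def)
    then show ?thesis using assms by (simp add: vge_def)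
  qed
  then show "0 \<le> v (\<delta> - 1)" .
  have dv: "dval v \<delta> = enat (nat (v (\<delta> - 1)))" using U_d assms by simp
  then show "dint v \<delta> = v (\<delta> - 1)" using nn by (simp add: dint_def)
  define a where "a = (SOME a. a \<noteq> 0 \<and> dideal v \<delta> = frac_ideal v a)"
  have ex: "\<exists>a. a \<noteq> 0 \<and> dideal v \<delta> = frac_ideal v a"
    using dv unfolding dval_def by (auto split: if_splits)
  then have a: "a \<noteq> 0" "dideal v \<delta> = frac_ideal v a"
    unfolding a_def by (metis (mono_tags, lifting) someI_ex)+
  have "nat (v a - v \<delta>) = nat (v (\<delta> - 1))"
    using dv ex unfolding dval_def a_def[symmetric] by simp
  moreover have "a \<in> dideal v \<delta>" using a by (simp add: frac_ideal_def)
  then have all: "a \<in> frac_ideal v (\<delta> - x^2)" for x by (auto simp: dideal_def)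
  then have "v (\<delta> - 1) \<le> v a" using a all[of 1] by (auto simp: frac_ideal_def)
  ultimately have "v a = v (\<delta> - 1)" using nn U_v[OF assms(1)] by simp
  then show "\<delta> - x^2 \<noteq> 0" "v (\<delta> - x^2) \<le> v (\<delta> - 1)" using a all[of x] by (auto simp: frac_ideal_def)
qed

text \<open>An even order below \<open>2 * v 2\<close> could be improved by the square of some
  \<open>1 + q * s\<close>. From order \<open>2 * v 2\<close> on, \<delta> has the form
  \<open>1 + 4 * w\<close>, and the two Artin-Schreier cosets for \<open>w\<close> make it a square
  or a square multiple of \<open>\<Delta>\<close>.\<close>

lemma U_defect_odd:
  assumes d: "\<delta> \<in> U" "\<delta> \<noteq> 1" "\<delta> \<noteq> \<Delta>"
  shows "odd (v (\<delta> - 1))" "1 \<le> v (\<delta> - 1)" "v (\<delta> - 1) < 2 * v 2"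
proof -
  define a where "a = \<delta> - 1"
  have anz: "a \<noteq> 0" and a0: "0 \<le> v a" using d U_defect[OF d(1,2)] by (auto simp: a_def)
  have bound: "\<not> vge (\<delta> - x^2) (v a + 1)" for x
    using U_defect(1,2)[OF d(1,2), of x] by (auto simp: a_def vge_def)
  have lt: "v a < 2 * v 2"
  proof (rule ccontr)
    assume ge: "\<not> v a < 2 * v 2"
    define w where "w = a / 4"
    have "4 * w = \<delta> - 1" by (simp add: w_def a_def)
    then have "\<delta> = 1 + 4 * w" by simp
    moreover have "vge w 0" using ge anz by (simp add: w_def vge_def v_divide v_four)
    ultimately have w: "vge w 0" "\<delta> = 1 + 4 * w" by simp_all
    obtain t where t: "vge t 0" "vge (w - t^2 - t) 1 \<or> vge (w - \<rho> - t^2 - t) 1"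
      using artin_schreier_cosets[OF w(1)] by blast
    from t(2) show False
    proof
      assume "vge (w - t^2 - t) 1"
      then obtain t' where t': "t'^2 + t' = w" using artin_schreier_lift t(1) by blast
      have "\<delta> - (1 + 2 * t')^2 = 0" unfolding w(2) t'[symmetric]
        by (simp add: power2_eq_square algebra_simps)
      then show False using U_defect(1)[OF d(1,2)] by blast
    next
      assume a1: "vge (w - \<rho> - t^2 - t) 1"
      \<comment> \<open>Chosen so that \<open>\<delta> = \<Delta> * (1 + 4 * w')\<close>. Modulo the
        maximal ideal \<open>w'\<close> is \<open>w + \<rho>\<close>, the same as
        \<open>w - \<rho>\<close>.\<close>
      define w' where "w' = (w + \<rho>) / \<Delta>"
      have e1: "w' - t^2 - t = (w + \<rho> - \<Delta> * (t^2 + t)) / \<Delta>"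
        using Delta_unit by (simp add: w'_def diff_divide_distrib)
      have e2: "w + \<rho> - \<Delta> * (t^2 + t) = (w - \<rho> - t^2 - t) + 2 * \<rho> + 4 * (\<rho> * (t^2 + t))"
        by (simp add: Delta_def algebra_simps)
      have "vge (4 * (\<rho> * (t^2 + t))) 1"
        using e_pos t(1) by (intro vge_mult_le[of 4 1 _ 0] vge_mult0 vge_add)
          (auto simp: vge_def[of 4] v_four power2_eq_square intro: vge_mult0)
      moreover have "vge (2 * \<rho>) 1" by (rule vge_mult_le[OF vge_2 vge_rho]) simp
      ultimately have "vge (w + \<rho> - \<Delta> * (t^2 + t)) 1"
        unfolding e2 using a1 by (intro vge_add)
      then have "vge (w' - t^2 - t) 1" unfolding e1 by (simp add: vge_divide_iff)
      then obtain t' where t': "t'^2 + t' = w'" using artin_schreier_lift t(1) by blast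
      have "\<Delta> * (1 + 2 * t')^2 = \<Delta> + 4 * (\<Delta> * (t'^2 + t'))"
        by (simp add: power2_eq_square algebra_simps)
      also have "\<dots> = \<delta>" using Delta_unit by (simp add: t' w'_def w(2)) (simp add: Delta_def)
      finally have e: "\<delta> = \<Delta> * (1 + 2 * t')^2" by simp
      moreover have "1 + 2 * t' \<noteq> 0" using e U_nz[OF d(1)] by auto
      ultimately show False using U_inj[OF d(1) U_Delta] sqeqI d(3) by blast
    qed
  qed
  then show "v (\<delta> - 1) < 2 * v 2" by (simp add: a_def)
  show od: "odd (v (\<delta> - 1))"
  proof
    assume "even (v (\<delta> - 1))"
    then obtain j where j: "v a = 2 * j" unfolding a_def by (elim evenE)
    define q where "q = \<pi> powi j"
    have q: "q \<noteq> 0" "v q = j" by (auto simp: q_def v_powi)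
    have "vge (a / q^2) 0" using anz q j by (simp add: vge_def v_divide v_power)
    then obtain s where s: "vge s 0" "vge (a / q^2 - s^2) 1" using residue_perfect by blast
    have qs: "vge (q * s) j" using vge_mult[OF vge_v s(1), of q] q by simp
    have 1: "vge (2 * (q * s)) (v a + 1)"
      by (rule vge_mult_le[OF vge_v qs]) (use j lt in linarith)
    have 2: "vge (q^2 * (a / q^2 - s^2)) (v a + 1)"
      using vge_mult_le[OF vge_v s(2), of "v a + 1" "q^2"] q j by (simp add: v_power)
    have "\<delta> - (1 + q * s)^2 = q^2 * (a / q^2 - s^2) - 2 * (q * s)"
      using q by (simp add: a_def power2_eq_square field_simps)
    then show False using vge_diff[OF 2 1] bound by metis
  qed
  then have "v (\<delta> - 1) \<noteq> 0" by auto
  then show "1 \<le> v (\<delta> - 1)" using a0 by (simp add: a_def)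
qed

text \<open>Both halves of the index statement for a nonsquare \<open>D\<close>: the isometry with
  \<open>tern x\<close> keeps \<open>c\<close> outside the norm group by
  \<open>tern_nonnorm\<close>, and the last clause bounds the index by two.\<close>

lemma nonnorm_exists:
  assumes D: "D \<noteq> 0" "\<not> sqeq D 1"
  obtains c x where "c \<noteq> 0" "x \<noteq> 0" "meq (tern x) (bin 1 D + {#- c#})"
    "\<And>b. b \<noteq> 0 \<Longrightarrow> b \<in> normgroup D \<or> b * c \<in> normgroup D"
proof -
  have "\<exists>c x. c \<noteq> 0 \<and> x \<noteq> 0 \<and> meq (tern x) (bin 1 D' + {#- c#}) \<and>
    (\<forall>b. b \<noteq> 0 \<longrightarrow> b \<in> normgroup D' \<or> b * c \<in> normgroup D') \<and> sqeq D D'" (is "\<exists>c x. ?P c x D'")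
    if DD: "sqeq D D'" and D': "D' = \<Delta> \<or> (D' \<in> U \<and> D' \<noteq> 1 \<and> D' \<noteq> \<Delta>) \<or> (\<exists>u\<in>U. D' = u * \<pi>)" for D'
    using D'
  proof (elim disjE)
    assume "D' = \<Delta>"
    then have "?P \<pi> (- (\<pi> * \<Delta>)) D'" using DD tern_Delta by (auto simp: normgroup_Delta v_mult)
    then show ?thesis by blast
  next
    assume "D' \<in> U \<and> D' \<noteq> 1 \<and> D' \<noteq> \<Delta>"
    then have d: "odd (v (D' - 1))" "1 \<le> v (D' - 1)" "v (D' - 1) < 2 * v 2" "D' \<noteq> 1"
      using U_defect_odd by auto
    have "?P (1 + 4 * \<rho> * inverse (D' - 1)) (- (D' * (1 + 4 * \<rho> * inverse (D' - 1)))) D'"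
      using tern_unit[OF d] norm_index_unit[OF d] DD by auto
    then show ?thesis by blast
  next
    assume "\<exists>u\<in>U. D' = u * \<pi>"
    then have d: "D' \<noteq> 0" "v D' = 1" using U_nz U_v by (auto simp: v_mult)
    have "?P \<Delta> (- (D' * \<Delta>)) D'" using tern_prime[of D'] norm_index_prime[OF d] DD d by auto
    then show ?thesis by blast
  qed
  note main = this
  obtain u where u: "u \<in> U" "sqeq D u \<or> sqeq D (u * \<pi>)" using U_cover[OF D(1)] by blast
  have "u \<noteq> 1 \<or> sqeq D (u * \<pi>)" using u D(2) by auto
  then have "\<exists>D'. sqeq D D' \<and> (D' = \<Delta> \<or> (D' \<in> U \<and> D' \<noteq> 1 \<and> D' \<noteq> \<Delta>) \<or> (\<exists>u\<in>U. D' = u * \<pi>))"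
    using u by blast
  then obtain D' where r1: "sqeq D D'" and D': "D' = \<Delta> \<or> (D' \<in> U \<and> D' \<noteq> 1 \<and> D' \<noteq> \<Delta>) \<or> (\<exists>u\<in>U. D' = u * \<pi>)"
    by blast
  obtain c x where r: "c \<noteq> 0" "x \<noteq> 0" "meq (tern x) (bin 1 D' + {#- c#})"
    "\<And>b. b \<noteq> 0 \<Longrightarrow> b \<in> normgroup D' \<or> b * c \<in> normgroup D'"
    using main[OF r1 D'] by blast
  note r(3)
  also have "meq (bin 1 D' + {#- c#}) (bin 1 D + {#- c#})"
    by (intro meq_add meq_refl bin_sqeq sqeq_sym[OF r1])
  finally show ?thesis using that[OF r(1,2)] r(4) normgroup_sqeq[OF r1] by simp
qed

lemma normgroup_index2:
  assumes "D \<noteq> 0" "(x::'a) \<noteq> 0" "y \<noteq> 0" "x \<notin> normgroup D" "y \<notin> normgroup D"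
  shows "x * y \<in> normgroup D"
proof -
  have "\<not> sqeq D 1" using assms normgroup_sqeq[of D 1] normgroup_of_one by auto
  then obtain c z where c: "c \<noteq> 0" "z \<noteq> 0" "meq (tern z) (bin 1 D + {#- c#})"
    "\<And>b. b \<noteq> 0 \<Longrightarrow> b \<in> normgroup D \<or> b * c \<in> normgroup D" using nonnorm_exists[OF assms(1)] by metis
  have "(x * c) * (y * c) \<in> normgroup D"
    by (rule normgroup_mult) (use c assms in blast)+
  then have "(x * y) * c^2 \<in> normgroup D" by (simp add: power2_eq_square ac_simps)
  then show ?thesis using normgroup_mult_iff[OF normgroup_square[OF c(1)]] by blast
qed

text \<open>Distinct square classes give distinct norm groups of index at most two, so their cosets meet.\<close>

lemma norm_cosets_meet:
  assumes D: "(D1::'a) \<noteq> 0" "D2 \<noteq> 0" "\<not> sqeq D1 D2" and ab: "a \<noteq> 0" "b \<noteq> 0"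
  obtains w where "w \<noteq> 0" "w / a \<in> normgroup D1" "w / b \<in> normgroup D2"
proof -
  have "\<not> sqeq (D1 * D2) 1"
  proof
    assume "sqeq (D1 * D2) 1"
    then have "sqeq (D1 * D2 * D2) (1 * D2)" using sqeq_mult sqeq_refl by blast
    moreover have "sqeq (D1 * D2 * D2) D1" using D by (intro sqeqI[of D2]) (auto simp: power2_eq_square)
    ultimately have "sqeq D1 D2" using sqeq_sym sqeq_trans by (metis mult_1)
    then show False using D by blast
  qed
  then obtain c x where "c \<noteq> 0" "x \<noteq> 0" "meq (tern x) (bin 1 (D1 * D2) + {#- c#})"
    using nonnorm_exists[of "D1 * D2"] D by (metis mult_eq_0_iff)
  then have c: "c \<noteq> 0" "c \<notin> normgroup (D1 * D2)" using tern_nonnorm by auto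
  \<comment> \<open>By symmetry the question moves to the norm group of \<open>c\<close>. A product
    outside it with index at most two means that exactly one of \<open>D1\<close>, \<open>D2\<close>
    lies in it. So \<open>c\<close> is a norm for one parameter only, and multiplication by
    \<open>c\<close> switches the coset of the other alone.\<close>
  then have "D1 * D2 \<notin> normgroup c" using normgroup_sym[of c "D1 * D2"] D by simp
  then have "(D1 \<in> normgroup c) \<noteq> (D2 \<in> normgroup c)"
    using normgroup_mult normgroup_index2[OF c(1) D(1,2)] by blast
  then have cc: "(c \<in> normgroup D1) \<noteq> (c \<in> normgroup D2)"
    using normgroup_sym[OF c(1) D(1)] normgroup_sym[OF c(1) D(2)] by blast
  have main: "\<exists>w. w \<noteq> 0 \<and> w / a \<in> normgroup D1 \<and> w / b \<in> normgroup D2"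
    if "c \<in> normgroup D1" "c \<notin> normgroup D2" "D2 \<noteq> 0" "a \<noteq> 0" "b \<noteq> 0" for D1 D2 a b
  proof (cases "a / b \<in> normgroup D2")
    case True
    then show ?thesis using that by (intro exI[of _ a]) auto
  next
    case False
    then have "(a / b) * c \<in> normgroup D2" using normgroup_index2[of D2 "a / b" c] that c by simp
    then show ?thesis using that c by (intro exI[of _ "a * c"]) auto
  qed
  show ?thesis
  proof (cases "c \<in> normgroup D1")
    case True
    then show ?thesis using main[of D1 D2 a b] cc D ab that by blast
  next
    case False
    then show ?thesis using main[of D2 D1 b a] cc D ab that by blast
  qed
qed

text \<open>To write \<open>b\<close> as \<open>\<Delta> * a * z^2\<close> plus a value of
  \<open>bin (\<pi> * a) \<Delta>\<close>, look for a common value \<open>w\<close> of that plane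
  and of the plane with entries \<open>b\<close>, \<open>- (\<Delta> * a)\<close>, whose norm
  parameter is \<open>E\<close>. The parameters \<open>E\<close> and \<open>\<Delta>\<close> differ
  as square classes because \<open>a\<close> and \<open>b\<close> do.\<close>

lemma tern_rep:
  assumes ab: "a \<noteq> 0" "b \<noteq> 0" "\<not> sqeq a b"
  obtains x y where "x \<noteq> 0" "y \<noteq> 0" "meq (tern a) {#b, x, y#}"
proof -
  define E where "E = \<Delta> * a * b"
  have "\<not> sqeq E \<Delta>"
  proof
    assume "sqeq E \<Delta>"
    then obtain s where s: "s \<noteq> 0" "E = \<Delta> * s^2" by (auto simp: sqeq_def)
    then have "a * b = s^2" using Delta_unit by (simp add: E_def mult.assoc)
    then have "a = b * (s / b)^2" using ab by (simp add: field_simps power2_eq_square)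
    then show False using ab s sqeqI[of "s / b" a b] by simp
  qed
  moreover have "E \<noteq> 0" using ab by (simp add: E_def)
  ultimately obtain w where w: "w \<noteq> 0" "w / b \<in> normgroup E" "w / (\<pi> * a) \<in> normgroup \<Delta>"
    using norm_cosets_meet[of E \<Delta> b "\<pi> * a"] ab by auto
  obtain x y where xy: "w / b = x^2 - E * y^2" using w(2) by (auto simp: normgroup_def)
  then have weq: "w = b * x^2 - \<Delta> * a * (b * y)^2"
    using ab by (simp add: E_def field_simps power2_eq_square)
  \<comment> \<open>Otherwise \<open>w\<close> would be \<open>- (\<Delta> * a)\<close> times a
    square, with the parity of \<open>a\<close> instead of that of \<open>\<pi> * a\<close>.\<close>
  have x: "x \<noteq> 0"
  proof
    assume "x = 0"
    then have e: "w / (\<pi> * a) = - (\<Delta> * (b * y)^2 / \<pi>)" using weq ab by simp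
    have "b * y \<noteq> 0" using w(1) weq \<open>x = 0\<close> by auto
    then have "odd (v (- (\<Delta> * (b * y)^2 / \<pi>)))" by (simp add: v_divide v_mult v_power)
    then show False using w(3) unfolding e normgroup_Delta by simp
  qed
  have "b = w * (1 / x)^2 + (\<Delta> * a) * (b * y / x)^2"
    using x weq by (simp add: field_simps power2_eq_square)
  then have m: "meq {#w, \<Delta> * a#} {#b, w * (\<Delta> * a) * b#}"
    using ab by (intro meq_binary)
  have "meq (tern a) ({#\<Delta> * a#} + bin w \<Delta>)"
    unfolding tern_def by (intro meq_add meq_refl bin_eq) (use ab w in auto)
  also have "{#\<Delta> * a#} + bin w \<Delta> = {#w, \<Delta> * a#} + {#- (w * \<Delta>)#}"
    by (simp add: bin_def add_mset_commute)
  also have "meq \<dots> ({#b, w * (\<Delta> * a) * b#} + {#- (w * \<Delta>)#})" by (intro meq_add m meq_refl)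
  finally have "meq (tern a) {#b, w * (\<Delta> * a) * b, - (w * \<Delta>)#}" by (simp add: add_mset_commute)
  then show ?thesis using that[of "w * (\<Delta> * a) * b" "- (w * \<Delta>)"] w ab by simp
qed

text \<open>An unramified plane is determined by the parity of the order of its scaling factor, and
  \<open>c\<close>, \<open>\<pi> * c\<close> have both parities.\<close>

lemma quat_split:
  assumes "c \<noteq> 0" shows "meq quat (bin c \<Delta> + bin (\<pi> * c) \<Delta>)"
proof (cases "even (v c)")
  case True
  then show ?thesis unfolding quat_def
    by (intro meq_add bin_Delta) (use assms in \<open>auto simp: v_mult\<close>)
next
  case False
  have "meq (bin \<pi> \<Delta> + bin 1 \<Delta>) (bin c \<Delta> + bin (\<pi> * c) \<Delta>)"
    by (intro meq_add bin_Delta) (use assms False in \<open>auto simp: v_mult\<close>)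
  then show ?thesis by (simp add: quat_def add.commute)
qed

lemma quat_split_tern:
  assumes "c \<noteq> 0" shows "meq quat ({#c#} + tern (- c))"
proof -
  have "meq quat (bin c \<Delta> + bin (\<pi> * c) \<Delta>)" by (rule quat_split[OF assms])
  also have "meq \<dots> (bin c \<Delta> + bin (\<pi> * - c) \<Delta>)"
    by (intro meq_add meq_refl bin_Delta) (use assms in \<open>auto simp: v_mult\<close>)
  also have "bin c \<Delta> + bin (\<pi> * - c) \<Delta> = {#c#} + tern (- c)"
    by (simp add: tern_def bin_def mult.commute)
  finally show ?thesis .
qed

text \<open>A vector of value \<open>c\<close> has complement \<open>tern (- c)\<close>, and
  \<open>- (c * D)\<close> avoids the square class of \<open>- c\<close> because \<open>D\<close> is
  not a square.\<close>

lemma quat_rep_bin: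
  assumes "c \<noteq> 0" "D \<noteq> 0" "\<not> sqeq D 1"
  obtains x y where "x \<noteq> 0" "y \<noteq> 0" "meq quat (bin c D + {#x, y#})"
proof -
  have "\<not> sqeq (- c) (- (c * D))"
  proof
    assume "sqeq (- c) (- (c * D))"
    then obtain s where s: "s \<noteq> 0" "- c = - (c * D) * s^2" by (auto simp: sqeq_def)
    then have "1 = D * s^2" using assms by simp
    then have "D = 1 * (1 / s)^2" using s by (simp add: field_simps)
    then show False using assms s sqeqI[of "1 / s" D 1] by simp
  qed
  then obtain x y where xy: "x \<noteq> 0" "y \<noteq> 0" "meq (tern (- c)) {#- (c * D), x, y#}"
    using tern_rep[of "- c" "- (c * D)"] assms by auto
  have "meq quat ({#c#} + tern (- c))" by (rule quat_split_tern[OF assms(1)])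
  also have "meq \<dots> ({#c#} + {#- (c * D), x, y#})" by (intro meq_add meq_refl xy)
  also have "{#c#} + {#- (c * D), x, y#} = bin c D + {#x, y#}" by (simp add: bin_def add_mset_commute)
  finally show ?thesis using that xy by blast
qed

text \<open>Witt decomposition with the anisotropic kernels, built up one diagonal entry at a time.\<close>

lemma kernel_cover:
  assumes "0 \<notin># xs" "xs \<noteq> {#}"
  shows "(\<exists>k a. a \<noteq> 0 \<and> size xs = 2 * k + 1 \<and> mrep (hyp k + {#a#}) xs) \<or>
    (\<exists>k a. a \<noteq> 0 \<and> size xs = 2 * k + 3 \<and> mrep (hyp k + tern a) xs) \<or>
    (\<exists>k c D. c \<noteq> 0 \<and> D \<noteq> 0 \<and> size xs = 2 * k + 2 \<and> mrep (hyp k + bin c D) xs) \<or>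
    (\<exists>k. size xs = 2 * k + 4 \<and> mrep (hyp k + quat) xs)"
  using assms
proof (induction xs)
  case (add b xs)
  have b: "b \<noteq> 0" and nz: "0 \<notin># xs" using add.prems by auto
  \<comment> \<open>Only the kernel \<open>A\<close> interacts with the new entry \<open>b\<close>;
    the old hyperbolic planes are carried along.\<close>
  have lift: "mrep (hyp k + B) (add_mset b xs)" if "mrep (hyp j + A) xs" "mrep (hyp m + B) (A + {#b#})" "k = j + m" for j k m A B
  proof -
    have "mrep (hyp j + (hyp m + B)) (hyp j + (A + {#b#}))" by (rule mrep_add[OF mrep_refl that(2)])
    also have "hyp j + (A + {#b#}) = (hyp j + A) + {#b#}" by simp
    also have "mrep \<dots> (xs + {#b#})" by (rule mrep_add[OF that(1) mrep_refl])
    finally show ?thesis using that by (simp add: hyp_add ac_simps)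
  qed
  have hb: "meq (hyp 1) {#- b, b#}" using hyp_1_pair[of "- b"] b by simp
  consider "xs = {#}"
    | k a where "a \<noteq> 0" "size xs = 2 * k + 1" "mrep (hyp k + {#a#}) xs"
    | k a where "a \<noteq> 0" "size xs = 2 * k + 3" "mrep (hyp k + tern a) xs"
    | k c D where "c \<noteq> 0" "D \<noteq> 0" "size xs = 2 * k + 2" "mrep (hyp k + bin c D) xs"
    | k where "size xs = 2 * k + 4" "mrep (hyp k + quat) xs"
    using add.IH[OF nz] by blast
  then show ?case
  proof cases
    case 1
    then have "b \<noteq> 0 \<and> size (add_mset b xs) = 2 * 0 + 1 \<and> mrep (hyp 0 + {#b#}) (add_mset b xs)"
      using b by simp
    then show ?thesis by blast
  next
    case 2
    have h: "mrep (hyp 0 + bin a (- b / a)) ({#a#} + {#b#})" using 2 by (simp add: bin_pair add_mset_commute)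
    have "mrep (hyp k + bin a (- b / a)) (add_mset b xs)" by (rule lift[OF 2(3) h]) simp
    moreover have "- b / a \<noteq> 0" "size (add_mset b xs) = 2 * k + 2" using 2 b by auto
    ultimately show ?thesis using 2(1) by blast
  next
    case 3
    show ?thesis
    \<comment> \<open>A hyperbolic plane appears as soon as the kernel takes the value
      \<open>- b\<close>, and \<open>tern a\<close> misses only the square class of
      \<open>a\<close>. In the exceptional case the new kernel is \<open>quat\<close>.\<close>
    proof (cases "sqeq a (- b)")
      case True
      have "meq quat (bin (- a) \<Delta> + bin (\<pi> * - a) \<Delta>)" using quat_split[of "- a"] 3 by simp
      also have "meq \<dots> (bin (- a) \<Delta> + bin (\<pi> * a) \<Delta>)"
        by (intro meq_add meq_refl bin_Delta) (use 3 in \<open>auto simp: v_mult\<close>)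
      also have "bin (- a) \<Delta> + bin (\<pi> * a) \<Delta> = {#- a#} + tern a"
        by (simp add: tern_def bin_def mult.commute)
      also have "meq \<dots> ({#b#} + tern a)"
        using sqeq_mult[OF sqeq_refl True, of "- 1"] by (intro meq_add meq_refl meq_sqeq) simp
      finally have h: "mrep (hyp 0 + quat) (tern a + {#b#})" by (simp add: meq_mrep)
      have "mrep (hyp k + quat) (add_mset b xs)" by (rule lift[OF 3(3) h]) simp
      moreover have "size (add_mset b xs) = 2 * k + 4" using 3 by simp
      ultimately show ?thesis by blast
    next
      case False
      then obtain x y where xy: "x \<noteq> 0" "y \<noteq> 0" "meq (tern a) {#- b, x, y#}"
        using tern_rep[of a "- b"] 3 b by auto
      have "meq (hyp 1 + {#x, y#}) ({#- b, b#} + {#x, y#})" by (intro meq_add hb meq_refl)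
      also have "{#- b, b#} + {#x, y#} = {#- b, x, y#} + {#b#}" by (simp add: add_mset_commute)
      also have "meq \<dots> (tern a + {#b#})" by (intro meq_add meq_sym[OF xy(3)] meq_refl)
      finally have h: "mrep (hyp 1 + bin x (- y / x)) (tern a + {#b#})" using xy by (simp add: bin_pair meq_mrep)
      have "mrep (hyp (k + 1) + bin x (- y / x)) (add_mset b xs)" by (rule lift[OF 3(3) h]) simp
      moreover have "size (add_mset b xs) = 2 * (k + 1) + 2" "- y / x \<noteq> 0" using 3 xy by auto
      ultimately show ?thesis using xy(1) by blast
    qed
  next
    case 4
    show ?thesis
    \<comment> \<open>The condition says that \<open>bin c D\<close> takes the value
      \<open>- b\<close>, so that a hyperbolic plane splits off and one entry is left.\<close>
    proof (cases "- b / c \<in> normgroup D")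
      case True
      have "meq (hyp 1 + {#b * D#}) ({#- b, b#} + {#b * D#})" by (intro meq_add hb meq_refl)
      also have "{#- b, b#} + {#b * D#} = bin (- b) D + {#b#}" by (simp add: bin_def add_mset_commute)
      also have "meq \<dots> (bin c D + {#b#})" by (intro meq_add meq_sym[OF bin_eq[OF 4(1) True]] meq_refl)
      finally have h: "mrep (hyp 1 + {#b * D#}) (bin c D + {#b#})" by (rule meq_mrep)
      have "mrep (hyp (k + 1) + {#b * D#}) (add_mset b xs)" by (rule lift[OF 4(4) h]) simp
      moreover have "size (add_mset b xs) = 2 * (k + 1) + 1" "b * D \<noteq> 0" using 4 b by auto
      ultimately show ?thesis by blast
    next
      case False
      then have "\<not> sqeq D 1" using 4 b normgroup_sqeq[of D 1] normgroup_of_one by auto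
      then obtain c0 x where c0: "c0 \<noteq> 0" "x \<noteq> 0" "meq (tern x) (bin 1 D + {#- c0#})"
        "- b / c \<in> normgroup D \<or> - b / c * c0 \<in> normgroup D"
        using nonnorm_exists[OF 4(2)] 4 b by (metis divide_eq_0_iff neg_equal_0_iff_equal)
      \<comment> \<open>A norm with \<open>b = - (c * g * c0)\<close>. Scaling the form
        \<open>bin 1 D + {#- c0#}\<close> by \<open>c * g\<close> therefore produces the entry
        \<open>b\<close>, and the norm \<open>g\<close> can be removed from the binary part.\<close>
      define g where "g = - b / c / c0"
      have "g = (- b / c * c0) / c0^2" using c0 by (simp add: g_def power2_eq_square)
      then have g: "g \<in> normgroup D" using c0 False normgroup_divide normgroup_square by metis
      have bg: "b = - (c * g * c0)" using 4 c0 by (simp add: g_def)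
      have "meq (tern (c * g * x)) (bin (c * g) D + {#b#})"
        using meq_image_scale[OF c0(3), of "c * g"] by (simp add: image_scale_tern image_scale_bin bg)
      also have "meq \<dots> (bin c D + {#b#})" by (intro meq_add meq_sym[OF bin_norm[OF 4(1) g]] meq_refl)
      finally have h: "mrep (hyp 0 + tern (c * g * x)) (bin c D + {#b#})" by (simp add: meq_mrep)
      have "mrep (hyp k + tern (c * g * x)) (add_mset b xs)" by (rule lift[OF 4(4) h]) simp
      moreover have "size (add_mset b xs) = 2 * k + 3" "c * g * x \<noteq> 0"
        using 4 c0 normgroup_nz[OF g] by auto
      ultimately show ?thesis by blast
    qed
  next
    case 5
    \<comment> \<open>The form \<open>quat\<close> takes every nonzero value, in particular
      \<open>- b\<close>, and the complement of such a vector is \<open>tern b\<close>.\<close>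
    have "meq (hyp 1 + tern b) ({#- b, b#} + tern b)" by (intro meq_add hb meq_refl)
    also have "{#- b, b#} + tern b = ({#- b#} + tern (- (- b))) + {#b#}"
      unfolding minus_minus by (simp add: add_mset_commute)
    also have "meq \<dots> (quat + {#b#})"
      by (rule meq_add[OF meq_sym[OF quat_split_tern] meq_refl]) (use b in simp)
    finally have h: "mrep (hyp 1 + tern b) (quat + {#b#})" by (rule meq_mrep)
    have "mrep (hyp (k + 1) + tern b) (add_mset b xs)" by (rule lift[OF 5(2) h]) simp
    moreover have "size (add_mset b xs) = 2 * (k + 1) + 3" using 5 by simp
    ultimately show ?thesis using b by blast
  qed
qed simp

end

section \<open>Lattices with maximal anisotropic part\<close>

definition fequiv :: "'a::field mat \<Rightarrow> 'a multiset \<Rightarrow> bool" where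
  "fequiv A x \<longleftrightarrow> (\<exists>xs. mset xs = x \<and> frep A (diagL xs) \<and> frep (diagL xs) A)"

lemma frep_trans:
  "L \<in> carrier_mat l l \<Longrightarrow> M \<in> carrier_mat m m \<Longrightarrow> frep L M \<Longrightarrow> frep M N \<Longrightarrow> frep L N"
  by (rule rep_over_trans) auto

lemma fequiv_diagL [simp]: "fequiv (diagL xs) (mset xs)"
  unfolding fequiv_def by (intro exI[of _ xs] conjI refl rep_over_refl[OF diagL_carrier]) auto

lemma fequiv_meq:
  assumes A: "A \<in> carrier_mat n n" and "fequiv A x" "meq x y" shows "fequiv A y"
proof -
  obtain xs ys where xs: "mset xs = x" "frep A (diagL xs)" "frep (diagL xs) A" and ys: "mset ys = y"
    using assms ex_mset[of y] by (auto simp: fequiv_def)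
  have "frep (diagL xs) (diagL ys)" "frep (diagL ys) (diagL xs)"
    using assms(3) xs ys mrep_mset by (auto simp: meq_def lrep_def[symmetric])
  then show ?thesis unfolding fequiv_def
    using xs ys frep_trans[OF A diagL_carrier] frep_trans[OF diagL_carrier diagL_carrier] by blast
qed

lemma fequiv_frep:
  assumes A: "A \<in> carrier_mat a a" and B: "B \<in> carrier_mat b b" and "fequiv A x" "fequiv B y"
  shows "frep A B \<longleftrightarrow> mrep x y"
proof -
  obtain xs ys where xs: "mset xs = x" "frep A (diagL xs)" "frep (diagL xs) A"
    and ys: "mset ys = y" "frep B (diagL ys)" "frep (diagL ys) B"
    using assms by (auto simp: fequiv_def)
  have "frep A B \<longleftrightarrow> frep (diagL xs) (diagL ys)"
    using xs ys frep_trans[OF A diagL_carrier] frep_trans[OF diagL_carrier diagL_carrier]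
      frep_trans[OF diagL_carrier A] frep_trans[OF A B] by metis
  then show ?thesis using xs ys mrep_mset[of xs ys] by (simp add: lrep_def)
qed

lemma fequiv_osum:
  assumes A: "A \<in> carrier_mat a a" and B: "B \<in> carrier_mat b b" and "fequiv A x" "fequiv B y"
  shows "fequiv (A \<perp>\<^sub>L B) (x + y)"
proof -
  obtain xs ys where xs: "mset xs = x" "frep A (diagL xs)" "frep (diagL xs) A"
    and ys: "mset ys = y" "frep B (diagL ys)" "frep (diagL ys) B"
    using assms by (auto simp: fequiv_def)
  then show ?thesis unfolding fequiv_def
    using rep_over_osum[OF A B diagL_carrier diagL_carrier] rep_over_osum[OF diagL_carrier diagL_carrier A B]
    by (intro exI[of _ "xs @ ys"]) (auto simp: diagL_append)
qed

lemma det_diagL: "det (diagL xs) = prod_list (xs :: 'a::field list)"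
proof -
  have "diag_mat (diagL xs) = xs"
    by (rule nth_equalityI) (auto simp: diag_mat_def diagL_def)
  then show ?thesis using det_upper_triangular[of "diagL xs" "length xs"]
    by (auto simp: upper_triangular_def diagL_def)
qed

lemma fequiv_det:
  assumes A: "A \<in> carrier_mat n n" "size x = n" and "fequiv A x" "0 \<notin># x"
  shows "det A \<noteq> 0"
proof -
  obtain xs where xs: "mset xs = x" "frep A (diagL xs)" using assms by (auto simp: fequiv_def)
  have n: "length xs = n" using xs A by auto
  obtain X where X: "X \<in> carrier_mat n n" "X * A * X\<^sup>T = diagL xs"
    using xs A n by (auto simp: rep_over_def)
  have "det (X * A * X\<^sup>T) = det X * det A * det X\<^sup>T"
    using X A det_mult[of "X * A" n "X\<^sup>T"] det_mult[of X n A] by simp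
  moreover have "det (diagL xs) \<noteq> 0" using xs assms(4) by (auto simp: det_diagL)
  ultimately show ?thesis using X by auto
qed

lemma Abin_carrier [simp]: "Abin \<gamma> \<xi> \<eta> \<in> carrier_mat 2 2"
  by (rule carrier_matI) (simp_all add: Abin_def mat_of_rows_list_def)

lemma dim_Abin [simp]: "dim_row (Abin \<gamma> \<xi> \<eta>) = 2" "dim_col (Abin \<gamma> \<xi> \<eta>) = 2"
  by (simp_all add: Abin_def mat_of_rows_list_def)

lemma Abin_index [simp]:
  "Abin \<gamma> \<xi> \<eta> $$ (0, 0) = \<gamma> * \<xi>" "Abin \<gamma> \<xi> \<eta> $$ (0, Suc 0) = \<gamma>"
  "Abin \<gamma> \<xi> \<eta> $$ (Suc 0, 0) = \<gamma>" "Abin \<gamma> \<xi> \<eta> $$ (Suc 0, Suc 0) = \<gamma> * \<eta>"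
  by (simp_all add: Abin_def mat_of_rows_list_def)

lemma Abin_transpose [simp]: "(Abin \<gamma> \<xi> \<eta>)\<^sup>T = Abin \<gamma> \<xi> \<eta>"
  by (rule eq_matI) (auto simp: less_2_cases_iff)

lemma bform_Abin: "bform (Abin \<gamma> \<xi> \<eta>) f g =
    \<gamma> * \<xi> * f 0 * g 0 + \<gamma> * (f 0 * g 1 + f 1 * g 0) + \<gamma> * \<eta> * f 1 * g 1"
  by (simp add: bform_def numeral_2_eq_2 algebra_simps)

lemma frep_binaryI:
  assumes "L \<in> carrier_mat 2 2" "M \<in> carrier_mat 2 2"
    and "M $$ (0, 0) = bform L f f" "M $$ (0, Suc 0) = bform L f g"
      "M $$ (Suc 0, 0) = bform L g f" "M $$ (Suc 0, Suc 0) = bform L g g"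
  shows "frep L M"
  unfolding rep_over_iff[OF assms(1,2)]
  using assms(3-) by (intro exI[of _ "\<lambda>i. if i = 0 then f else g"]) (auto simp: less_2_cases_iff)

lemma fequiv_Abin:
  assumes "\<gamma> \<noteq> 0" "\<xi> \<noteq> 0"
  shows "fequiv (Abin \<gamma> \<xi> \<eta>) {#\<gamma> * \<xi>, \<gamma> * \<eta> - \<gamma> / \<xi>#}"
proof -
  define xs where "xs = [\<gamma> * \<xi>, \<gamma> * \<eta> - \<gamma> / \<xi>]"
  have c: "diagL xs \<in> carrier_mat 2 2" by (rule carrier_matI) (simp_all add: xs_def)
  have "frep (Abin \<gamma> \<xi> \<eta>) (diagL xs)"
    by (rule frep_binaryI[OF Abin_carrier c, where f = "\<lambda>k. if k = 0 then 1 else 0" and g = "\<lambda>k. if k = 0 then - 1 / \<xi> else 1"])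
       (use assms in \<open>simp_all add: xs_def diagL_def bform_Abin field_simps\<close>)
  moreover have "frep (diagL xs) (Abin \<gamma> \<xi> \<eta>)"
    by (rule frep_binaryI[OF c Abin_carrier, where f = "\<lambda>k. if k = 0 then 1 else 0" and g = "\<lambda>k. if k = 0 then 1 / \<xi> else 1"])
       (use assms in \<open>simp_all add: xs_def bform_diagL field_simps\<close>)
  ultimately show ?thesis unfolding fequiv_def by (intro exI[of _ xs]) (simp add: xs_def add_mset_commute)
qed

lemma Hyp_carrier [simp]: "Hyp \<in> carrier_mat 2 2" and Hyp_transpose [simp]: "Hyp\<^sup>T = Hyp"
  by (simp_all add: Hyp_def)

lemma bform_Hyp: "bform Hyp f g = (f 0 * g 1 + f 1 * g 0) / 2"
  by (simp add: Hyp_def bform_Abin)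

lemma Hpow_carrier [simp]: "Hpow k \<in> carrier_mat (2 * k) (2 * k)"
  by (induction k) (use osum_carrier[OF Hyp_carrier] in auto)

lemma Hpow_transpose [simp]: "(Hpow k)\<^sup>T = Hpow k"
  by (induction k) (auto intro!: osum_transpose[OF Hyp_carrier Hpow_carrier])

context dyadic
begin

lemma fequiv_Hyp: "fequiv (Hyp :: 'a mat) {#1, - 1#}"
proof -
  have c: "diagL [1, - 1 :: 'a] \<in> carrier_mat 2 2" by (rule carrier_matI) simp_all
  have "frep Hyp (diagL [1, - 1 :: 'a])"
    by (rule frep_binaryI[OF Hyp_carrier c, where f = "\<lambda>_. 1" and g = "\<lambda>k. if k = 0 then 1 else - 1"])
       (simp_all add: diagL_def bform_Hyp)
  moreover have "frep (diagL [1, - 1 :: 'a]) Hyp"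
    by (rule frep_binaryI[OF c Hyp_carrier, where f = "\<lambda>_. 1 / 2" and g = "\<lambda>k. if k = 0 then 1 / 2 else - 1 / 2"])
       (simp_all add: Hyp_def bform_diagL)
  ultimately show ?thesis unfolding fequiv_def by (intro exI[of _ "[1, - 1]"]) simp
qed

lemma fequiv_Hpow: "fequiv (Hpow k :: 'a mat) (hyp k)"
proof (induction k)
  case 0
  have "fequiv (diagL []) (mset ([] :: 'a list))" by (rule fequiv_diagL)
  moreover have "diagL [] = (0\<^sub>m 0 0 :: 'a mat)" by (rule eq_matI) auto
  ultimately show ?case by simp
next
  case (Suc k)
  then show ?case using fequiv_osum[OF Hyp_carrier Hpow_carrier fequiv_Hyp] by (simp add: hyp_Suc bin_def)
qed

section \<open>Integrality and maximality of lattices\<close>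

lemma integral_lattice_bform:
  assumes G: "G \<in> carrier_mat n n"
  shows "integral_lattice v G \<longleftrightarrow> (\<forall>f. (\<forall>k<n. vge (f k) 0) \<longrightarrow> vge (bform G f f) 0)"
proof -
  have e: "x \<bullet> (G *\<^sub>v x) = bform G (\<lambda>i. x $ i) (\<lambda>i. x $ i)" if "x \<in> carrier_vec n" for x
    using that G by (simp add: bform_def scalar_prod_def atLeast0LessThan sum_distrib_left mult.assoc)
  show ?thesis
  proof
    assume i: "integral_lattice v G"
    show "\<forall>f. (\<forall>k<n. vge (f k) 0) \<longrightarrow> vge (bform G f f) 0"
    proof (intro allI impI)
      fix f assume f: "\<forall>k<n. vge (f k) 0"
      have "intO v (vec n f \<bullet> (G *\<^sub>v vec n f))"
        using i f G by (simp add: integral_lattice_def integral_vec_def intO_iff)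
      moreover have "bform G (\<lambda>i. vec n f $ i) (\<lambda>i. vec n f $ i) = bform G f f"
        by (rule bform_cong) (use G in auto)
      ultimately show "vge (bform G f f) 0" using e[of "vec n f"] by (simp add: intO_iff)
    qed
  next
    assume "\<forall>f. (\<forall>k<n. vge (f k) 0) \<longrightarrow> vge (bform G f f) 0"
    then show "integral_lattice v G"
      unfolding integral_lattice_def using G e by (auto simp: integral_vec_def intO_iff)
  qed
qed

lemma integral_lattice_entries:
  assumes G: "G \<in> carrier_mat n n" "G\<^sup>T = G"
  shows "integral_lattice v G \<longleftrightarrow> (\<forall>i<n. vge (G $$ (i, i)) 0) \<and> (\<forall>i<n. \<forall>j<n. vge (2 * G $$ (i, j)) 0)"
proof
  assume "integral_lattice v G"
  then have Q: "vge (bform G f f) 0" if "\<forall>k<n. vge (f k) 0" for f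
    using integral_lattice_bform[OF G(1)] that by blast
  define u where "u i k = (if k = i then 1 else 0 :: 'a)" for i k :: nat
  have ent: "bform G (u i) (u j) = G $$ (i, j)" if "i < n" "j < n" for i j
  proof -
    have "(\<Sum>l<n. u i k * G $$ (k, l) * u j l) = (if k = i then G $$ (i, j) else 0)" if "k < n" for k
    proof -
      have "(\<Sum>l<n. u i k * G $$ (k, l) * u j l) = (\<Sum>l<n. if l = j then u i k * G $$ (k, j) else 0)"
        by (rule sum.cong) (auto simp: u_def)
      then show ?thesis using \<open>j < n\<close> by (simp add: u_def)
    qed
    then show ?thesis using G \<open>i < n\<close> by (simp add: bform_def)
  qed
  have u: "\<forall>k<n. vge (u i k) 0" for i by (simp add: u_def)
  have d: "vge (G $$ (i, i)) 0" if "i < n" for i using Q[OF u[of i]] ent that by simp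
  have "vge (2 * G $$ (i, j)) 0" if ij: "i < n" "j < n" for i j
  proof -
    have "vge (bform G (\<lambda>k. u i k + u j k) (\<lambda>k. u i k + u j k)) 0"
      using u by (intro Q) (auto intro!: vge_add)
    moreover have "bform G (\<lambda>k. u i k + u j k) (\<lambda>k. u i k + u j k) = G $$ (i, i) + G $$ (j, j) + 2 * G $$ (i, j)"
      using ij bform_commute[OF G, of "u j" "u i"] by (simp add: bform_add_left bform_add_right ent)
    ultimately have "vge (G $$ (i, i) + G $$ (j, j) + 2 * G $$ (i, j) - (G $$ (i, i) + G $$ (j, j))) 0"
      using vge_diff vge_add d ij by metis
    then show ?thesis by simp
  qed
  then show "(\<forall>i<n. vge (G $$ (i, i)) 0) \<and> (\<forall>i<n. \<forall>j<n. vge (2 * G $$ (i, j)) 0)" using d by blast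
next
  assume a: "(\<forall>i<n. vge (G $$ (i, i)) 0) \<and> (\<forall>i<n. \<forall>j<n. vge (2 * G $$ (i, j)) 0)"
  have sym: "G $$ (k, l) = G $$ (l, k)" if "k < n" "l < n" for k l
    using that G by (metis carrier_matD index_transpose_mat(1))
  have "vge (\<Sum>k<m. \<Sum>l<m. f k * G $$ (k, l) * f l) 0" if f: "\<forall>k<n. vge (f k) 0" and m: "m \<le> n" for f m
    using m
  proof (induction m)
    case (Suc m)
    have s0: "vge (\<Sum>k<m. f k * f m * (2 * G $$ (k, m))) 0"
    proof -
      have "vge (\<Sum>k<j. f k * f m * (2 * G $$ (k, m))) 0" if "j \<le> m" for j
        using that
      proof (induction j)
        case (Suc j)
        then have "vge (f j * f m * (2 * G $$ (j, m))) 0"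
          by (intro vge_mult0[of "f j * f m"] vge_mult0[of "f j" "f m"]) (use a f Suc.prems \<open>Suc m \<le> n\<close> in auto)
        then show ?case using Suc by (simp add: vge_add)
      qed simp
      then show ?thesis by blast
    qed
    have dbl: "(\<Sum>k<m. f k * f m * (2 * G $$ (k, m))) = 2 * (\<Sum>k<m. f k * G $$ (k, m) * f m)"
      by (simp add: sum_distrib_left ac_simps)
    have "(\<Sum>k<Suc m. \<Sum>l<Suc m. f k * G $$ (k, l) * f l) =
      (\<Sum>k<m. \<Sum>l<m. f k * G $$ (k, l) * f l) + (\<Sum>k<m. f k * G $$ (k, m) * f m) +
      (\<Sum>l<m. f m * G $$ (m, l) * f l) + f m * f m * G $$ (m, m)"
      by (simp add: sum.distrib ac_simps)
    also have "(\<Sum>l<m. f m * G $$ (m, l) * f l) = (\<Sum>k<m. f k * G $$ (k, m) * f m)"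
      by (rule sum.cong) (use sym Suc.prems in \<open>auto simp: ac_simps\<close>)
    finally have "(\<Sum>k<Suc m. \<Sum>l<Suc m. f k * G $$ (k, l) * f l) =
      (\<Sum>k<m. \<Sum>l<m. f k * G $$ (k, l) * f l) + (\<Sum>k<m. f k * f m * (2 * G $$ (k, m))) + f m * f m * G $$ (m, m)"
      unfolding dbl by (simp only: mult_2 add.assoc)
    moreover have "vge (\<Sum>k<m. \<Sum>l<m. f k * G $$ (k, l) * f l) 0" using Suc by simp
    moreover have "vge (f m * f m * G $$ (m, m)) 0" using a f Suc.prems by (auto intro!: vge_mult0)
    ultimately show ?case using s0 by (simp only: vge_add)
  qed simp
  then show "integral_lattice v G" using integral_lattice_bform[OF G(1)] G by (simp add: bform_def)
qed

text \<open>The property through which lattice questions become questions over the field. It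
  includes degenerate \<open>M\<close>, which the induction over hyperbolic planes produces.\<close>

definition maximal_rep :: "'a mat \<Rightarrow> bool" where
  "maximal_rep L \<longleftrightarrow> (\<forall>n M. M \<in> carrier_mat n n \<longrightarrow> M\<^sup>T = M \<longrightarrow> integral_lattice v M \<longrightarrow>
     frep L M \<longrightarrow> represents v L M)"

text \<open>All vectors of integral value belong to the lattice. This entails anisotropy, since all
  scalar multiples of an isotropic vector have the integral value 0.\<close>

definition aniso_max :: "'a mat \<Rightarrow> bool" where
  "aniso_max A \<longleftrightarrow> (\<forall>f. vge (bform A f f) 0 \<longrightarrow> (\<forall>k<dim_row A. vge (f k) 0))"

lemma aniso_max_maximal:
  assumes A: "A \<in> carrier_mat d d" and "aniso_max A" shows "maximal_rep A"
  unfolding maximal_rep_def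
proof (intro allI impI)
  fix n M assume M: "M \<in> carrier_mat n n" "M\<^sup>T = M" "integral_lattice v M" "frep A M"
  obtain f where f: "\<forall>i<n. \<forall>j<n. M $$ (i, j) = bform A (f i) (f j)"
    using M(4) rep_over_iff[OF A M(1)] by blast
  have "\<forall>i<n. vge (M $$ (i, i)) 0" using integral_lattice_entries[OF M(1,2)] M(3) by blast
  then have "\<forall>i<n. \<forall>k<d. vge (f i k) 0" using assms f A unfolding aniso_max_def by simp
  then show "represents v A M" unfolding represents_rep_over rep_over_iff[OF A M(1)]
    using f by (auto simp: intO_iff)
qed

text \<open>The rows with respect to \<open>Hyp \<perp> W\<close> are \<open>(a\<^sub>i, b\<^sub>i, w\<^sub>i)\<close>. Rescaling the hyperbolic pair makes some
  \<open>b\<^sub>j\<close> of minimal order equal to one, and an Eichler transformation then moves \<open>w\<^sub>j\<close> to zero;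
  integrality of the Gram matrix forces the remaining hyperbolic coordinates to be integral.\<close>

lemma maximal_Hyp:
  assumes W: "W \<in> carrier_mat d d" "W\<^sup>T = W" and m: "maximal_rep W"
  shows "maximal_rep (Hyp \<perp>\<^sub>L W)"
  unfolding maximal_rep_def
proof (intro allI impI)
  fix n M assume M: "M \<in> carrier_mat n n" "M\<^sup>T = M" "integral_lattice v M" "frep (Hyp \<perp>\<^sub>L W) M"
  have HW: "Hyp \<perp>\<^sub>L W \<in> carrier_mat (2 + d) (2 + d)" by (rule osum_carrier[OF Hyp_carrier W(1)])
  have bf: "bform (Hyp \<perp>\<^sub>L W) f g = (f 0 * g 1 + f 1 * g 0) / 2 + bform W (\<lambda>k. f (k + 2)) (\<lambda>k. g (k + 2))" for f g
    unfolding bform_osum[OF Hyp_carrier W(1)] bform_Hyp by (rule refl)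
  obtain f where f0: "\<forall>i<n. \<forall>j<n. M $$ (i, j) = bform (Hyp \<perp>\<^sub>L W) (f i) (f j)"
    using M(4) unfolding rep_over_iff[OF HW M(1)] by blast
  note f = f0[rule_format]
  define a b w where "a = (\<lambda>i. f i 0)" and "b = (\<lambda>i. f i 1)" and "w = (\<lambda>i k. f i (k + 2))"
  have M_ent: "M $$ (i, j) = (a i * b j + b i * a j) / 2 + bform W (w i) (w j)" if "i < n" "j < n" for i j
    unfolding a_def b_def w_def using f[OF that] unfolding bf .
  have int: "vge (M $$ (i, i)) 0" "j < n \<Longrightarrow> vge (2 * M $$ (i, j)) 0" if "i < n" for i j
    using integral_lattice_entries[OF M(1,2)] M(3) that by blast+
  have finish: "represents v (Hyp \<perp>\<^sub>L W) M"
    if g: "\<And>i k. i < n \<Longrightarrow> k < d \<Longrightarrow> vge (g i k) 0" and xy: "\<And>i. i < n \<Longrightarrow> vge (x i) 0" "\<And>i. i < n \<Longrightarrow> vge (y i) 0"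
      and e: "\<And>i j. i < n \<Longrightarrow> j < n \<Longrightarrow> M $$ (i, j) = (x i * y j + y i * x j) / 2 + bform W (g i) (g j)" for x y g
    unfolding represents_rep_over rep_over_iff[OF HW M(1)]
  proof (intro exI[of _ "\<lambda>i k. if k = 0 then x i else if k = 1 then y i else g i (k - 2)"] conjI allI impI)
    fix i k assume "i < n" "k < 2 + d"
    then show "intO v (if k = 0 then x i else if k = 1 then y i else g i (k - 2))"
      using g[of i "k - 2"] xy by (auto simp: intO_iff)
  qed (simp add: bf e)
  show "represents v (Hyp \<perp>\<^sub>L W) M"
  proof (cases "\<forall>i<n. b i = 0")
    case True
    then have "frep W M" unfolding rep_over_iff[OF W(1) M(1)] using M_ent by (intro exI[of _ w]) simp
    then have "represents v W M" using m M unfolding maximal_rep_def by blast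
    then obtain g where g: "\<forall>i<n. \<forall>k<d. intO v (g i k)" "\<forall>i<n. \<forall>j<n. M $$ (i, j) = bform W (g i) (g j)"
      unfolding represents_rep_over rep_over_iff[OF W(1) M(1)] by blast
    show ?thesis by (rule finish[of g "\<lambda>_. 0" "\<lambda>_. 0"]) (use g in \<open>auto simp: intO_iff\<close>)
  next
    case False
    define I where "I = {i. i < n \<and> b i \<noteq> 0}"
    have I: "finite I" "I \<noteq> {}" using False by (auto simp: I_def)
    have "Min ((\<lambda>i. v (b i)) ` I) \<in> (\<lambda>i. v (b i)) ` I" using I by (intro Min_in) auto
    then obtain j where j: "j \<in> I" "v (b j) = Min ((\<lambda>i. v (b i)) ` I)" by auto
    have jn: "j < n" "b j \<noteq> 0" using j by (auto simp: I_def)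
    have le: "vge (b i) (v (b j))" if "i < n" for i
    proof (cases "b i = 0")
      case False
      then show ?thesis using that I(1) unfolding j(2) vge_def
        by (intro disjI2 Min_le finite_imageI imageI) (auto simp: I_def)
    qed simp
    define \<beta> where "\<beta> i = b i / b j" for i
    define G where "G i k = bform W (w i) (w k)" for i k
    \<comment> \<open>The factor \<open>b j\<close> is the rescaling. The other terms are the
      correction that keeps the pairing of any two rows unchanged when \<open>w i\<close> is
      replaced by \<open>w' i\<close>.\<close>
    define \<alpha> where "\<alpha> i = b j * a i + 2 * G i j - \<beta> i * G j j" for i
    define w' where "w' i k = w i k + - \<beta> i * w j k" for i k
    have Gs: "G i k = G k i" for i k unfolding G_def by (rule bform_commute[OF W])
    have G': "bform W (w' i) (w' k) = G i k - \<beta> k * G i j - \<beta> i * G j k + \<beta> i * \<beta> k * G j j" for i k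
      unfolding w'_def bform_add_left bform_add_right bform_scale_left bform_scale_right G_def[symmetric]
      by (simp add: algebra_simps)
    have bj: "\<beta> j = 1" using jn by (simp add: \<beta>_def)
    have \<beta>int: "vge (\<beta> i) 0" if "i < n" for i using le[OF that] jn by (simp add: \<beta>_def vge_divide_iff)
    have ent: "M $$ (i, k) = (\<alpha> i * \<beta> k + \<beta> i * \<alpha> k) / 2 + bform W (w' i) (w' k)" if "i < n" "k < n" for i k
    proof -
      have "\<alpha> i * \<beta> k + \<beta> i * \<alpha> k = a i * b k + b i * a k + 2 * (\<beta> k * G i j + \<beta> i * G j k - \<beta> i * \<beta> k * G j j)"
        using jn Gs[of k j] by (simp add: \<alpha>_def algebra_simps) (simp add: \<beta>_def)
      then have h: "(\<alpha> i * \<beta> k + \<beta> i * \<alpha> k) / 2 = (a i * b k + b i * a k) / 2 + (\<beta> k * G i j + \<beta> i * G j k - \<beta> i * \<beta> k * G j j)"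
        by (simp add: add_divide_distrib)
      show ?thesis unfolding h G' using M_ent[OF that] by (simp add: G_def)
    qed
    have w'j: "bform W (w' i) (w' j) = 0" for i by (simp add: G' bj)
    have \<alpha>j: "vge (\<alpha> j) 0" using ent[OF jn(1) jn(1)] int(1)[OF jn(1)] by (simp add: w'j bj)
    have \<alpha>int: "vge (\<alpha> i) 0" if "i < n" for i
    proof -
      have "2 * M $$ (i, j) = \<alpha> i + \<beta> i * \<alpha> j" using ent[OF that jn(1)] by (simp add: w'j bj mult.commute)
      then have "\<alpha> i = 2 * M $$ (i, j) - \<beta> i * \<alpha> j" by simp
      then show ?thesis using int(2)[OF that jn(1)] vge_mult0[OF \<beta>int[OF that] \<alpha>j] vge_diff by metis
    qed
    \<comment> \<open>What is left for \<open>W\<close> to represent. Since \<open>w' j = 0\<close>,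
      row \<open>j\<close> of this matrix vanishes, so it is degenerate.\<close>
    define M' where "M' = mat n n (\<lambda>(i, k). bform W (w' i) (w' k))"
    have M': "M' \<in> carrier_mat n n" "M'\<^sup>T = M'"
      using bform_commute[OF W] by (auto simp: M'_def intro!: eq_matI)
    have "integral_lattice v M'"
      unfolding integral_lattice_entries[OF M']
    proof (intro conjI allI impI)
      fix i assume i: "i < n"
      have "bform W (w' i) (w' i) = M $$ (i, i) - \<alpha> i * \<beta> i" using ent[OF i i] by simp
      then show "vge (M' $$ (i, i)) 0"
        using i int(1)[OF i] vge_mult0[OF \<alpha>int[OF i] \<beta>int[OF i]] by (simp add: M'_def vge_diff)
    next
      fix i k assume ik: "i < n" "k < n"
      have "2 * bform W (w' i) (w' k) = 2 * M $$ (i, k) - (\<alpha> i * \<beta> k + \<beta> i * \<alpha> k)"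
        using ent[OF ik] by (simp add: algebra_simps)
      then show "vge (2 * M' $$ (i, k)) 0"
        using ik int(2)[OF ik] vge_mult0[OF \<alpha>int[OF ik(1)] \<beta>int[OF ik(2)]] vge_mult0[OF \<beta>int[OF ik(1)] \<alpha>int[OF ik(2)]]
        by (simp add: M'_def vge_diff vge_add)
    qed
    moreover have "frep W M'" unfolding rep_over_iff[OF W(1) M'(1)] by (intro exI[of _ w']) (simp add: M'_def)
    ultimately have "represents v W M'" using m M' unfolding maximal_rep_def by blast
    then obtain g where g: "\<forall>i<n. \<forall>k<d. intO v (g i k)" "\<forall>i<n. \<forall>k<n. M' $$ (i, k) = bform W (g i) (g k)"
      unfolding represents_rep_over rep_over_iff[OF W(1) M'(1)] by blast
    show ?thesis
    proof (rule finish[of g \<alpha> \<beta>])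
      fix i k assume ik: "i < n" "k < n"
      then show "M $$ (i, k) = (\<alpha> i * \<beta> k + \<beta> i * \<alpha> k) / 2 + bform W (g i) (g k)"
        using ent[OF ik] g by (simp add: M'_def)
    qed (use g \<alpha>int \<beta>int in \<open>auto simp: intO_iff\<close>)
  qed
qed

lemma maximal_Hpow:
  assumes "A \<in> carrier_mat d d" "A\<^sup>T = A" "maximal_rep A"
  shows "maximal_rep (Hpow k \<perp>\<^sub>L A)"
proof (induction k)
  case (Suc k)
  have "maximal_rep (Hyp \<perp>\<^sub>L (Hpow k \<perp>\<^sub>L A))"
    by (rule maximal_Hyp[OF _ _ Suc, of "2 * k + d"]) (use assms in \<open>auto intro!: osum_transpose[OF Hpow_carrier]\<close>)
  then show ?case by (simp add: osum_assoc)
qed (use assms in simp)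

definition kern :: "'a mat \<Rightarrow> 'a multiset \<Rightarrow> bool" where
  "kern A x \<longleftrightarrow> A \<in> carrier_mat (size x) (size x) \<and> A\<^sup>T = A \<and> integral_lattice v A \<and> aniso_max A \<and>
     fequiv A x \<and> 0 \<notin># x"

lemma integral_osum:
  assumes A: "A \<in> carrier_mat a a" and B: "B \<in> carrier_mat b b"
    and "integral_lattice v A" "integral_lattice v B"
  shows "integral_lattice v (A \<perp>\<^sub>L B)"
  unfolding integral_lattice_bform[OF osum_carrier[OF A B]] bform_osum[OF A B]
  using assms unfolding integral_lattice_bform[OF A] integral_lattice_bform[OF B]
  by (auto intro!: vge_add)

lemma integral_Hpow: "integral_lattice v (Hpow k)"
proof (induction k)
  case 0
  then show ?case using integral_lattice_bform[OF Hpow_carrier[of 0]] by (simp add: bform_def)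
next
  case (Suc k)
  have "integral_lattice v Hyp"
    unfolding integral_lattice_bform[OF Hyp_carrier] bform_Hyp by (auto simp: mult.commute intro: vge_mult0)
  then show ?case using Suc integral_osum[OF Hyp_carrier Hpow_carrier] by simp
qed

lemma kern_lattice:
  assumes "kern A x"
  shows "is_lattice (2 * k + size x) (Hpow k \<perp>\<^sub>L A)" "integral_lattice v (Hpow k \<perp>\<^sub>L A)"
    "fequiv (Hpow k \<perp>\<^sub>L A) (hyp k + x)" "maximal_rep (Hpow k \<perp>\<^sub>L A)"
proof -
  have A: "A \<in> carrier_mat (size x) (size x)" "A\<^sup>T = A" "integral_lattice v A" "aniso_max A"
    "fequiv A x" "0 \<notin># x" using assms by (auto simp: kern_def)
  show "integral_lattice v (Hpow k \<perp>\<^sub>L A)" by (rule integral_osum[OF Hpow_carrier A(1) integral_Hpow A(3)])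
  show f: "fequiv (Hpow k \<perp>\<^sub>L A) (hyp k + x)" by (rule fequiv_osum[OF Hpow_carrier A(1) fequiv_Hpow A(5)])
  show "maximal_rep (Hpow k \<perp>\<^sub>L A)"
    by (rule maximal_Hpow[OF A(1,2) aniso_max_maximal[OF A(1,4)]])
  have c: "Hpow k \<perp>\<^sub>L A \<in> carrier_mat (2 * k + size x) (2 * k + size x)" using A by simp
  have "det (Hpow k \<perp>\<^sub>L A) \<noteq> 0"
    by (rule fequiv_det[OF c _ f]) (use A hyp_nz[of k] in auto)
  then show "is_lattice (2 * k + size x) (Hpow k \<perp>\<^sub>L A)"
    using c osum_transpose[OF Hpow_carrier A(1) Hpow_transpose A(2)] by (simp add: is_lattice_def)
qed

lemma kern_represents:
  assumes "kern A x" "kern B y"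
  shows "represents v (Hpow j \<perp>\<^sub>L A) (Hpow k \<perp>\<^sub>L B) \<longleftrightarrow> mrep (hyp j + x) (hyp k + y)"
proof -
  note a = kern_lattice[OF assms(1), of j] and b = kern_lattice[OF assms(2), of k]
  have c: "Hpow j \<perp>\<^sub>L A \<in> carrier_mat (2 * j + size x) (2 * j + size x)"
    "Hpow k \<perp>\<^sub>L B \<in> carrier_mat (2 * k + size y) (2 * k + size y)"
    "(Hpow k \<perp>\<^sub>L B)\<^sup>T = Hpow k \<perp>\<^sub>L B"
    using a(1) b(1) by (simp_all add: is_lattice_def)
  have "represents v (Hpow j \<perp>\<^sub>L A) (Hpow k \<perp>\<^sub>L B) \<longleftrightarrow> frep (Hpow j \<perp>\<^sub>L A) (Hpow k \<perp>\<^sub>L B)"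
    using a(4) b(2) c unfolding maximal_rep_def represents_rep_over by (blast intro: rep_over_mono)
  then show ?thesis using fequiv_frep[OF c(1,2) a(3) b(3)] by simp
qed

definition even_valued :: "'a mat \<Rightarrow> bool" where
  "even_valued A \<longleftrightarrow> (\<forall>f. bform A f f \<noteq> 0 \<longrightarrow> even (v (bform A f f)))"

definition odd_valued :: "'a mat \<Rightarrow> bool" where
  "odd_valued A \<longleftrightarrow> (\<forall>f. bform A f f \<noteq> 0 \<longrightarrow> odd (v (bform A f f)))"

text \<open>Nonzero values of opposite parity cannot cancel: the order of their sum is the smaller
  order, so an integral sum has integral summands.\<close>

lemma kern_osum:
  assumes "kern A x" "kern B y" "even_valued A \<and> odd_valued B \<or> odd_valued A \<and> even_valued B"
  shows "kern (A \<perp>\<^sub>L B) (x + y)"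
proof -
  have A: "A \<in> carrier_mat (size x) (size x)" "A\<^sup>T = A" "integral_lattice v A" "aniso_max A"
    "fequiv A x" "0 \<notin># x" using assms by (auto simp: kern_def)
  have B: "B \<in> carrier_mat (size y) (size y)" "B\<^sup>T = B" "integral_lattice v B" "aniso_max B"
    "fequiv B y" "0 \<notin># y" using assms by (auto simp: kern_def)
  have split: "vge p 0 \<and> vge q 0" if "vge (p + q) 0" "p \<noteq> 0 \<Longrightarrow> q \<noteq> 0 \<Longrightarrow> v p \<noteq> v q" for p q
  proof (cases "p = 0 \<or> q = 0")
    case False
    then have ne: "v p \<noteq> v q" using that by blast
    have "v (p + q) = min (v p) (v q) \<and> p + q \<noteq> 0"
    proof (cases "v p < v q")
      case True
      then show ?thesis using v_add_less[of p q] False by (auto simp: vge_def)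
    next
      case False
      then show ?thesis using v_add_less[of q p] ne \<open>\<not> (p = 0 \<or> q = 0)\<close> by (auto simp: vge_def add.commute)
    qed
    then show ?thesis using that(1) by (auto simp: vge_def)
  qed (use that in auto)
  have "aniso_max (A \<perp>\<^sub>L B)"
    unfolding aniso_max_def bform_osum[OF A(1) B(1)]
  proof (intro allI impI)
    fix f k assume q: "vge (bform A f f + bform B (\<lambda>k. f (k + size x)) (\<lambda>k. f (k + size x))) 0"
      and k: "k < dim_row (A \<perp>\<^sub>L B)"
    have "vge (bform A f f) 0 \<and> vge (bform B (\<lambda>k. f (k + size x)) (\<lambda>k. f (k + size x))) 0"
      by (rule split[OF q]) (use assms(3) in \<open>auto simp: even_valued_def odd_valued_def\<close>)
    then have "\<forall>k<size x. vge (f k) 0" "\<forall>k<size y. vge (f (k + size x)) 0"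
      using A(1,4) B(1,4) by (auto simp: aniso_max_def)
    moreover have "k < size x \<or> (\<exists>l<size y. k = l + size x)"
      using k A(1) B(1) by (auto intro!: exI[of _ "k - size x"])
    ultimately show "vge (f k) 0" by blast
  qed
  then show ?thesis unfolding kern_def
    using A B fequiv_osum[OF A(1) B(1) A(5) B(5)] osum_transpose[OF A(1) B(1) A(2) B(2)]
      integral_osum[OF A(1) B(1) A(3) B(3)] by simp
qed

lemma kern_empty: "kern (0\<^sub>m 0 0) {#}"
proof -
  have "diagL [] = (0\<^sub>m 0 0 :: 'a mat)" by (rule eq_matI) auto
  then show ?thesis unfolding kern_def
    using fequiv_diagL[of "[] :: 'a list"] integral_Hpow[of 0] by (simp add: aniso_max_def)
qed

section \<open>Kernels of rank one and two\<close>

lemma kern_unary: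
  assumes "c \<noteq> 0" "v c = 0 \<or> v c = 1" shows "kern (diagL [c]) {#c#}"
proof -
  have q: "bform (diagL [c]) f f = c * (f 0 * f 0)" for f by (simp add: bform_diagL mult.assoc)
  have c: "diagL [c] \<in> carrier_mat 1 1" using diagL_carrier[of "[c]"] by simp
  have cint: "vge c 0" using assms by (auto simp: vge_def)
  have "integral_lattice v (diagL [c])"
    unfolding integral_lattice_bform[OF c] q by (simp add: vge_mult0 cint)
  moreover have "aniso_max (diagL [c])"
  proof -
    have an: "vge x 0" if "vge (c * (x * x)) 0" for x
      using that assms by (cases "x = 0") (auto simp: vge_def v_mult)
    show "aniso_max (diagL [c])" unfolding aniso_max_def q
    proof (intro allI impI)
      fix f :: "nat \<Rightarrow> 'a" and k assume h: "vge (c * (f 0 * f 0)) 0" and "k < dim_row (diagL [c])"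
      then have "k = 0" by simp
      then show "vge (f k) 0" using an[OF h] by blast
    qed
  qed
  moreover have "(diagL [c])\<^sup>T = diagL [c]" by (rule eq_matI) auto
  ultimately show ?thesis unfolding kern_def using assms c fequiv_diagL[of "[c]"] by simp
qed

lemma unary_valued:
  assumes "c \<noteq> 0"
  shows "even (v c) \<Longrightarrow> even_valued (diagL [c])" "odd (v c) \<Longrightarrow> odd_valued (diagL [c])"
  using assms unfolding even_valued_def odd_valued_def by (auto simp: bform_diagL v_mult)

lemma integral_Abin:
  assumes "vge (\<gamma> * \<xi>) 0" "vge (2 * \<gamma>) 0" "vge (\<gamma> * \<eta>) 0"
  shows "integral_lattice v (Abin \<gamma> \<xi> \<eta>)"
  unfolding integral_lattice_bform[OF Abin_carrier]
proof (intro allI impI)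
  fix f :: "nat \<Rightarrow> 'a" assume "\<forall>k<2. vge (f k) 0"
  then have f: "vge (f 0) 0" "vge (f 1) 0" by auto
  have "bform (Abin \<gamma> \<xi> \<eta>) f f = f 0 * (f 0 * (\<gamma> * \<xi>)) + f 0 * (f 1 * (2 * \<gamma>)) + f 1 * (f 1 * (\<gamma> * \<eta>))"
    by (simp add: bform_Abin algebra_simps)
  then show "vge (bform (Abin \<gamma> \<xi> \<eta>) f f) 0" using f assms by (simp only: vge_add vge_mult0)
qed

end

context dyadic_pi
begin

lemma kern_unr:
  assumes c: "c \<noteq> 0" "v c = 0 \<or> v c = 1"
  shows "kern (Abin (c / 2) 2 (2 * \<rho>)) (bin c \<Delta>)"
    "even (v c) \<Longrightarrow> even_valued (Abin (c / 2) 2 (2 * \<rho>))"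
    "odd (v c) \<Longrightarrow> odd_valued (Abin (c / 2) 2 (2 * \<rho>))"
proof -
  have q: "bform (Abin (c / 2) 2 (2 * \<rho>)) f f = c * unrN (f 0) (f 1)" for f
    by (simp add: bform_Abin unrN_def power2_eq_square algebra_simps)
  show "even (v c) \<Longrightarrow> even_valued (Abin (c / 2) 2 (2 * \<rho>))"
    "odd (v c) \<Longrightarrow> odd_valued (Abin (c / 2) 2 (2 * \<rho>))"
    using c unrN_even unfolding even_valued_def odd_valued_def q by (auto simp: v_mult)
  have i: "integral_lattice v (Abin (c / 2) 2 (2 * \<rho>))"
    by (rule integral_Abin) (use c in \<open>auto simp: vge_def v_mult\<close>)
  have a: "aniso_max (Abin (c / 2) 2 (2 * \<rho>))"
    unfolding aniso_max_def q
  proof (intro allI impI)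
    fix f :: "nat \<Rightarrow> 'a" and k assume h: "vge (c * unrN (f 0) (f 1)) 0" and k: "k < dim_row (Abin (c / 2) 2 (2 * \<rho>))"
    \<comment> \<open>As \<open>c\<close> has order at most 1, the norm value has order at least -1,
      the odd bound from which integrality of the coordinates still follows.\<close>
    have "vge (unrN (f 0) (f 1)) (2 * (- 1) + 1)" using h c by (auto simp: vge_mult_iff elim: vge_mono)
    then have "vge (f 0) 0 \<and> vge (f 1) 0" using unrN_vge_odd[of "f 0" "f 1" "- 1"] by simp
    then show "vge (f k) 0" using k by (auto simp: less_2_cases_iff)
  qed
  have "fequiv (Abin (c / 2) 2 (2 * \<rho>)) {#c / 2 * 2, c / 2 * (2 * \<rho>) - c / 2 / 2#}"
    by (rule fequiv_Abin) (use c in auto)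
  moreover have "meq {#c / 2 * 2, c / 2 * (2 * \<rho>) - c / 2 / 2#} (bin c \<Delta>)"
    unfolding bin_def
  proof (rule meq_pair)
    have "4 * (c / 2 * (2 * \<rho>) - c / 2 / 2) = - (c * \<Delta>)" by (simp add: Delta_def field_simps)
    then have "c / 2 * (2 * \<rho>) - c / 2 / 2 = - (c * \<Delta>) / 4" by (metis four_nz nonzero_mult_div_cancel_left)
    then show "sqeq (c / 2 * (2 * \<rho>) - c / 2 / 2) (- (c * \<Delta>))"
      by (intro sqeqI[of "1 / 2"]) (simp_all add: power2_eq_square)
  qed simp
  ultimately have "fequiv (Abin (c / 2) 2 (2 * \<rho>)) (bin c \<Delta>)" using fequiv_meq[OF Abin_carrier] by blast
  moreover have "size (bin c \<Delta>) = 2" by (simp add: bin_def)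
  moreover have "0 \<notin># bin c \<Delta>" using c by (auto simp: bin_def)
  ultimately show "kern (Abin (c / 2) 2 (2 * \<rho>)) (bin c \<Delta>)"
    unfolding kern_def using a i by simp
qed

lemma kern_quat: "kern (Abin (1/2) 2 (2*\<rho>) \<perp>\<^sub>L Abin (\<pi>/2) 2 (2*\<rho>)) quat"
  unfolding quat_def by (rule kern_osum) (use kern_unr[of 1] kern_unr[of \<pi>] in auto)

text \<open>With \<open>v a = 2 * m + 1\<close> and \<open>q = \<pi> powi (- m)\<close>, the value
  is \<open>u\<close> times the norm of \<open>x + y * q * (1 + sqrt \<delta>)\<close>, and
  \<open>q * (1 + sqrt \<delta>)\<close> has norm \<open>- a * q^2\<close> of order 1. This is the
  origin of the exponents: \<open>x^2\<close> has even order, \<open>a * q^2 * y^2\<close> odd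
  order, and the cross term is too small to interfere because \<open>m < v 2\<close>.\<close>

lemma kern_ram:
  assumes a: "odd (v (\<delta> - 1))" "1 \<le> v (\<delta> - 1)" "v (\<delta> - 1) < 2 * v 2" "\<delta> \<noteq> 1" and u: "u \<noteq> 0" "v u = 0"
  shows "kern (Abin (u * \<pi> powi ((1 - v (\<delta> - 1)) div 2)) (\<pi> powi ((v (\<delta> - 1) - 1) div 2))
    (- (\<delta> - 1) * \<pi> powi ((1 - v (\<delta> - 1)) div 2))) (bin u \<delta>)"
proof -
  define a where "a = \<delta> - 1"
  have anz: "a \<noteq> 0" and va: "odd (v a)" "1 \<le> v a" "v a < 2 * v 2" using assms by (auto simp: a_def)
  obtain m where m: "v a = 2 * m + 1" using va by (elim oddE)
  define q where "q = \<pi> powi (- m)"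
  have q: "q \<noteq> 0" "v q = - m" by (auto simp: q_def v_powi)
  have qi: "\<pi> powi m = 1 / q" by (simp add: q_def power_int_minus divide_inverse)
  define A where "A = Abin (u * q) (1 / q) (- a * q)"
  have Q: "bform A f f = u * ((f 0)^2 + 2 * q * f 0 * f 1 + - a * q^2 * (f 1)^2)" for f
    using q by (simp add: A_def bform_Abin power2_eq_square algebra_simps)
  have i: "integral_lattice v A" unfolding A_def
    by (rule integral_Abin) (use q u anz m va in \<open>auto simp: vge_def v_mult v_divide\<close>)
  have an: "vge x 0 \<and> vge y 0" if h: "vge (x^2 + 2 * q * x * y + - a * q^2 * y^2) 0" for x y
  proof -
    have v2q: "1 \<le> v (2 * q)" using q m va by (simp add: v_mult)
    have cross: "vge (2 * q * x * y) (1 + i + j)" if "vge x i" "vge y j" for i j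
      using that v2q by (intro vge_mult_le[of "2 * q * x" "1 + i"] vge_mult_le[of "2 * q" 1]) (auto simp: vge_def[of "2 * q"])
    have vaq: "v (- a * q^2) = 1" using anz q m by (simp add: v_mult v_power)
    consider "x = 0" "y = 0" | "x \<noteq> 0" "vge y (v x)" | "y \<noteq> 0" "vge x (v y + 1)"
      by (cases "x = 0 \<or> y = 0"; cases "v x \<le> v y") (auto simp: vge_def)
    then show ?thesis
    proof cases
      case 2
      have "vge (- a * q^2 * y^2) (2 * v x + 1)"
        using vge_mult_le[OF vge_v[of "- a * q^2"] vge_mult[OF 2(2) 2(2)]] vaq by (simp add: power2_eq_square)
      moreover have "vge (2 * q * x * y) (2 * v x + 1)" using vge_mono[OF cross[OF vge_v 2(2)]] by simp
      ultimately have "vge (2 * q * x * y + - a * q^2 * y^2) (v (x^2) + 1)"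
        using 2 vge_add by (simp add: v_power del: mult_minus_left)
      then have "v (x^2 + (2 * q * x * y + - a * q^2 * y^2)) = 2 * v x"
        "x^2 + (2 * q * x * y + - a * q^2 * y^2) \<noteq> 0"
        using v_add_less[of "x^2" "2 * q * x * y + - a * q^2 * y^2"] 2 by (auto simp: v_power)
      then have "0 \<le> v x" using h unfolding vge_def add.assoc by simp
      then show ?thesis using 2 vge_mono by (auto simp: vge_def)
    next
      case 3
      have y2: "- a * q^2 * y^2 \<noteq> 0" "v (- a * q^2 * y^2) = 2 * v y + 1"
        using 3 anz q vaq v_mult[of "- a * q^2" "y^2"] by (auto simp: v_power)
      have "vge (x^2) (2 * v y + 2)" using vge_mult[OF 3(2) 3(2)] by (simp add: power2_eq_square)
      moreover have "vge (2 * q * x * y) (2 * v y + 2)" using vge_mono[OF cross[OF 3(2) vge_v]] by simp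
      ultimately have "vge (x^2 + 2 * q * x * y) (v (- a * q^2 * y^2) + 1)"
        using vge_add[of "x^2" "2 * v y + 2" "2 * q * x * y"] by (simp add: y2 add.commute del: mult_minus_left)
      then have "v (- a * q^2 * y^2 + (x^2 + 2 * q * x * y)) = 2 * v y + 1"
        "- a * q^2 * y^2 + (x^2 + 2 * q * x * y) \<noteq> 0"
        using v_add_less[OF y2(1)] y2 by auto
      then have "0 \<le> v y" using h by (simp add: vge_def add.commute)
      then show ?thesis using 3 vge_mono[OF 3(2), of 0] by (auto simp: vge_def)
    qed simp
  qed
  have am: "aniso_max A" unfolding aniso_max_def Q
  proof (intro allI impI)
    fix f :: "nat \<Rightarrow> 'a" and k
    assume "vge (u * ((f 0)^2 + 2 * q * f 0 * f 1 + - a * q^2 * (f 1)^2)) 0" and k: "k < dim_row A"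
    then have "vge ((f 0)^2 + 2 * q * f 0 * f 1 + - a * q^2 * (f 1)^2) 0"
      unfolding vge_mult_iff[OF u(1)] u(2) by simp
    then have "vge (f 0) 0 \<and> vge (f 1) 0" by (rule an)
    then show "vge (f k) 0" using k by (auto simp: A_def less_2_cases_iff)
  qed
  have "fequiv A {#u * q * (1 / q), u * q * (- a * q) - u * q / (1 / q)#}"
    unfolding A_def by (rule fequiv_Abin) (use u q in auto)
  moreover have "meq {#u * q * (1 / q), u * q * (- a * q) - u * q / (1 / q)#} (bin u \<delta>)"
    unfolding bin_def
    by (intro meq_pair sqeqI[of q "u * q * (- a * q) - u * q / (1 / q)"])
       (use q in \<open>auto simp: a_def power2_eq_square algebra_simps\<close>)
  ultimately have "fequiv A (bin u \<delta>)" using fequiv_meq[of A 2] by (auto simp: A_def)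
  moreover have "\<delta> \<noteq> 0" using tern_unit(4)[OF assms(1-4)] .
  moreover have "A \<in> carrier_mat 2 2" "A\<^sup>T = A" "size (bin u \<delta>) = 2" by (simp_all add: A_def bin_def)
  ultimately have "kern A (bin u \<delta>)"
    unfolding kern_def using am i u by (auto simp: bin_def)
  moreover have "(1 - v (\<delta> - 1)) div 2 = - m" "(v (\<delta> - 1) - 1) div 2 = m"
    using m by (simp_all add: a_def)
  ultimately show ?thesis by (simp add: A_def q_def[symmetric] qi a_def)
qed

end

section \<open>The minimal testing sets\<close>

lemma mrep_add_left: "mrep A B \<Longrightarrow> mrep (C + A) (C + B)"
  by (rule mrep_add) simp_all

context dyadic
begin

text \<open>A lattice \<open>M\<close> of rank \<open>n\<close> is represented over the field by
  some listed space, hence by the listed lattice, by maximality. For minimality, the witness of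
  \<open>drop\<close> passes every test but one and is not universal. The triples keep with each
  matrix its diagonalization, so \<open>cover\<close> and the representation conditions in
  \<open>drop\<close> are statements about spaces only.\<close>

lemma minimal_testing_setI:
  assumes K: "\<And>k A x. (k, A, x) \<in> K \<Longrightarrow> kern A x \<and> 2 * k + size x = n"
    and cover: "\<And>y. 0 \<notin># y \<Longrightarrow> size y = n \<Longrightarrow> \<exists>k A x. (k, A, x) \<in> K \<and> mrep (hyp k + x) y"
    and drop: "\<And>k A x. (k, A, x) \<in> K \<Longrightarrow> \<exists>k' A' x'. kern A' x' \<and> \<not> mrep (hyp k' + x') (hyp k + x) \<and>
      (\<forall>k2 A2 x2. (k2, A2, x2) \<in> K \<longrightarrow> (k2, A2, x2) \<noteq> (k, A, x) \<longrightarrow> mrep (hyp k' + x') (hyp k2 + x2))"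
  shows "minimal_testing_set v n ((\<lambda>(k, A, x). Hpow k \<perp>\<^sub>L A) ` K)"
proof -
  let ?S = "(\<lambda>(k, A, x). Hpow k \<perp>\<^sub>L A) ` K"
  have lat: "is_lattice n (Hpow k \<perp>\<^sub>L A)" if "(k, A, x) \<in> K" for k A x
    using kern_lattice(1)[of A x k] K[OF that] by simp
  have O_trans: "represents v L N" if "represents v L M" "represents v M N"
    "L \<in> carrier_mat l l" "M \<in> carrier_mat m m" for L M N l m
    using that(1,2) unfolding represents_rep_over
    by (rule rep_over_trans[OF that(3,4), rotated 3]) (simp_all add: intO_iff vge_add vge_mult0)
  have "testing_set v n ?S"
    unfolding testing_set_def
  proof (intro conjI allI impI ballI)
    fix M assume "M \<in> ?S" then show "is_lattice n M" using lat by auto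
  next
    fix L l assume L: "is_lattice l L \<and> integral_lattice v L \<and> (\<forall>M\<in>?S. represents v L M)"
    show "n_universal v n L" unfolding n_universal_def
    proof (intro conjI allI impI)
      show "integral_lattice v L" using L by blast
    next
      fix M assume M: "is_lattice n M \<and> integral_lattice v M"
      then have Mc: "M \<in> carrier_mat n n" "M\<^sup>T = M" by (auto simp: is_lattice_def)
      obtain xs where xs: "length xs = n" "0 \<notin> set xs" "frep (diagL xs) M"
        using diagonalize[OF two_nz Mc] by blast
      obtain k A x where t: "(k, A, x) \<in> K" "mrep (hyp k + x) (mset xs)" using cover[of "mset xs"] xs by auto
      have kA: "kern A x" "Hpow k \<perp>\<^sub>L A \<in> carrier_mat n n"
        using K[OF t(1)] lat[OF t(1)] by (auto simp: is_lattice_def)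
      have "frep (Hpow k \<perp>\<^sub>L A) (diagL xs)"
        using fequiv_frep[OF kA(2) diagL_carrier kern_lattice(3)[OF kA(1)] fequiv_diagL] t by blast
      then have "frep (Hpow k \<perp>\<^sub>L A) M" using frep_trans[OF kA(2) diagL_carrier] xs by blast
      then have "represents v (Hpow k \<perp>\<^sub>L A) M"
        using kern_lattice(4)[OF kA(1), of k] Mc M unfolding maximal_rep_def by blast
      moreover have "represents v L (Hpow k \<perp>\<^sub>L A)" using L t by force
      ultimately show "represents v L M" using O_trans kA(2) L by (metis is_lattice_def)
    qed
  qed
  moreover have "\<not> testing_set v n S'" if S': "S' \<subset> ?S" for S'
  proof
    assume T: "testing_set v n S'"
    obtain k A x where t: "(k, A, x) \<in> K" "Hpow k \<perp>\<^sub>L A \<notin> S'" using S' by auto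
    obtain k' A' x' where t': "kern A' x'" "\<not> mrep (hyp k' + x') (hyp k + x)"
      "\<And>k2 A2 x2. (k2, A2, x2) \<in> K \<Longrightarrow> (k2, A2, x2) \<noteq> (k, A, x) \<Longrightarrow> mrep (hyp k' + x') (hyp k2 + x2)"
      using drop[OF t(1)] by blast
    have "represents v (Hpow k' \<perp>\<^sub>L A') M" if M: "M \<in> S'" for M
    proof -
      obtain k2 A2 x2 where t2: "(k2, A2, x2) \<in> K" "M = Hpow k2 \<perp>\<^sub>L A2"
        using subsetD[OF psubset_imp_subset[OF S'] M] by auto
      then have "(k2, A2, x2) \<noteq> (k, A, x)" using M t by auto
      then show ?thesis using t'(3)[OF t2(1)] kern_represents[OF t'(1)] K[OF t2(1)] t2(2) by blast
    qed
    then have "n_universal v n (Hpow k' \<perp>\<^sub>L A')"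
      using T kern_lattice(1,2)[OF t'(1), of k'] unfolding testing_set_def by blast
    then have "represents v (Hpow k' \<perp>\<^sub>L A') (Hpow k \<perp>\<^sub>L A)"
      unfolding n_universal_def using lat[OF t(1)] kern_lattice(2) K[OF t(1)] by blast
    then show False using t'(2) kern_represents[OF t'(1)] K[OF t(1)] by blast
  qed
  ultimately show ?thesis unfolding minimal_testing_set_def by blast
qed

lemma kern_meq:
  assumes "kern A x" "meq x y" "size y = size x" "0 \<notin># y" shows "kern A y"
  using assms fequiv_meq unfolding kern_def by auto

lemma hyp_2_rep: "a \<noteq> (0::'a) \<Longrightarrow> b \<noteq> 0 \<Longrightarrow> mrep (hyp 2) {#a, b#}"
  using mrep_add[OF hyp_1_rep hyp_1_rep, of b a] hyp_add[of 1 1, where 'a='a] by (simp add: numeral_2_eq_2)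

lemma hyp_cancel: "mrep (hyp k + A) (hyp k + B) \<Longrightarrow> mrep A (B :: 'a multiset)"
  using mrep_cancel[OF two_nz hyp_nz] by blast

end

context dyadic_sys
begin

lemma hyp_cancel_le:
  "mrep (hyp (k + j) + A) (hyp k + B) \<Longrightarrow> mrep (hyp j + A) (B :: 'a multiset)"
  by (rule hyp_cancel[of k]) (simp add: hyp_add add.assoc)

lemma hyp_lift: "mrep (hyp j + A) B \<Longrightarrow> mrep (hyp (k + j) + A) (hyp k + (B :: 'a multiset))"
  using mrep_add_left[of "hyp j + A" B "hyp k"] by (simp add: hyp_add add.assoc)

definition nonunit_classes :: "'a set" where
  "nonunit_classes = (\<lambda>\<epsilon>. \<epsilon> * \<pi>) ` U"

lemma classes_nz: "a \<in> U \<union> nonunit_classes \<Longrightarrow> a \<noteq> 0"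
  using U_nz by (auto simp: nonunit_classes_def)

lemma nonunit_v: "a \<in> nonunit_classes \<Longrightarrow> v a = 1"
  using U_nz U_v by (auto simp: nonunit_classes_def v_mult)

lemma sqeq_even: "sqeq a b \<Longrightarrow> b \<noteq> 0 \<Longrightarrow> even (v a - v b)"
  by (auto simp: sqeq_def v_mult v_power)

lemma classes_inj:
  assumes "a \<in> U \<union> nonunit_classes" "b \<in> U \<union> nonunit_classes" "sqeq a b" shows "a = b"
proof -
  have ev: "even (v a - v b)" using sqeq_even assms classes_nz by blast
  then consider "a \<in> U" "b \<in> U" | "a \<in> nonunit_classes" "b \<in> nonunit_classes"
    using assms U_v nonunit_v by fastforce
  then show ?thesis
  proof cases
    case 1 then show ?thesis using U_inj assms by blast
  next
    case 2
    then obtain u w where uw: "u \<in> U" "w \<in> U" "a = u * \<pi>" "b = w * \<pi>" by (auto simp: nonunit_classes_def)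
    obtain s where "s \<noteq> 0" "u * \<pi> = w * \<pi> * s^2" using assms uw by (auto simp: sqeq_def)
    then have "sqeq u w" by (intro sqeqI[of s]) auto
    then show ?thesis using U_inj uw by blast
  qed
qed

lemma classes_cover:
  assumes "D \<noteq> 0" obtains a where "a \<in> U \<union> nonunit_classes" "sqeq D a"
  using U_cover[OF assms] by (metis UnI1 UnI2 imageI nonunit_classes_def)

section \<open>Odd rank\<close>

definition tern_lattice :: "'a \<Rightarrow> 'a mat" where
  "tern_lattice a = (if a \<in> U then Abin (\<pi>/2) 2 (2*\<rho>) \<perp>\<^sub>L diagL [\<Delta> * a]
     else Abin (1/2) 2 (2*\<rho>) \<perp>\<^sub>L diagL [\<Delta> * a])"

lemma size_tern [simp]: "size (tern a) = 3" by (simp add: tern_def bin_def)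

lemma tern_nz: "a \<noteq> 0 \<Longrightarrow> 0 \<notin># tern a" by (simp add: tern_def bin_def)

lemma kern_tern:
  assumes a: "a \<in> U \<union> nonunit_classes" shows "kern (tern_lattice a) (tern a)"
proof -
  have nz: "\<Delta> * a \<noteq> 0" using classes_nz[OF a] by simp
  show ?thesis
  proof (cases "a \<in> U")
    case True
    then have va: "v a = 0" "v (\<Delta> * a) = 0" using U_v U_nz by (auto simp: v_mult)
    have "kern (Abin (\<pi>/2) 2 (2*\<rho>) \<perp>\<^sub>L diagL [\<Delta> * a]) (bin \<pi> \<Delta> + {#\<Delta> * a#})"
      by (rule kern_osum) (use kern_unr[of \<pi>] kern_unary[OF nz] unary_valued[OF nz] va in auto)
    moreover have "meq (bin \<pi> \<Delta> + {#\<Delta> * a#}) (bin (\<pi> * a) \<Delta> + {#\<Delta> * a#})"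
      by (intro meq_add meq_refl bin_Delta) (use nz va in \<open>auto simp: v_mult\<close>)
    moreover have "bin (\<pi> * a) \<Delta> + {#\<Delta> * a#} = tern a" by (simp add: tern_def)
    ultimately show ?thesis using True kern_meq[of _ _ "tern a"] tern_nz[of a] nz
      by (simp add: tern_lattice_def bin_def)
  next
    case False
    then have va: "v a = 1" "v (\<Delta> * a) = 1" using nonunit_v a nz by (auto simp: v_mult)
    have "kern (Abin (1/2) 2 (2*\<rho>) \<perp>\<^sub>L diagL [\<Delta> * a]) (bin 1 \<Delta> + {#\<Delta> * a#})"
      by (rule kern_osum) (use kern_unr[of 1] kern_unary[OF nz] unary_valued[OF nz] va in auto)
    moreover have "meq (bin 1 \<Delta> + {#\<Delta> * a#}) (bin (\<pi> * a) \<Delta> + {#\<Delta> * a#})"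
      by (intro meq_add meq_refl bin_Delta) (use nz va in \<open>auto simp: v_mult\<close>)
    moreover have "bin (\<pi> * a) \<Delta> + {#\<Delta> * a#} = tern a" by (simp add: tern_def)
    ultimately show ?thesis using False kern_meq[of _ _ "tern a"] tern_nz[of a] nz
      by (simp add: tern_lattice_def bin_def)
  qed
qed

lemma kern_class_unary: "a \<in> U \<union> nonunit_classes \<Longrightarrow> kern (diagL [a]) {#a#}"
  using kern_unary[of a] classes_nz[of a] U_v nonunit_v by blast

lemma tern_sqeq:
  assumes "sqeq a b" "a \<noteq> 0" "b \<noteq> 0" shows "meq (tern a) (tern b)"
  unfolding tern_def
  by (intro meq_add meq_sqeq sqeq_mult sqeq_refl bin_Delta)
     (use assms sqeq_even[OF assms(1,3)] in \<open>auto simp: v_mult\<close>)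

text \<open>For equal parity the two forms share their unramified plane, and the hyperbolic plane
  supplies \<open>\<Delta> * b\<close>. For different parity the unramified plane of
  \<open>tern a\<close> supplies \<open>\<Delta> * b\<close>, and the hyperbolic plane completes
  \<open>\<Delta> * a\<close> to an unramified plane of the required parity.\<close>

lemma hyp_1_tern_rep:
  assumes ab: "a \<noteq> 0" "b \<noteq> 0" shows "mrep (hyp 1 + tern a) (tern b)"
proof (cases "even (v a - v b)")
  case True
  have "mrep (hyp 1 + tern a) ({#\<Delta> * b#} + bin (\<pi> * a) \<Delta>)"
    unfolding tern_def using mrep_drop[of "bin (\<pi> * a) \<Delta>" "{#\<Delta> * a#}"] ab
    by (intro mrep_add hyp_1_rep) (simp_all add: add.commute)
  also have "meq \<dots> (tern b)" unfolding tern_def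
    by (intro meq_add meq_refl bin_Delta) (use ab True in \<open>auto simp: v_mult\<close>)
  finally show ?thesis .
next
  case False
  have "meq (bin (\<pi> * a) \<Delta>) (bin (\<Delta> * b) \<Delta>)" by (intro bin_Delta) (use ab False in \<open>auto simp: v_mult\<close>)
  also have "mrep (bin (\<Delta> * b) \<Delta>) {#\<Delta> * b#}" by (rule mrep_subset) (simp add: bin_def)
  finally have 1: "mrep (bin (\<pi> * a) \<Delta>) {#\<Delta> * b#}" .
  have "mrep (hyp 1 + tern a) ({#- (\<Delta> * a * \<Delta>)#} + ({#\<Delta> * a#} + {#\<Delta> * b#}))"
    unfolding tern_def by (intro mrep_add hyp_1_rep 1 mrep_refl) (use ab in simp)
  also have "{#- (\<Delta> * a * \<Delta>)#} + ({#\<Delta> * a#} + {#\<Delta> * b#}) = {#\<Delta> * b#} + bin (\<Delta> * a) \<Delta>"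
    by (simp add: bin_def add_mset_commute)
  also have "meq \<dots> (tern b)" unfolding tern_def
    by (intro meq_add meq_refl bin_Delta) (use ab False in \<open>auto simp: v_mult\<close>)
  finally show ?thesis .
qed

text \<open>Two hyperbolic planes are the sum of the unramified plane of \<open>tern a\<close> and
  its negative. Cancelling that plane would leave \<open>tern (\<Delta> * a)\<close> representing
  \<open>\<Delta> * a\<close>.\<close>

lemma hyp_2_not_tern:
  assumes a: "a \<noteq> 0" shows "\<not> mrep (hyp 2 + {#a#}) (tern a)"
proof
  assume h: "mrep (hyp 2 + {#a#}) (tern a)"
  define C where "C = {#\<pi> * a, - (\<pi> * a * \<Delta>)#}"
  have "meq (hyp 1 + hyp 1) ({#\<pi> * a, - (\<pi> * a)#} + {#- (\<pi> * a * \<Delta>), - (- (\<pi> * a * \<Delta>))#})"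
    by (intro meq_add hyp_1_pair) (use a in auto)
  then have "meq (hyp 1 + hyp 1 + {#a#}) ({#\<pi> * a, - (\<pi> * a)#} + {#- (\<pi> * a * \<Delta>), - (- (\<pi> * a * \<Delta>))#} + {#a#})"
    by (rule meq_add) simp
  also have "{#\<pi> * a, - (\<pi> * a)#} + {#- (\<pi> * a * \<Delta>), - (- (\<pi> * a * \<Delta>))#} + {#a#} = C + ({#a#} + bin (- (\<pi> * a)) \<Delta>)"
    by (simp add: C_def bin_def add_mset_commute)
  finally have "mrep (C + ({#a#} + bin (- (\<pi> * a)) \<Delta>)) (hyp 2 + {#a#})"
    using hyp_add[of 1 1, where 'a='a] by (simp add: meq_def numeral_2_eq_2)
  also note h
  also have "tern a = C + {#\<Delta> * a#}" by (simp add: tern_def C_def bin_def)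
  finally have 1: "mrep ({#a#} + bin (- (\<pi> * a)) \<Delta>) {#\<Delta> * a#}"
    by (rule mrep_cancel[OF two_nz, rotated]) (use a in \<open>simp add: C_def\<close>)
  have "meq (tern (\<Delta> * a)) ({#a#} + bin (- (\<pi> * a)) \<Delta>)" unfolding tern_def
    by (intro meq_add meq_sqeq sqeqI[of \<Delta>] bin_Delta) (use a in \<open>auto simp: v_mult power2_eq_square\<close>)
  then have "mrep (tern (\<Delta> * a)) {#\<Delta> * a#}" using 1 meq_mrep_trans(1) by blast
  then show False using tern_not_rep a by simp
qed

text \<open>The two families are played against each other: the lattice with kernel
  \<open>{#a#}\<close> is missed by hyperbolic planes plus \<open>tern a\<close>, and the one with
  kernel \<open>tern a\<close> by hyperbolic planes plus \<open>{#a#}\<close>, each time in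
  dimension \<open>n + 2\<close>.\<close>

lemma minimal_odd:
  assumes n: "n = 2 * h + 3"
  shows "minimal_testing_set v n
    ((\<lambda>a. Hpow (h + 1) \<perp>\<^sub>L diagL [a]) ` (U \<union> nonunit_classes) \<union>
     (\<lambda>a. Hpow h \<perp>\<^sub>L tern_lattice a) ` (U \<union> nonunit_classes))"
proof -
  let ?A = "U \<union> nonunit_classes"
  define K where "K = (\<lambda>a. (h + 1, diagL [a], {#a#})) ` ?A \<union> (\<lambda>a. (h, tern_lattice a, tern a)) ` ?A"
  have "minimal_testing_set v n ((\<lambda>(k, A, x). Hpow k \<perp>\<^sub>L A) ` K)"
  proof (rule minimal_testing_setI)
    fix k A x assume "(k, A, x) \<in> K"
    then consider a where "a \<in> ?A" "(k, A, x) = (h + 1, diagL [a], {#a#})"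
      | a where "a \<in> ?A" "(k, A, x) = (h, tern_lattice a, tern a)" unfolding K_def by blast
    then show "kern A x \<and> 2 * k + size x = n"
      by cases (use kern_tern kern_class_unary n in simp_all)
  next
    fix y :: "'a multiset" assume y: "0 \<notin># y" "size y = n"
    have "y \<noteq> {#}" using y n by auto
    moreover have "size y \<noteq> 2 * k + 2" "size y \<noteq> 2 * k + 4" for k using y n by presburger+
    ultimately consider
      k a where "a \<noteq> 0" "size y = 2 * k + 1" "mrep (hyp k + {#a#}) y" |
      k a where "a \<noteq> 0" "size y = 2 * k + 3" "mrep (hyp k + tern a) y"
      using kernel_cover[OF y(1)] by blast
    then show "\<exists>k A x. (k, A, x) \<in> K \<and> mrep (hyp k + x) y"
    proof cases
      case 1
      obtain b where b: "b \<in> ?A" "sqeq a b" using classes_cover[OF 1(1)] by blast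
      have k: "k = h + 1" using 1(2) y n by simp
      have "mrep (hyp (h + 1) + {#b#}) (hyp k + {#a#})"
        unfolding k by (intro mrep_add_left meq_mrep meq_sym[OF meq_sqeq[OF b(2)]])
      then have "mrep (hyp (h + 1) + {#b#}) y" using 1(3) by (rule mrep_trans)
      then show ?thesis using b(1) unfolding K_def by blast
    next
      case 2
      obtain b where b: "b \<in> ?A" "sqeq a b" using classes_cover[OF 2(1)] by blast
      have k: "k = h" using 2(2) y n by simp
      have "mrep (hyp h + tern b) (hyp k + tern a)"
        unfolding k by (intro mrep_add_left meq_mrep meq_sym[OF tern_sqeq[OF b(2) 2(1) classes_nz[OF b(1)]]])
      then have "mrep (hyp h + tern b) y" using 2(3) by (rule mrep_trans)
      then show ?thesis using b(1) unfolding K_def by blast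
    qed
  next
    fix k A x assume t: "(k, A, x) \<in> K"
    have ternS: "mrep (tern a) {#b#}" if "a \<in> ?A" "b \<in> ?A" "b \<noteq> a" for a b
    proof -
      have "\<not> sqeq a b" using classes_inj that by blast
      from tern_rep[OF classes_nz[OF that(1)] classes_nz[OF that(2)] this]
      obtain x y where "meq (tern a) {#b, x, y#}" by blast
      also have "mrep {#b, x, y#} {#b#}" by (rule mrep_subset) simp
      finally show ?thesis .
    qed
    from t consider a where "a \<in> ?A" "(k, A, x) = (h + 1, diagL [a], {#a#})"
      | a where "a \<in> ?A" "(k, A, x) = (h, tern_lattice a, tern a)" unfolding K_def by blast
    then show "\<exists>k' A' x'. kern A' x' \<and> \<not> mrep (hyp k' + x') (hyp k + x) \<and>
      (\<forall>k2 A2 x2. (k2, A2, x2) \<in> K \<longrightarrow> (k2, A2, x2) \<noteq> (k, A, x) \<longrightarrow> mrep (hyp k' + x') (hyp k2 + x2))"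
    proof cases
      case 1
      show ?thesis
      proof (intro exI conjI allI impI)
        show "kern (tern_lattice a) (tern a)" by (rule kern_tern[OF 1(1)])
        show "\<not> mrep (hyp (h + 1) + tern a) (hyp k + x)"
          using hyp_cancel[of "h + 1" "tern a" "{#a#}"] tern_not_rep[OF classes_nz[OF 1(1)]] 1(2) by auto
        fix k2 A2 x2 assume t2: "(k2, A2, x2) \<in> K" "(k2, A2, x2) \<noteq> (k, A, x)"
        from t2(1) consider b where "b \<in> ?A" "(k2, A2, x2) = (h + 1, diagL [b], {#b#})"
          | b where "b \<in> ?A" "(k2, A2, x2) = (h, tern_lattice b, tern b)" unfolding K_def by blast
        then show "mrep (hyp (h + 1) + tern a) (hyp k2 + x2)"
        proof cases
          case b: 1
          then have "b \<noteq> a" using t2(2) 1(2) by auto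
          then have "mrep (hyp (h + 1) + tern a) (hyp (h + 1) + {#b#})"
            by (intro mrep_add_left ternS[OF 1(1) b(1)])
          then show ?thesis using b(2) by simp
        next
          case b: 2
          then show ?thesis using hyp_lift[OF hyp_1_tern_rep[OF classes_nz[OF 1(1)] classes_nz[OF b(1)]], of h] by auto
        qed
      qed
    next
      case 2
      have anz: "a \<noteq> 0" using classes_nz[OF 2(1)] .
      show ?thesis
      proof (intro exI conjI allI impI)
        show "kern (diagL [a]) {#a#}" by (rule kern_class_unary[OF 2(1)])
        show "\<not> mrep (hyp (h + 2) + {#a#}) (hyp k + x)"
          using hyp_cancel_le[of h 2 "{#a#}" "tern a"] hyp_2_not_tern[OF anz] 2(2) by auto
        fix k2 A2 x2 assume t2: "(k2, A2, x2) \<in> K" "(k2, A2, x2) \<noteq> (k, A, x)"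
        from t2(1) consider b where "b \<in> ?A" "(k2, A2, x2) = (h + 1, diagL [b], {#b#})"
          | b where "b \<in> ?A" "(k2, A2, x2) = (h, tern_lattice b, tern b)" unfolding K_def by blast
        then show "mrep (hyp (h + 2) + {#a#}) (hyp k2 + x2)"
        proof cases
          case b: 1
          have "mrep (hyp 1 + {#a#}) {#b#}"
            using mrep_trans[OF mrep_drop hyp_1_rep] classes_nz[OF b(1)] by blast
          then show ?thesis using hyp_lift[of 1 "{#a#}" "{#b#}" "h + 1"] b(2) by auto
        next
          case b: 2
          then have "b \<noteq> a" using t2(2) 2(2) by auto
          then have "\<not> sqeq b a" using classes_inj b 2 by blast
          then obtain x y where xy: "x \<noteq> 0" "y \<noteq> 0" "meq (tern b) {#a, x, y#}"
            using tern_rep[OF classes_nz[OF b(1)] anz] by metis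
          have "mrep (hyp 2 + {#a#}) ({#x, y#} + {#a#})" by (intro mrep_add hyp_2_rep xy mrep_refl)
          also have "{#x, y#} + {#a#} = {#a, x, y#}" by (simp add: add_mset_commute)
          also have "meq {#a, x, y#} (tern b)" by (rule meq_sym[OF xy(3)])
          finally show ?thesis using hyp_lift[of 2 "{#a#}" "tern b" h] b(2) by auto
        qed
      qed
    qed
  qed
  moreover have "(\<lambda>(k, A, x). Hpow k \<perp>\<^sub>L A) ` K =
    (\<lambda>a. Hpow (h + 1) \<perp>\<^sub>L diagL [a]) ` ?A \<union> (\<lambda>a. Hpow h \<perp>\<^sub>L tern_lattice a) ` ?A"
    unfolding K_def image_Un image_image by simp
  ultimately show ?thesis by metis
qed

section \<open>Even rank\<close>

definition disc_classes :: "'a set" where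
  "disc_classes = (U - {1}) \<union> nonunit_classes"

definition nonnorm :: "'a \<Rightarrow> 'a" where
  "nonnorm D = (if D = \<Delta> then \<pi> else if D \<in> U then 1 + 4 * \<rho> * inverse (D - 1) else \<Delta>)"

text \<open>The flag selects one of the two binary spaces with parameter \<open>D\<close>: the norm
  form, or its multiple by \<open>nonnorm D\<close>.\<close>

definition bin_lattice :: "bool \<Rightarrow> 'a \<Rightarrow> 'a mat" where
  "bin_lattice s D =
     (if D = \<Delta> then Abin ((if s then \<pi> else 1) / 2) 2 (2 * \<rho>)
      else if D \<in> U then Abin ((if s then nonnorm D else 1) * \<pi> powi ((1 - dint v D) div 2))
        (\<pi> powi ((dint v D - 1) div 2)) (- (D - 1) * \<pi> powi ((1 - dint v D) div 2))
      else diagL [if s then \<Delta> else 1, - (if s then \<Delta> else 1) * D])"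

lemma disc_nz: "D \<in> disc_classes \<Longrightarrow> D \<noteq> 0"
  using classes_nz by (auto simp: disc_classes_def)

lemma disc_nonsquare: "D \<in> disc_classes \<Longrightarrow> \<not> sqeq D 1"
proof
  assume D: "D \<in> disc_classes" and s: "sqeq D 1"
  then have "D = 1" using classes_inj[of D 1] U_1 by (auto simp: disc_classes_def)
  then show False using D nonunit_v[of 1] by (auto simp: disc_classes_def)
qed

lemma nonnorm_props:
  assumes D: "D \<in> disc_classes"
  shows "nonnorm D \<noteq> 0" "nonnorm D \<notin> normgroup D"
    "b \<noteq> 0 \<Longrightarrow> b \<in> normgroup D \<or> b * nonnorm D \<in> normgroup D"
    "kern (bin_lattice s D) (bin (if s then nonnorm D else 1) D)"
proof -
  have all: "nonnorm D \<noteq> 0 \<and> nonnorm D \<notin> normgroup D \<and>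
    (\<forall>b. b \<noteq> 0 \<longrightarrow> b \<in> normgroup D \<or> b * nonnorm D \<in> normgroup D) \<and>
    kern (bin_lattice s D) (bin (if s then nonnorm D else 1) D)"
  proof -
    consider "D = \<Delta>" | "D \<in> U" "D \<noteq> 1" "D \<noteq> \<Delta>" | "D \<in> nonunit_classes"
      using D by (auto simp: disc_classes_def)
    then show ?thesis
    proof cases
      case 1
      then show ?thesis using kern_unr(1)[of \<pi>] kern_unr(1)[of 1]
        by (auto simp: nonnorm_def bin_lattice_def normgroup_Delta v_mult)
    next
      case 2
      have d: "odd (v (D - 1))" "1 \<le> v (D - 1)" "v (D - 1) < 2 * v 2" "D \<noteq> 1"
        using U_defect_odd 2 by auto
      have c: "nonnorm D = 1 + 4 * \<rho> * inverse (D - 1)" using 2 by (simp add: nonnorm_def)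
      note t = tern_unit[OF d, folded c]
      have x: "- (D * nonnorm D) \<noteq> 0" using t by simp
      have "bin_lattice s D = Abin ((if s then nonnorm D else 1) * \<pi> powi ((1 - v (D - 1)) div 2))
          (\<pi> powi ((v (D - 1) - 1) div 2)) (- (D - 1) * \<pi> powi ((1 - v (D - 1)) div 2))"
        unfolding bin_lattice_def using 2 U_defect(4)[OF 2(1,2)] by simp
      then have "kern (bin_lattice s D) (bin (if s then nonnorm D else 1) D)"
        using kern_ram[OF d, of "if s then nonnorm D else 1"] t by simp
      then show ?thesis using tern_nonnorm[OF t(3) x t(1)] t(1) norm_index_unit[OF d, folded c] by blast
    next
      case 3
      then have nU: "D \<notin> U" "D \<noteq> \<Delta>" using nonunit_v[of D] U_v[of D] U_Delta by auto
      have Dv: "D \<noteq> 0" "v D = 1" using nonunit_v 3 disc_nz[OF D] by auto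
      have c: "nonnorm D = \<Delta>" using nU by (simp add: nonnorm_def)
      have "\<Delta> \<notin> normgroup D"
        by (rule tern_nonnorm[OF tern_prime]) (use Dv in auto)
      moreover have k: "kern (diagL [u, - u * D]) (bin u D)" if u: "u \<noteq> 0" "v u = 0" for u
      proof -
        have w: "- u * D \<noteq> 0" "v (- u * D) = 1" using u Dv by (simp_all add: v_mult)
        have "kern (diagL [u] \<perp>\<^sub>L diagL [- u * D]) ({#u#} + {#- u * D#})"
          by (rule kern_osum) (use kern_unary[OF u(1)] kern_unary[OF w(1)] unary_valued[OF u(1)] unary_valued[OF w(1)] u w in simp_all)
        then show ?thesis using diagL_append[of "[u]" "[- u * D]"] by (simp add: bin_def add_mset_commute)
      qed
      have "kern (bin_lattice s D) (bin (if s then nonnorm D else 1) D)"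
        using k[of \<Delta>] k[of 1] nU by (cases s) (simp_all add: bin_lattice_def c)
      ultimately show ?thesis using norm_index_prime[OF Dv] c by auto
    qed
  qed
  then show "nonnorm D \<noteq> 0" "nonnorm D \<notin> normgroup D"
    "b \<noteq> 0 \<Longrightarrow> b \<in> normgroup D \<or> b * nonnorm D \<in> normgroup D"
    "kern (bin_lattice s D) (bin (if s then nonnorm D else 1) D)" by blast+
qed

text \<open>Cancelling the entry 1 would leave \<open>tern (- 1)\<close> representing -1.\<close>

lemma quat_not_hyp: "\<not> mrep quat (hyp 1)"
proof
  assume h: "mrep quat (hyp 1)"
  have "meq ({#1#} + tern (- 1)) quat" using quat_split_tern[of 1] meq_sym by simp
  also note h
  also have "hyp 1 = {#1#} + {#- 1 :: 'a#}" by (simp add: hyp_Suc bin_def add_mset_commute)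
  finally have "mrep (tern (- 1)) {#- 1#}" by (rule mrep_cancel[OF two_nz, rotated]) simp
  then show False using tern_not_rep[of "- 1"] by simp
qed

text \<open>Three hyperbolic planes are the sum of \<open>C\<close>, three of the four entries of
  \<open>quat\<close>, and its negative. Cancelling \<open>C\<close> would leave
  \<open>tern (- (\<pi> * \<Delta>))\<close> representing the value that it misses.\<close>

lemma hyp_3_not_quat: "\<not> mrep (hyp 3) quat"
proof
  assume h: "mrep (hyp 3) quat"
  define C where "C = {#1, - \<Delta>, \<pi>#}"
  have "meq (hyp 1 + (hyp 1 + hyp 1)) ({#1, - 1#} + ({#- \<Delta>, - (- \<Delta>)#} + {#\<pi>, - \<pi>#}))"
    by (intro meq_add hyp_1_pair) auto
  also have "{#1, - 1#} + ({#- \<Delta>, - (- \<Delta>)#} + {#\<pi>, - \<pi>#}) = C + ({#- \<pi>#} + bin (- 1) \<Delta>)"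
    by (simp add: C_def bin_def add_mset_commute)
  finally have "mrep (C + ({#- \<pi>#} + bin (- 1) \<Delta>)) (hyp 3)"
    using hyp_add[of 1 2, where 'a='a] hyp_add[of 1 1, where 'a='a] by (simp add: meq_def numeral_2_eq_2 numeral_3_eq_3)
  also note h
  also have "quat = C + {#- (\<pi> * \<Delta>)#}" by (simp add: quat_def C_def bin_def add_mset_commute)
  finally have 1: "mrep ({#- \<pi>#} + bin (- 1) \<Delta>) {#- (\<pi> * \<Delta>)#}"
    by (rule mrep_cancel[OF two_nz, rotated]) (simp add: C_def)
  have "meq (tern (- (\<pi> * \<Delta>))) ({#- \<pi>#} + bin (- 1) \<Delta>)" unfolding tern_def
    by (intro meq_add meq_sqeq sqeqI[of \<Delta>] bin_Delta) (auto simp: v_mult power2_eq_square)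
  then have "mrep (tern (- (\<pi> * \<Delta>))) {#- (\<pi> * \<Delta>)#}" using 1 meq_mrep_trans(1) by blast
  then show False using tern_not_rep[of "- (\<pi> * \<Delta>)"] by simp
qed

text \<open>After cancelling \<open>c\<close>, a representation reads
  \<open>c' * (x^2 - D * y^2) = c * (z^2 - D)\<close>. As \<open>D\<close> is not a square, both
  sides are nonzero, and \<open>c' / c\<close> is a quotient of norms.\<close>

lemma bin_not_rep:
  assumes c: "(c::'a) \<noteq> 0" "c' \<noteq> 0" and D: "D \<noteq> 0" "\<not> sqeq D 1" and nn: "c' / c \<notin> normgroup D"
  shows "\<not> mrep (hyp 1 + bin c' D) (bin c D)"
proof
  assume h: "mrep (hyp 1 + bin c' D) (bin c D)"
  have "meq ({#c#} + ({#- c#} + bin c' D)) (hyp 1 + bin c' D)"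
    using meq_add[OF meq_sym[OF hyp_1_pair[OF c(1)]] meq_refl, of "bin c' D"] by (simp add: add_mset_commute)
  also note h
  also have "bin c D = {#c#} + {#- (c * D)#}" by (simp add: bin_def add_mset_commute)
  finally have "mrep ({#- c#} + bin c' D) {#- (c * D)#}"
    by (rule mrep_cancel[OF two_nz, rotated]) (use c in simp)
  then have "mrep (mset [- c, c', - (c' * D)]) {#- (c * D)#}" by (simp add: bin_def add_mset_commute)
  from mrep_singleD[OF this] obtain f where
    "- (c * D) = - c * (f 0)^2 + c' * (f (Suc 0))^2 - c' * D * (f (Suc (Suc 0)))^2" by auto
  then obtain z x y where e: "- (c * D) = - c * z^2 + c' * x^2 - c' * D * y^2" by blast
  then have e2: "c' * (x^2 - D * y^2) = c * (z^2 - D * 1^2)" by (simp add: algebra_simps)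
  have "z^2 - D * 1^2 \<noteq> 0"
  proof
    assume "z^2 - D * 1^2 = 0"
    then have "D = 1 * z^2" by simp
    then show False using D sqeqI[of z D 1] by auto
  qed
  then have g: "z^2 - D * 1^2 \<in> normgroup D" by (rule normgroupI) (rule refl)
  have nz: "x^2 - D * y^2 \<noteq> 0" using e2 normgroup_nz[OF g] c by auto
  then have g2: "x^2 - D * y^2 \<in> normgroup D" by (rule normgroupI) (rule refl)
  have "c' / c = (z^2 - D * 1^2) / (x^2 - D * y^2)"
    using e2 nz c by (simp add: frac_eq_eq mult.commute)
  then show False using nn normgroup_divide[OF g g2] by simp
qed

text \<open>Test spaces of dimension \<open>n + 2\<close> come in pairs: \<open>hyp h + quat\<close>
  misses the hyperbolic lattice and \<open>hyp (h + 2)\<close> the one containing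
  \<open>quat\<close>, while a binary kernel is missed by \<open>hyp (h + 1)\<close> plus the other
  binary space with the same \<open>D\<close>.\<close>

lemma minimal_even:
  assumes n: "n = 2 * h + 2"
  shows "minimal_testing_set v n
    ({Hpow (h + 1)} \<union>
     (if h \<ge> 1 then {Hpow (h - 1) \<perp>\<^sub>L Abin (1/2) 2 (2*\<rho>) \<perp>\<^sub>L Abin (\<pi>/2) 2 (2*\<rho>)} else {}) \<union>
     (\<Union>s. (\<lambda>D. Hpow h \<perp>\<^sub>L bin_lattice s D) ` disc_classes))"
proof -
  define c where "c s D = (if s then nonnorm D else 1)" for s D
  let ?Q = "Abin (1/2) 2 (2*\<rho>) \<perp>\<^sub>L Abin (\<pi>/2) 2 (2*\<rho>)"
  define K where "K = {(h + 1, 0\<^sub>m 0 0, {#})} \<union> (if h \<ge> 1 then {(h - 1, ?Q, quat)} else {}) \<union>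
    (\<Union>s. (\<lambda>D. (h, bin_lattice s D, bin (c s D) D)) ` disc_classes)"
  have cnz: "c s D \<noteq> 0" if "D \<in> disc_classes" for s D using nonnorm_props(1)[OF that] by (simp add: c_def)
  have ck: "kern (bin_lattice s D) (bin (c s D) D)" if "D \<in> disc_classes" for s D
    using nonnorm_props(4)[OF that] by (simp add: c_def)
  have cnn: "c s D / c t D \<notin> normgroup D" if "D \<in> disc_classes" "s \<noteq> t" for s t D
    using nonnorm_props(1,2)[OF that(1)] that(2) normgroup_inverse[of "1 / nonnorm D" D]
    by (cases s; cases t) (auto simp: c_def)
  have Kcases: "(k, A, x) = (h + 1, 0\<^sub>m 0 0, {#}) \<or> (h \<ge> 1 \<and> (k, A, x) = (h - 1, ?Q, quat)) \<or>
      (\<exists>s. \<exists>D\<in>disc_classes. (k, A, x) = (h, bin_lattice s D, bin (c s D) D))"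
    if "(k, A, x) \<in> K" for k A x
    using that unfolding K_def by (auto split: if_splits)
  have K0: "(h + 1, 0\<^sub>m 0 0, {#}) \<in> K" and KQ: "h \<ge> 1 \<Longrightarrow> (h - 1, ?Q, quat) \<in> K"
    and KB: "D \<in> disc_classes \<Longrightarrow> (h, bin_lattice s D, bin (c s D) D) \<in> K" for s D
    unfolding K_def by auto
  have quat_bin: "mrep quat (bin (c s D) D)" if "D \<in> disc_classes" for s D
    using quat_rep_bin[OF cnz[OF that] disc_nz[OF that] disc_nonsquare[OF that]] meq_mrep_trans(1) mrep_drop by metis
  have bin_quat: "mrep (hyp 2 + bin (c s D) D) quat" if D: "D \<in> disc_classes" for s D
  proof -
    obtain x y where xy: "x \<noteq> 0" "y \<noteq> 0" "meq quat (bin (c s D) D + {#x, y#})"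
      using quat_rep_bin[OF cnz[OF D] disc_nz[OF D] disc_nonsquare[OF D]] by blast
    have "mrep (hyp 2 + bin (c s D) D) ({#x, y#} + bin (c s D) D)" by (intro mrep_add hyp_2_rep xy mrep_refl)
    also have "meq ({#x, y#} + bin (c s D) D) quat" using meq_sym[OF xy(3)] by (simp add: add.commute)
    finally show ?thesis .
  qed
  have hyp2_bin: "mrep (hyp 2) (bin (c s D) D)" if "D \<in> disc_classes" for s D
    using hyp_2_rep[OF cnz[OF that], of "- (c s D * D)"] cnz[OF that] disc_nz[OF that] by (simp add: bin_def)
  have bin_bin: "mrep (hyp 1 + bin (c s D) D) (bin (c t E) E)"
    if D: "D \<in> disc_classes" "E \<in> disc_classes" "(t, E) \<noteq> (\<not> s, D)" for s t D E
  proof (cases "D = E")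
    case True
    then have "t = s" using D by auto
    then show ?thesis using True mrep_drop[of "bin (c s D) D" "hyp 1"] by (simp add: add.commute)
  next
    case False
    then have "\<not> sqeq D E" using classes_inj D by (auto simp: disc_classes_def)
    \<comment> \<open>A common value of the two planes; the hyperbolic plane supplies the second
      entry of \<open>bin w E\<close>.\<close>
    then obtain w where w: "w \<noteq> 0" "w / c s D \<in> normgroup D" "w / c t E \<in> normgroup E"
      using norm_cosets_meet[OF disc_nz disc_nz _ cnz cnz] D by metis
    have 1: "mrep (bin (c s D) D) {#w#}"
      using bin_eq[OF cnz[OF D(1)] w(2)] meq_mrep_trans(1) mrep_subset[of "{#w#}" "bin w D"] by (auto simp: bin_def)
    have "mrep (hyp 1 + bin (c s D) D) ({#- (w * E)#} + {#w#})"
      by (intro mrep_add hyp_1_rep 1) (use w disc_nz[OF D(2)] in simp)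
    also have "{#- (w * E)#} + {#w#} = bin w E" by (simp add: bin_def add_mset_commute)
    also have "meq (bin w E) (bin (c t E) E)" by (rule meq_sym[OF bin_eq[OF cnz[OF D(2)] w(3)]])
    finally show ?thesis .
  qed
  have "minimal_testing_set v n ((\<lambda>(k, A, x). Hpow k \<perp>\<^sub>L A) ` K)"
  proof (rule minimal_testing_setI)
    fix k A x assume "(k, A, x) \<in> K"
    from Kcases[OF this] show "kern A x \<and> 2 * k + size x = n"
      using kern_empty kern_quat ck n by (auto simp: quat_def bin_def)
  next
    fix y :: "'a multiset" assume y: "0 \<notin># y" "size y = n"
    have "y \<noteq> {#}" using y n by auto
    moreover have "size y \<noteq> 2 * k + 1" "size y \<noteq> 2 * k + 3" for k using y n by presburger+
    ultimately consider
      k a D where "a \<noteq> 0" "D \<noteq> 0" "size y = 2 * k + 2" "mrep (hyp k + bin a D) y" |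
      k where "size y = 2 * k + 4" "mrep (hyp k + quat) y"
      using kernel_cover[OF y(1)] by blast
    then show "\<exists>k A x. (k, A, x) \<in> K \<and> mrep (hyp k + x) y"
    proof cases
      case 1
      have k: "k = h" using 1(3) y n by simp
      show ?thesis
      proof (cases "sqeq D 1")
        case True
        have "meq (hyp 1) (bin a 1)" using bin_hyp[of 1 a] 1(1) by (simp add: hyp_Suc)
        also have "meq (bin a 1) (bin a D)" by (rule bin_sqeq[OF sqeq_sym[OF True]])
        finally have "mrep (hyp h + hyp 1) (hyp k + bin a D)" unfolding k by (intro mrep_add_left meq_mrep)
        then have "mrep (hyp h + hyp 1) y" using 1(4) by (rule mrep_trans)
        then have "mrep (hyp (h + 1) + {#}) y" by (simp only: hyp_add add_0_right)
        then show ?thesis using K0 by blast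
      next
        case False
        obtain E where E: "E \<in> U \<union> nonunit_classes" "sqeq D E" using classes_cover[OF 1(2)] by blast
        then have Ed: "E \<in> disc_classes" using False by (auto simp: disc_classes_def)
        have "\<exists>s. a / c s E \<in> normgroup E"
        proof (cases "a \<in> normgroup E")
          case True then show ?thesis by (intro exI[of _ False]) (simp add: c_def)
        next
          case False
          then have "a * nonnorm E \<in> normgroup E" using nonnorm_props(3)[OF Ed] 1(1) by blast
          then have "a * nonnorm E / (nonnorm E)^2 \<in> normgroup E"
            by (rule normgroup_divide[OF _ normgroup_square]) (rule nonnorm_props(1)[OF Ed])
          then show ?thesis using nonnorm_props(1)[OF Ed]
            by (intro exI[of _ True]) (simp add: c_def power2_eq_square)
        qed
        then obtain s where s: "a / c s E \<in> normgroup E" by blast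
        have "meq (bin (c s E) E) (bin a E)" by (rule bin_eq[OF cnz[OF Ed] s])
        also have "meq (bin a E) (bin a D)" by (rule bin_sqeq[OF sqeq_sym[OF E(2)]])
        finally have "mrep (hyp h + bin (c s E) E) (hyp k + bin a D)" unfolding k by (intro mrep_add_left meq_mrep)
        then have "mrep (hyp h + bin (c s E) E) y" using 1(4) by (rule mrep_trans)
        then show ?thesis using KB[OF Ed] by blast
      qed
    next
      case 2
      then have "k = h - 1" "h \<ge> 1" using y n by auto
      then show ?thesis using 2 KQ by blast
    qed
  next
    fix k A x assume "(k, A, x) \<in> K"
    from Kcases[OF this] consider "(k, A, x) = (h + 1, 0\<^sub>m 0 0, {#})" | "h \<ge> 1" "(k, A, x) = (h - 1, ?Q, quat)"
      | s D where "D \<in> disc_classes" "(k, A, x) = (h, bin_lattice s D, bin (c s D) D)" by blast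
    then show "\<exists>k' A' x'. kern A' x' \<and> \<not> mrep (hyp k' + x') (hyp k + x) \<and>
      (\<forall>k2 A2 x2. (k2, A2, x2) \<in> K \<longrightarrow> (k2, A2, x2) \<noteq> (k, A, x) \<longrightarrow> mrep (hyp k' + x') (hyp k2 + x2))"
    proof cases
      case 1
      show ?thesis
      proof (intro exI conjI allI impI)
        show "kern ?Q quat" by (rule kern_quat)
        show "\<not> mrep (hyp h + quat) (hyp k + x)"
          using hyp_cancel[of h quat "hyp 1"] quat_not_hyp 1 hyp_add[of h 1, where 'a='a] by auto
        fix k2 A2 x2 assume t2: "(k2, A2, x2) \<in> K" "(k2, A2, x2) \<noteq> (k, A, x)"
        from Kcases[OF t2(1)] t2(2) 1 consider "h \<ge> 1" "k2 = h - 1" "x2 = quat"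
          | s D where "D \<in> disc_classes" "k2 = h" "x2 = bin (c s D) D" by blast
        then show "mrep (hyp h + quat) (hyp k2 + x2)"
        proof cases
          case 1
          have "mrep (hyp 1 + quat) quat" using mrep_drop[of quat "hyp 1"] by (simp add: add.commute)
          then show ?thesis using hyp_lift[of 1 quat quat "h - 1"] 1 by simp
        next
          case 2
          then show ?thesis using mrep_add_left[OF quat_bin] by blast
        qed
      qed
    next
      case 2
      show ?thesis
      proof (intro exI conjI allI impI)
        show "kern (0\<^sub>m 0 0) ({#} :: 'a multiset)" by (rule kern_empty)
        show "\<not> mrep (hyp (h + 2) + {#}) (hyp k + x)"
          using hyp_cancel_le[of "h - 1" 3 "{#}" quat] hyp_3_not_quat 2 by auto
        fix k2 A2 x2 assume t2: "(k2, A2, x2) \<in> K" "(k2, A2, x2) \<noteq> (k, A, x)"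
        from Kcases[OF t2(1)] t2(2) 2 consider "k2 = h + 1" "x2 = {#}"
          | s D where "D \<in> disc_classes" "k2 = h" "x2 = bin (c s D) D" by blast
        then show "mrep (hyp (h + 2) + {#}) (hyp k2 + x2)"
        proof cases
          case 1
          then show ?thesis using mrep_drop[of "hyp (h + 1)" "hyp 1"] hyp_add[of "h + 1" 1, where 'a='a] by simp
        next
          case 2
          then show ?thesis using mrep_add_left[OF hyp2_bin, of D "hyp h" s] by (simp only: hyp_add add_0_right)
        qed
      qed
    next
      case 3
      show ?thesis
      proof (intro exI conjI allI impI)
        show "kern (bin_lattice (\<not> s) D) (bin (c (\<not> s) D) D)" by (rule ck[OF 3(1)])
        show "\<not> mrep (hyp (h + 1) + bin (c (\<not> s) D) D) (hyp k + x)"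
          using hyp_cancel_le[of h 1 "bin (c (\<not> s) D) D" "bin (c s D) D"] 3(2)
            bin_not_rep[OF cnz cnz disc_nz disc_nonsquare cnn, OF 3(1) 3(1) 3(1) 3(1) 3(1), of "\<not> s" s] by auto
        fix k2 A2 x2 assume t2: "(k2, A2, x2) \<in> K" "(k2, A2, x2) \<noteq> (k, A, x)"
        from Kcases[OF t2(1)] t2(2) 3 consider "k2 = h + 1" "x2 = {#}" | "h \<ge> 1" "k2 = h - 1" "x2 = quat"
          | t E where "E \<in> disc_classes" "k2 = h" "x2 = bin (c t E) E" "(t, E) \<noteq> (s, D)" by blast
        then show "mrep (hyp (h + 1) + bin (c (\<not> s) D) D) (hyp k2 + x2)"
        proof cases
          case 1
          then show ?thesis using mrep_drop by simp
        next
          case 2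
          then show ?thesis using hyp_lift[OF bin_quat[OF 3(1), of "\<not> s"], of "h - 1"] by simp
        next
          case E: 3
          then show ?thesis using hyp_lift[OF bin_bin[OF 3(1) E(1), of t "\<not> s"], of h] by simp
        qed
      qed
    qed
  qed
  moreover have "(\<lambda>(k, A, x). Hpow k \<perp>\<^sub>L A) ` K = {Hpow (h + 1)} \<union>
     (if h \<ge> 1 then {Hpow (h - 1) \<perp>\<^sub>L ?Q} else {}) \<union>
     (\<Union>s. (\<lambda>D. Hpow h \<perp>\<^sub>L bin_lattice s D) ` disc_classes)"
    unfolding K_def by (simp add: image_Un image_UN image_image)
  ultimately show ?thesis by metis
qed

end

theorem theorem1p2:
  fixes v :: "'a::field \<Rightarrow> int" and \<rho> \<pi> :: 'a and U :: "'a set" and n :: nat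
  assumes F: "dyadic_local_field v"
    and rho: "unitO v \<rho>" "dideal v (1 - 4 * \<rho>) = frac_ideal v 4"
    and pi: "\<pi> \<noteq> 0" "v \<pi> = 1"
    and U_units: "U \<subseteq> {x. unitO v x}"
    and U_reps: "\<forall>u. unitO v u \<longrightarrow> (\<exists>!\<delta>\<in>U. \<exists>w. unitO v w \<and> u = \<delta> * w^2)"
    and U_1: "1 \<in> U" and U_Delta: "1 - 4 * \<rho> \<in> U"
    and U_d: "\<forall>\<delta>\<in>U. dval v \<delta> = (if \<delta> = 1 then \<infinity> else enat (nat (v (\<delta> - 1))))"
    and n: "n \<ge> 2"
  shows
   "(even n \<longrightarrow> minimal_testing_set v n (
       {Hpow (n div 2)}
     \<union> (if n \<ge> 4 then {Hpow ((n - 4) div 2) \<perp>\<^sub>L Abin (1/2) 2 (2*\<rho>) \<perp>\<^sub>L Abin (\<pi>/2) 2 (2*\<rho>)} else {})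
     \<union> {Hpow ((n - 2) div 2) \<perp>\<^sub>L Abin (1/2) 2 (2*\<rho>)}
     \<union> {Hpow ((n - 2) div 2) \<perp>\<^sub>L Abin (\<pi>/2) 2 (2*\<rho>)}
     \<union> (\<lambda>\<delta>. Hpow ((n - 2) div 2) \<perp>\<^sub>L
              Abin (\<pi> powi ((1 - dint v \<delta>) div 2)) (\<pi> powi ((dint v \<delta> - 1) div 2))
                   (- (\<delta> - 1) * \<pi> powi ((1 - dint v \<delta>) div 2))) ` (U - {1, 1 - 4 * \<rho>})
     \<union> (\<lambda>\<delta>. Hpow ((n - 2) div 2) \<perp>\<^sub>L
              Abin ((1 + 4 * \<rho> * inverse (\<delta> - 1)) * \<pi> powi ((1 - dint v \<delta>) div 2))
                   (\<pi> powi ((dint v \<delta> - 1) div 2))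
                   (- (\<delta> - 1) * \<pi> powi ((1 - dint v \<delta>) div 2))) ` (U - {1, 1 - 4 * \<rho>})
     \<union> (\<lambda>\<epsilon>. Hpow ((n - 2) div 2) \<perp>\<^sub>L diagL [1, - \<epsilon> * \<pi>]) ` U
     \<union> (\<lambda>\<epsilon>. Hpow ((n - 2) div 2) \<perp>\<^sub>L diagL [1 - 4 * \<rho>, - (1 - 4 * \<rho>) * \<epsilon> * \<pi>]) ` U))
  \<and> (odd n \<longrightarrow> minimal_testing_set v n (
       (\<lambda>\<epsilon>. Hpow ((n - 1) div 2) \<perp>\<^sub>L diagL [\<epsilon>]) ` U
     \<union> (\<lambda>\<epsilon>. Hpow ((n - 3) div 2) \<perp>\<^sub>L Abin (\<pi>/2) 2 (2*\<rho>) \<perp>\<^sub>L diagL [(1 - 4 * \<rho>) * \<epsilon>]) ` U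
     \<union> (\<lambda>\<epsilon>. Hpow ((n - 1) div 2) \<perp>\<^sub>L diagL [\<epsilon> * \<pi>]) ` U
     \<union> (\<lambda>\<epsilon>. Hpow ((n - 3) div 2) \<perp>\<^sub>L Abin (1/2) 2 (2*\<rho>) \<perp>\<^sub>L diagL [(1 - 4 * \<rho>) * \<epsilon> * \<pi>]) ` U))"
proof -
  interpret dyadic_pi v \<rho> \<pi>
    using F rho pi by unfold_locales
  interpret dyadic_sys v \<rho> \<pi> U
    using U_units U_reps U_1 U_Delta U_d by unfold_locales (simp_all add: Delta_def)
  have notU: "\<epsilon> * \<pi> \<notin> U" "\<epsilon> * \<pi> \<noteq> \<Delta>" if "\<epsilon> \<in> U" for \<epsilon>
    using nonunit_v[of "\<epsilon> * \<pi>"] U_v[of "\<epsilon> * \<pi>"] that by (auto simp: nonunit_classes_def)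
  have D1: "\<Delta> \<noteq> 1" using Delta_nonsquare by auto
  show ?thesis
  proof (intro conjI impI, goal_cases)
    case 1
    then obtain h where h: "n = 2 * h + 2" using n by (metis add.commute dvdE le_Suc_ex mult_2_right even_add even_numeral)
    have I: "n div 2 = h + 1" "(n - 4) div 2 = h - 1" "(n - 2) div 2 = h" "(n \<ge> 4) = (h \<ge> 1)"
      using h by auto
    \<comment> \<open>The parameter \<open>\<Delta>\<close>, the other units and the primes give the
      three pairs of binary families in the list; each pair is indexed by the flag of
      \<open>bin_lattice\<close>.\<close>
    have dc: "disc_classes = {\<Delta>} \<union> (U - {1, \<Delta>}) \<union> (\<lambda>\<epsilon>. \<epsilon> * \<pi>) ` U"
      using dyadic_sys.U_Delta[OF dyadic_sys_axioms] D1 by (auto simp: disc_classes_def nonunit_classes_def)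
    have b1: "bin_lattice s \<Delta> = Abin ((if s then \<pi> else 1) / 2) 2 (2 * \<rho>)" for s
      by (simp add: bin_lattice_def)
    have b2: "bin_lattice s \<delta> = Abin ((if s then 1 + 4 * \<rho> * inverse (\<delta> - 1) else 1) * \<pi> powi ((1 - dint v \<delta>) div 2))
        (\<pi> powi ((dint v \<delta> - 1) div 2)) (- (\<delta> - 1) * \<pi> powi ((1 - dint v \<delta>) div 2))" if "\<delta> \<in> U - {1, \<Delta>}" for s \<delta>
      using that by (simp add: bin_lattice_def nonnorm_def)
    have b3: "bin_lattice s (\<epsilon> * \<pi>) = diagL [if s then \<Delta> else 1, - (if s then \<Delta> else 1) * \<epsilon> * \<pi>]" if "\<epsilon> \<in> U" for s \<epsilon>
      using notU[OF that] by (simp add: bin_lattice_def mult.assoc)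
    have UN_bool: "(\<Union>s. X s) = X False \<union> X True" for X :: "bool \<Rightarrow> 'a mat set"
      by (auto simp: UNIV_bool)
    have im: "(\<lambda>D. Hpow h \<perp>\<^sub>L bin_lattice s D) ` disc_classes =
      {Hpow h \<perp>\<^sub>L Abin ((if s then \<pi> else 1) / 2) 2 (2 * \<rho>)} \<union>
      (\<lambda>\<delta>. Hpow h \<perp>\<^sub>L Abin ((if s then 1 + 4 * \<rho> * inverse (\<delta> - 1) else 1) * \<pi> powi ((1 - dint v \<delta>) div 2))
        (\<pi> powi ((dint v \<delta> - 1) div 2)) (- (\<delta> - 1) * \<pi> powi ((1 - dint v \<delta>) div 2))) ` (U - {1, \<Delta>}) \<union>
      (\<lambda>\<epsilon>. Hpow h \<perp>\<^sub>L diagL [if s then \<Delta> else 1, - (if s then \<Delta> else 1) * \<epsilon> * \<pi>]) ` U" for s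
      unfolding dc image_Un image_image by (intro arg_cong2[of _ _ _ _ "(\<union>)"] image_cong refl) (simp_all add: b1 b2 b3)
    show ?case
      using minimal_even[OF h]
      by (simp only: UN_bool I im if_True if_False mult_1_left mult_minus1 Delta_def Un_ac)
  next
    case 2
    then obtain m where m: "n = 2 * m + 1" by (elim oddE)
    \<comment> \<open>Here \<open>m \<ge> 1\<close> because \<open>n\<close> is odd and at least 2,
      so the truncated subtraction is exact.\<close>
    define h where "h = m - 1"
    have h: "n = 2 * h + 3" using m n by (simp add: h_def)
    have I: "(n - 1) div 2 = h + 1" "(n - 3) div 2 = h" using h by auto
    have im: "(\<lambda>a. Hpow h \<perp>\<^sub>L tern_lattice a) ` (U \<union> nonunit_classes) =
      (\<lambda>\<epsilon>. Hpow h \<perp>\<^sub>L Abin (\<pi>/2) 2 (2*\<rho>) \<perp>\<^sub>L diagL [\<Delta> * \<epsilon>]) ` U \<union>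
      (\<lambda>\<epsilon>. Hpow h \<perp>\<^sub>L Abin (1/2) 2 (2*\<rho>) \<perp>\<^sub>L diagL [\<Delta> * \<epsilon> * \<pi>]) ` U"
      unfolding nonunit_classes_def image_Un image_image
      by (intro arg_cong2[of _ _ _ _ "(\<union>)"] image_cong refl) (simp_all add: tern_lattice_def notU mult.assoc)
    show ?case
      using minimal_odd[OF h, unfolded im] unfolding I nonunit_classes_def image_Un image_image Delta_def
      by (simp only: Un_ac)
  qed
qed

end
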